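(* The Fullwood–Parzygnat state over time function $\star_{FP}$ satisfies axioms (E), (P), (CC) and (T), and it is the only state over time function that satisfies all four axioms (E), (P), (CC) and (T).
   Context: All systems $A,B,C,E,\dots$ are finite-dimensional Hilbert spaces; a system may also be a subspace of a larger Hilbert space. $\mathfrak{B}(A)$ denotes the linear operators on $A$, $\mathfrak{S}(A)$ the density operators, $\mathfrak{C}(A,B)$ the quantum channels (completely positive trace-preserving linear maps $\mathfrak{B}(A)\to\mathfrak{B}(B)$). $|A|=\dim A$, $\mathbb{1}_A$ is the identity (also the orthogonal projector onto $A$ when $A$ is a subspace), $\pi_A=\mathbb{1}_A/|A|$. $A'$ denotes a copy of $A$ (isomorphic systems are identified), $\mathrm{id}_{A'|A}$ is the identity channel, $F_{AA'}$ the swap operator, $\mathrm{Ad}_X(Y)=XYX^\dagger$, $[X,Y]=XY-YX$, $\{X,Y\}=XY+YX$. A subscript $\mathcal{E}_{B|A}$ indicates input $A$ and output $B$; $\mathcal{E}_{B|A'}$ is the same map acting on the copy $A'$. The Jamiołkowski state of $\mathcal{E}_{B|A}$ is $\mathscr{D}[\mathcal{E}]=(\mathrm{id}_A\otimes\mathcal{E}_{B|A'})(F_{AA'})\in\mathfrak{B}(A\otimes B)$. A state over time function assigns to all systems $A,B$ a map $\star:\mathfrak{C}(A,B)\times\mathfrak{S}(A)\to\mathfrak{B}(A\otimes B)$, $(\mathcal{E},\rho)\mapsto\mathcal{E}_{B|A}\star\rho_A$, such that $\mathrm{Tr}_A[\mathcal{E}\star\rho]=\mathcal{E}(\rho)$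 and $\mathrm{Tr}_B[\mathcal{E}\star\rho]=\rho$; it is extended homogeneously by $(\lambda\mathcal{E})\star\rho=\mathcal{E}\star(\lambda\rho)=\lambda(\mathcal{E}\star\rho)$, $\lambda\in\mathbb{C}$. A quantum state over spacetime on $A\otimes E$ is either a density operator on $A\otimes E$ or an operator of the form $\mathcal{F}\star\sigma$. The Fullwood–Parzygnat function is $\mathcal{E}_{B|A}\star_{FP}\rho_A=\tfrac12\{\rho_A\otimes\mathbb{1}_B,\mathscr{D}[\mathcal{E}]\}$. Axiom (E) (completeness): for all systems $A,B,E$, every quantum state over spacetime $\rho_{AE}$ and every channel $\mathcal{E}_{B|A}$, an operator $\mathcal{E}_{B|A}\star\rho_{AE}$ on $A\otimes B\otimes E$ is defined such that for every completely positive trace-non-increasing map $\mathcal{I}_E$ on $E$, $\mathcal{I}_E[\mathcal{E}_{B|A}\star\rho_{AE}]=\mathcal{E}_{B|A}\star\mathcal{I}_E(\rho_{AE})$, and $\mathrm{Tr}_A[\mathcal{E}_{B|A}\star\rho_{AE}]=(\mathcal{E}_{B|A}\otimes\mathrm{id}_E)(\rho_{AE})$. Axiom (P) (compositionality): for all channels $\mathcal{E}_{B|A}$, $\mathcal{F}_{C|B}$ and states $\rho_A$, $\mathrm{Tr}_B[\mathcal{F}_{C|B}\star(\mathcal{E}_{B|A}\star\rho_A)]=(\mathcal{F}\circ\mathcal{E})_{C|A}\star\rho_A$, where $\mathcal{F}_{C|B}\star(\cdot)$ acts on the $B$-part of the state over spacetime on $A\otimes B$ (with $A$ as spectator system, as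 in axiom (E)). Axiom (CC) (classical conditionability): for every orthogonal decomposition $A=\bigoplus_i A_i$, every channel $\mathcal{E}_{B|A}$ with $\mathcal{E}_{B|A}\circ(\sum_i\mathrm{Ad}_{\mathbb{1}_{A_i}})=\mathcal{E}_{B|A}$ and every probability distribution $\{\lambda_i\}$, $\mathcal{E}_{B|A}\star(\sum_i\lambda_i\pi_{A_i})=\sum_i\lambda_i\,\mathcal{E}_{B|A_i}\star\pi_{A_i}$, where $\mathcal{E}_{B|A_i}=\mathcal{E}_{B|A}\circ\mathrm{Ad}_{\mathbb{1}_{A_i}}$ is regarded as a channel from the subspace system $A_i$ to $B$ and $\mathcal{E}_{B|A_i}\star\pi_{A_i}\in\mathfrak{B}(A_i\otimes B)\subseteq\mathfrak{B}(A\otimes B)$. Axiom (T) (time reversal symmetry): for every system $A$, with $B$ a copy of $A$, and every $\rho_A\in\mathfrak{S}(A)$, $F_{AB}(\mathrm{id}_{B|A}\star\rho_A)F_{AB}=\mathrm{id}_{B|A}\star\rho_A$. *)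

theory Defs
  imports "Jordan_Normal_Form.Matrix" "Jordan_Normal_Form.Conjugate"
begin

type_synonym cmat = "complex mat"

text \<open>A system is a subspace of some C^n (n = ambient dimension), represented by the
  pair (n, P) where P is the (nonzero) orthogonal projector onto the subspace.\<close>
type_synonym system = "nat \<times> complex mat"

definition mtrace :: "cmat \<Rightarrow> complex" where
  "mtrace X = (\<Sum>i<dim_row X. X $$ (i,i))"

definition sdim :: "system \<Rightarrow> nat" where "sdim S = fst S"
definition sproj :: "system \<Rightarrow> cmat" where "sproj S = snd S"

definition adj :: "cmat \<Rightarrow> cmat" where
  "adj X = mat (dim_col X) (dim_row X) (\<lambda>(i,j). cnj (X $$ (j,i)))"

definition is_system :: "system \<Rightarrow> bool" where
  "is_system S \<longleftrightarrow> 1 \<le> sdim S \<and> sproj S \<in> carrier_mat (sdim S) (sdim S)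
     \<and> sproj S * sproj S = sproj S \<and> adj (sproj S) = sproj S
     \<and> sproj S \<noteq> 0\<^sub>m (sdim S) (sdim S)"

text \<open>Kronecker (tensor) product of matrices, index (i,k) \<mapsto> i * dim + k.\<close>
definition kron :: "cmat \<Rightarrow> cmat \<Rightarrow> cmat" where
  "kron X Y = mat (dim_row X * dim_row Y) (dim_col X * dim_col Y)
     (\<lambda>(i,j). X $$ (i div dim_row Y, j div dim_col Y) * Y $$ (i mod dim_row Y, j mod dim_col Y))"

definition stensor :: "system \<Rightarrow> system \<Rightarrow> system" where
  "stensor S T = (sdim S * sdim T, kron (sproj S) (sproj T))"

definition triv_sys :: system where "triv_sys = (1, 1\<^sub>m 1)"

definition full_sys :: "nat \<Rightarrow> system" where "full_sys k = (k, 1\<^sub>m k)"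

definition ops :: "system \<Rightarrow> cmat set" where
  "ops S = {X. X \<in> carrier_mat (sdim S) (sdim S) \<and> sproj S * X * sproj S = X}"

definition psd :: "nat \<Rightarrow> cmat \<Rightarrow> bool" where
  "psd n X \<longleftrightarrow> X \<in> carrier_mat n n \<and>
     (\<forall>v \<in> carrier_vec n. Im (\<Sum>i<n. cnj (v $ i) * (X *\<^sub>v v) $ i) = 0
                         \<and> 0 \<le> Re (\<Sum>i<n. cnj (v $ i) * (X *\<^sub>v v) $ i))"

definition is_state :: "system \<Rightarrow> cmat \<Rightarrow> bool" where
  "is_state S X \<longleftrightarrow> X \<in> ops S \<and> psd (sdim S) X \<and> mtrace X = 1"

definition maxmix :: "system \<Rightarrow> cmat" where
  "maxmix S = (1 / mtrace (sproj S)) \<cdot>\<^sub>m sproj S"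

definition ptrace_left :: "nat \<Rightarrow> nat \<Rightarrow> cmat \<Rightarrow> cmat" where
  "ptrace_left n m M = mat m m (\<lambda>(b,c). \<Sum>a<n. M $$ (a*m+b, a*m+c))"

definition ptrace_right :: "nat \<Rightarrow> nat \<Rightarrow> cmat \<Rightarrow> cmat" where
  "ptrace_right n m M = mat n n (\<lambda>(a,c). \<Sum>b<m. M $$ (a*m+b, c*m+b))"

text \<open>(id_k \<otimes> Phi)(M), Phi mapping n x n matrices to m x m matrices, M on C^k \<otimes> C^n.\<close>
definition map_right :: "nat \<Rightarrow> nat \<Rightarrow> nat \<Rightarrow> (cmat \<Rightarrow> cmat) \<Rightarrow> cmat \<Rightarrow> cmat" where
  "map_right k n m Phi M = mat (k*m) (k*m) (\<lambda>(i,j).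
      Phi (mat n n (\<lambda>(b,c). M $$ ((i div m)*n + b, (j div m)*n + c))) $$ (i mod m, j mod m))"

text \<open>(Phi \<otimes> id_k)(M), Phi mapping n x n matrices to m x m matrices, M on C^n \<otimes> C^k.\<close>
definition map_left :: "nat \<Rightarrow> nat \<Rightarrow> nat \<Rightarrow> (cmat \<Rightarrow> cmat) \<Rightarrow> cmat \<Rightarrow> cmat" where
  "map_left n k m Phi M = mat (m*k) (m*k) (\<lambda>(i,j).
      Phi (mat n n (\<lambda>(a,c). M $$ (a*k + i mod k, c*k + j mod k))) $$ (i div k, j div k))"

definition swapmat :: "nat \<Rightarrow> nat \<Rightarrow> cmat" where
  "swapmat n m = mat (m*n) (n*m) (\<lambda>(i,j). if i = (j mod m)*n + j div m then 1 else 0)"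

definition swap_conj :: "system \<Rightarrow> system \<Rightarrow> cmat \<Rightarrow> cmat" where
  "swap_conj S T X = swapmat (sdim S) (sdim T) * X * swapmat (sdim T) (sdim S)"

definition swap_op :: "system \<Rightarrow> cmat" where
  "swap_op S = kron (sproj S) (sproj S) * swapmat (sdim S) (sdim S) * kron (sproj S) (sproj S)"

definition msum :: "nat \<Rightarrow> 'i set \<Rightarrow> ('i \<Rightarrow> cmat) \<Rightarrow> cmat" where
  "msum n I f = mat n n (\<lambda>ij. \<Sum>i\<in>I. f i $$ ij)"

definition linear_on :: "system \<Rightarrow> (cmat \<Rightarrow> cmat) \<Rightarrow> bool" where
  "linear_on S Phi \<longleftrightarrow> (\<forall>X\<in>ops S. \<forall>Y\<in>ops S. Phi (X + Y) = Phi X + Phi Y)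
      \<and> (\<forall>X\<in>ops S. \<forall>c. Phi (c \<cdot>\<^sub>m X) = c \<cdot>\<^sub>m Phi X)"

definition completely_positive :: "system \<Rightarrow> system \<Rightarrow> (cmat \<Rightarrow> cmat) \<Rightarrow> bool" where
  "completely_positive S T Phi \<longleftrightarrow>
     (\<forall>k M. M \<in> ops (stensor (full_sys k) S) \<and> psd (k * sdim S) M
        \<longrightarrow> psd (k * sdim T) (map_right k (sdim S) (sdim T) Phi M))"

definition is_channel :: "system \<Rightarrow> system \<Rightarrow> (cmat \<Rightarrow> cmat) \<Rightarrow> bool" where
  "is_channel S T Phi \<longleftrightarrow> (\<forall>X\<in>ops S. Phi X \<in> ops T) \<and> linear_on S Phi
     \<and> completely_positive S T Phi \<and> (\<forall>X\<in>ops S. mtrace (Phi X) = mtrace X)"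

definition is_cptni :: "system \<Rightarrow> system \<Rightarrow> (cmat \<Rightarrow> cmat) \<Rightarrow> bool" where
  "is_cptni S T Phi \<longleftrightarrow> (\<forall>X\<in>ops S. Phi X \<in> ops T) \<and> linear_on S Phi
     \<and> completely_positive S T Phi
     \<and> (\<forall>X\<in>ops S. psd (sdim S) X \<longrightarrow> Re (mtrace (Phi X)) \<le> Re (mtrace X))"

text \<open>star A B Phi rho stands for Phi_{B|A} \<star> rho_A.\<close>
type_synonym sotf = "system \<Rightarrow> system \<Rightarrow> (cmat \<Rightarrow> cmat) \<Rightarrow> cmat \<Rightarrow> cmat"

definition is_sotf :: "sotf \<Rightarrow> bool" where
  "is_sotf star \<longleftrightarrow> (\<forall>A B Phi rho. is_system A \<and> is_system B \<and> is_channel A B Phi \<and> is_state A rho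
     \<longrightarrow> star A B Phi rho \<in> ops (stensor A B)
       \<and> ptrace_left (sdim A) (sdim B) (star A B Phi rho) = Phi rho
       \<and> ptrace_right (sdim A) (sdim B) (star A B Phi rho) = rho)"

definition jam :: "system \<Rightarrow> system \<Rightarrow> (cmat \<Rightarrow> cmat) \<Rightarrow> cmat" where
  "jam A B Phi = map_right (sdim A) (sdim A) (sdim B) Phi (swap_op A)"

definition fp :: sotf where
  "fp A B Phi rho = (1/2) \<cdot>\<^sub>m (kron rho (sproj B) * jam A B Phi + jam A B Phi * kron rho (sproj B))"

text \<open>Quantum states over spacetime on A \<otimes> E (either tensor order of a state over time).\<close>
definition qsost :: "sotf \<Rightarrow> system \<Rightarrow> system \<Rightarrow> cmat \<Rightarrow> bool" where
  "qsost star A E X \<longleftrightarrow> is_state (stensor A E) X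
     \<or> (\<exists>F sigma. is_channel A E F \<and> is_state A sigma \<and> X = star A E F sigma)
     \<or> (\<exists>F sigma. is_channel E A F \<and> is_state E sigma \<and> X = swap_conj E A (star E A F sigma))"

text \<open>ext A B E Phi rhoAE stands for Phi_{B|A} \<star> rho_{AE}, an operator on A \<otimes> B \<otimes> E.
  It must agree with (the homogeneous extension of) star for the trivial system E = C.\<close>
definition valid_ext :: "sotf \<Rightarrow> (system \<Rightarrow> system \<Rightarrow> system \<Rightarrow> (cmat \<Rightarrow> cmat) \<Rightarrow> cmat \<Rightarrow> cmat) \<Rightarrow> bool" where
  "valid_ext star ext \<longleftrightarrow>
     (\<forall>A B Phi rho c. is_system A \<and> is_system B \<and> is_channel A B Phi \<and> is_state A rho
        \<longrightarrow> ext A B triv_sys Phi (c \<cdot>\<^sub>m rho) = c \<cdot>\<^sub>m star A B Phi rho)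
   \<and> (\<forall>A B E Phi rho. is_system A \<and> is_system B \<and> is_system E \<and> is_channel A B Phi \<and> qsost star A E rho
        \<longrightarrow> ext A B E Phi rho \<in> ops (stensor (stensor A B) E)
          \<and> ptrace_left (sdim A) (sdim B * sdim E) (ext A B E Phi rho)
              = map_left (sdim A) (sdim E) (sdim B) Phi rho
          \<and> (\<forall>E' I. is_system E' \<and> is_cptni E E' I \<longrightarrow>
               map_right (sdim A * sdim B) (sdim E) (sdim E') I (ext A B E Phi rho)
                 = ext A B E' Phi (map_right (sdim A) (sdim E) (sdim E') I rho)))"

definition axiom_E :: "sotf \<Rightarrow> bool" where
  "axiom_E star \<longleftrightarrow> (\<exists>ext. valid_ext star ext)"

definition axiom_P :: "sotf \<Rightarrow> bool" where
  "axiom_P star \<longleftrightarrow> (\<exists>ext. valid_ext star ext \<and>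
     (\<forall>A B C Phi Psi rho. is_system A \<and> is_system B \<and> is_system C \<and> is_channel A B Phi
        \<and> is_channel B C Psi \<and> is_state A rho \<longrightarrow>
        swap_conj C A (ptrace_left (sdim B) (sdim C * sdim A)
            (ext B C A Psi (swap_conj A B (star A B Phi rho))))
          = star A C (Psi \<circ> Phi) rho))"

definition axiom_CC :: "sotf \<Rightarrow> bool" where
  "axiom_CC star \<longleftrightarrow> (\<forall>A B (I::nat set) Ps Phi lam.
     is_system A \<and> is_system B \<and> finite I
     \<and> (\<forall>i\<in>I. is_system (sdim A, Ps i))
     \<and> (\<forall>i\<in>I. \<forall>j\<in>I. i \<noteq> j \<longrightarrow> Ps i * Ps j = 0\<^sub>m (sdim A) (sdim A))
     \<and> msum (sdim A) I Ps = sproj A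
     \<and> is_channel A B Phi
     \<and> (\<forall>X\<in>ops A. Phi (msum (sdim A) I (\<lambda>i. Ps i * X * Ps i)) = Phi X)
     \<and> (\<forall>i\<in>I. 0 \<le> lam i) \<and> (\<Sum>i\<in>I. lam i) = (1::real)
     \<longrightarrow> star A B Phi (msum (sdim A) I (\<lambda>i. complex_of_real (lam i) \<cdot>\<^sub>m maxmix (sdim A, Ps i)))
       = msum (sdim A * sdim B) I (\<lambda>i. complex_of_real (lam i) \<cdot>\<^sub>m
            star (sdim A, Ps i) B (\<lambda>X. Phi (Ps i * X * Ps i)) (maxmix (sdim A, Ps i))))"

definition axiom_T :: "sotf \<Rightarrow> bool" where
  "axiom_T star \<longleftrightarrow> (\<forall>A rho. is_system A \<and> is_state A rho \<longrightarrow>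
     swap_op A * star A A (\<lambda>X. X) rho * swap_op A = star A A (\<lambda>X. X) rho)"

end

theory Submission
  imports Defs "Jordan_Normal_Form.Schur_Decomposition"
begin

text \<open>
  Existence: on the identity channel the Fullwood--Parzygnat function has an explicit kernel that is
  linear in the state, and its value on a channel \<open>\<Phi>\<close> is \<open>id \<otimes> \<Phi>\<close> applied to that kernel. Tensoring
  this linear map with the identity of the spectator system gives the extension required by (E); it
  commutes with operations on the spectator because both are linear, and (P), (CC), (T) are read off the
  kernel.

  Uniqueness: the marginal prescribed for the extension, together with (P) for \<open>\<E> = id\<close>, gives
  \<open>\<Phi> \<star> \<rho> = (id \<otimes> \<Phi>)(id \<star> \<rho>)\<close>, so only \<open>id \<star> \<rho>\<close> has to be determined. Completeness makes it
  midpoint-affine in \<open>\<rho>\<close>. Pinching in an eigenbasis of \<open>\<rho>\<close> and applying (CC) with rank-one blocks gives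
  \<open>Tr\<^sub>2[(1 \<otimes> \<rho>)(id \<star> \<rho>)] = \<rho>\<^sup>2\<close>. If \<open>N(\<rho>)\<close> is the difference of two candidates, then
  \<open>f(\<alpha>, \<rho>, \<beta>) = Tr[(\<alpha> \<otimes> \<beta>) N(\<rho>)]\<close> vanishes for \<open>\<beta> = \<rho>\<close>, hence by polarization is antisymmetric
  in its last two arguments, while (T) makes it symmetric in the outer two. A trilinear form with both
  properties is zero.
\<close>

text \<open>A state over time function takes states only, and the proof extracts from (E) just
  midpoints of two states. One midpoint is enough to polarize
  \<open>f(\<alpha>, \<rho>, \<rho>) = 0\<close>, but the middle argument must stay a state
  throughout. The outer arguments are honestly linear, and they are extended from states to positive
  operators afterwards. The form vanishes because of a sign clash in the symmetric group: one
  transposition acts by -1, the other by +1, their product is a 3-cycle, and its cube, the identity,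
  acts by (-1)^3. The square identity holds because rank-one blocks leave no freedom: (CC) forces
  the pinched state over time to be the sum of \<lambda>_i P_i \<otimes> P_i over the
  eigenprojections of \<rho>, and pairing it with \<rho> on the second factor yields the sum of
  \<lambda>_i^2 P_i. Two arbitrary candidates are compared, so the Fullwood--Parzygnat formula is
  never derived from the axioms; it enters only as one of the candidates. Since systems are
  subspaces of some C^n, a channel is constrained only on operators P X P, and every expansion of
  its argument has to use compressed matrix units.\<close>

section \<open>Tensor product indices and entrywise matrix identities\<close>

lemma sum_tensor:
  fixes g :: "nat \<Rightarrow> 'a::comm_monoid_add"
  shows "(\<Sum>i<k*n. g i) = (\<Sum>a<k. \<Sum>b<n. g (a*n+b))"
proof -
  have "(\<Sum>i<k*n. g i) = (\<Sum>a<k. sum g {a*n..<a*n+n})"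
    by (simp add: sum.nat_group)
  also have "\<dots> = (\<Sum>a<k. \<Sum>b<n. g (a*n+b))"
  proof (rule sum.cong[OF refl])
    show "sum g {a*n..<a*n+n} = (\<Sum>b<n. g (a*n+b))" for a
      using sum.shift_bounds_nat_ivl[of g 0 "a*n" n] by (simp add: lessThan_atLeast0 add.commute)
  qed
  finally show ?thesis .
qed

lemma tensor_less [simp]:
  fixes a b k n :: nat
  assumes "a < k" "b < n"
  shows "a*n+b < k*n"
proof -
  have "a*n+b < Suc a * n" using assms(2) by simp
  also have "\<dots> \<le> k*n" using assms(1) by (intro mult_le_mono1) simp
  finally show ?thesis .
qed

lemma tensor_cases:
  fixes i :: nat
  assumes "i < k*n"
  obtains a b where "a < k" "b < n" "i = a*n+b"
proof
  show "i div n < k" using assms by (simp add: less_mult_imp_div_less)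
  show "i mod n < n" using assms by (metis mod_less_divisor mult_0_right not_gr_zero not_less_zero)
  show "i = (i div n)*n + i mod n" by simp
qed

lemma tensor_mat_eqI:
  assumes "X \<in> carrier_mat (k*n) (k*n)" "Y \<in> carrier_mat (k*n) (k*n)"
    and "\<And>a b c d. a < k \<Longrightarrow> b < n \<Longrightarrow> c < k \<Longrightarrow> d < n \<Longrightarrow> X $$ (a*n+b, c*n+d) = Y $$ (a*n+b, c*n+d)"
  shows "X = Y"
proof (rule eq_matI)
  fix i j assume "i < dim_row Y" "j < dim_col Y"
  then have "i < k*n" "j < k*n" using assms by auto
  then show "X $$ (i,j) = Y $$ (i,j)" using assms(3) by (metis tensor_cases)
qed (use assms in auto)

text \<open>The library rules have premises about \<open>dim_row\<close> and \<open>dim_col\<close>,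
  and entries of products unfold to scalar products of rows and columns. The rules below read the
  dimensions off \<open>carrier_mat\<close>, and \<open>mult_entry\<close> is applied only on
  demand.\<close>

declare index_mult_mat(1) [simp del] index_smult_mat(1) [simp del] index_add_mat(1) [simp del]

lemma smult_entry [simp]:
  "X \<in> carrier_mat n m \<Longrightarrow> i < n \<Longrightarrow> j < m \<Longrightarrow> (c \<cdot>\<^sub>m X) $$ (i,j) = c * X $$ (i,j)"
  by (auto simp: index_smult_mat(1))

lemma add_entry [simp]:
  "Y \<in> carrier_mat n m \<Longrightarrow> i < n \<Longrightarrow> j < m \<Longrightarrow> (X + Y) $$ (i,j) = X $$ (i,j) + Y $$ (i,j)"
  by (auto simp: index_add_mat(1))

lemma square_mult_carrier [simp]:
  "A \<in> carrier_mat n n \<Longrightarrow> B \<in> carrier_mat n n \<Longrightarrow> A * B \<in> carrier_mat n n"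
  by (rule mult_carrier_mat)

lemma mult_entry:
  assumes "A \<in> carrier_mat n m" "B \<in> carrier_mat m p" "i < n" "j < p"
  shows "(A * B) $$ (i,j) = (\<Sum>l<m. A $$ (i,l) * B $$ (l,j))"
  using assms by (auto simp: index_mult_mat(1) scalar_prod_def lessThan_atLeast0 intro!: sum.cong)

lemma mat_carrier_eqI:
  assumes "X \<in> carrier_mat n m" "Y \<in> carrier_mat n m"
    and "\<And>i j. i < n \<Longrightarrow> j < m \<Longrightarrow> X $$ (i,j) = Y $$ (i,j)"
  shows "X = Y"
  using assms by (intro eq_matI) auto

section \<open>Operators supported on the range of an idempotent, and linear maps on them\<close>

definition idem :: "nat \<Rightarrow> cmat \<Rightarrow> bool" where
  "idem n P \<longleftrightarrow> P \<in> carrier_mat n n \<and> P * P = P"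

lemma idem_sproj: "is_system S \<Longrightarrow> idem (sdim S) (sproj S)"
  by (simp add: idem_def is_system_def)

lemma idem_carrier: "idem n P \<Longrightarrow> P \<in> carrier_mat n n"
  by (simp add: idem_def)

lemma idem_one: "idem n (1\<^sub>m n)"
  by (simp add: idem_def)

text \<open>Separates the sandwich condition into a left and a right one, which can be carried
  through products and tensor slices independently.\<close>

lemma ops_iff:
  assumes "idem (sdim S) (sproj S)"
  shows "X \<in> ops S \<longleftrightarrow> X \<in> carrier_mat (sdim S) (sdim S) \<and> sproj S * X = X \<and> X * sproj S = X"
proof -
  have P: "sproj S \<in> carrier_mat (sdim S) (sdim S)" "sproj S * sproj S = sproj S"
    using assms by (auto simp: idem_def)
  have "sproj S * X = X" "X * sproj S = X"
    if X: "X \<in> carrier_mat (sdim S) (sdim S)" "sproj S * X * sproj S = X"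
  proof -
    have "sproj S * (sproj S * X * sproj S) = sproj S * X * sproj S"
      using P X(1) by (metis assoc_mult_mat mult_carrier_mat)
    with X show "sproj S * X = X" by simp
    have "(sproj S * X * sproj S) * sproj S = sproj S * X * sproj S"
      using P X(1) by (metis assoc_mult_mat mult_carrier_mat)
    with X show "X * sproj S = X" by simp
  qed
  then show ?thesis unfolding ops_def by auto
qed

lemma ops_carrier: "X \<in> ops S \<Longrightarrow> X \<in> carrier_mat (sdim S) (sdim S)"
  by (simp add: ops_def)

lemma ops_full: "ops (full_sys k) = carrier_mat k k"
  by (auto simp: ops_def full_sys_def sdim_def sproj_def)

lemma ops_triv: "ops triv_sys = carrier_mat 1 1"
  by (auto simp: ops_def triv_sys_def sdim_def sproj_def)

lemma msum_carrier [simp]: "msum n I f \<in> carrier_mat n n"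
  by (simp add: msum_def)

lemma msum_entry [simp]: "i < n \<Longrightarrow> j < n \<Longrightarrow> msum n I f $$ (i,j) = (\<Sum>k\<in>I. f k $$ (i,j))"
  by (simp add: msum_def)

lemma msum_cong: "(\<And>i. i \<in> I \<Longrightarrow> f i = g i) \<Longrightarrow> msum n I f = msum n I g"
  by (auto simp: msum_def cong: sum.cong)

lemma msum_empty [simp]: "msum n {} f = 0\<^sub>m n n"
  by (auto simp: msum_def)

lemma mult_msum:
  assumes "A \<in> carrier_mat n n" "\<And>i. i \<in> I \<Longrightarrow> f i \<in> carrier_mat n n"
  shows "A * msum n I f = msum n I (\<lambda>i. A * f i)"
proof (rule mat_carrier_eqI[of _ n n])
  fix i j assume ij: "i < n" "j < n"
  have "(A * msum n I f) $$ (i,j) = (\<Sum>l<n. \<Sum>k\<in>I. A $$ (i,l) * f k $$ (l,j))"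
    using assms ij by (simp add: mult_entry[of _ n n _ n] sum_distrib_left)
  also have "\<dots> = (\<Sum>k\<in>I. \<Sum>l<n. A $$ (i,l) * f k $$ (l,j))" by (rule sum.swap)
  also have "\<dots> = (\<Sum>k\<in>I. (A * f k) $$ (i,j))"
    using assms ij by (intro sum.cong refl) (simp add: mult_entry[of _ n n _ n])
  finally show "(A * msum n I f) $$ (i,j) = msum n I (\<lambda>i. A * f i) $$ (i,j)" using ij by simp
qed (use assms in auto)

lemma msum_mult:
  assumes "A \<in> carrier_mat n n" "\<And>i. i \<in> I \<Longrightarrow> f i \<in> carrier_mat n n"
  shows "msum n I f * A = msum n I (\<lambda>i. f i * A)"
proof (rule mat_carrier_eqI[of _ n n])
  fix i j assume ij: "i < n" "j < n"
  have "(msum n I f * A) $$ (i,j) = (\<Sum>l<n. \<Sum>k\<in>I. f k $$ (i,l) * A $$ (l,j))"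
    using assms ij by (simp add: mult_entry[of _ n n _ n] sum_distrib_right)
  also have "\<dots> = (\<Sum>k\<in>I. \<Sum>l<n. f k $$ (i,l) * A $$ (l,j))" by (rule sum.swap)
  also have "\<dots> = (\<Sum>k\<in>I. (f k * A) $$ (i,j))"
    using assms ij by (intro sum.cong refl) (simp add: mult_entry[of _ n n _ n])
  finally show "(msum n I f * A) $$ (i,j) = msum n I (\<lambda>i. f i * A) $$ (i,j)" using ij by simp
qed (use assms in auto)

lemma ops_msum:
  assumes "idem (sdim S) (sproj S)" "\<And>i. i \<in> I \<Longrightarrow> f i \<in> ops S"
  shows "msum (sdim S) I f \<in> ops S"
  using assms idem_carrier[OF assms(1)]
  by (auto simp: ops_iff mult_msum[of "sproj S"] msum_mult[of "sproj S"] intro!: msum_cong)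

lemma ops_smult:
  assumes "idem (sdim S) (sproj S)" "X \<in> ops S"
  shows "c \<cdot>\<^sub>m X \<in> ops S"
  using assms idem_carrier[OF assms(1)]
  by (auto simp: ops_iff mult_smult_distrib[of _ "sdim S" "sdim S"] mult_smult_assoc_mat[of _ "sdim S" "sdim S"])

lemma msum_insert:
  assumes "finite I" "i \<notin> I" "\<And>j. j \<in> insert i I \<Longrightarrow> f j \<in> carrier_mat n n"
  shows "msum n (insert i I) f = f i + msum n I f"
  using assms by (intro mat_carrier_eqI[of _ n n]) (auto simp: add_entry[of _ n n])

lemma linear_on_msum:
  assumes idem: "idem (sdim S) (sproj S)" and lin: "linear_on S Phi"
    and car: "\<And>X. X \<in> ops S \<Longrightarrow> Phi X \<in> carrier_mat m m"
    and "finite I" "\<And>i. i \<in> I \<Longrightarrow> f i \<in> ops S"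
  shows "Phi (msum (sdim S) I f) = msum m I (\<lambda>i. Phi (f i))"
  using assms(4,5)
proof (induction I rule: finite_induct)
  case empty
  have 0: "msum (sdim S) {} f \<in> ops S" using ops_msum[OF idem, of "{}" f] by simp
  \<comment> \<open>\<open>linear_on\<close> has no clause for zero, so the value at the empty sum
    is obtained from homogeneity with the scalar 0.\<close>
  have "Phi (0 \<cdot>\<^sub>m msum (sdim S) {} f) = 0 \<cdot>\<^sub>m Phi (msum (sdim S) {} f)"
    using lin 0 by (auto simp: linear_on_def)
  moreover have "0 \<cdot>\<^sub>m msum (sdim S) {} f = msum (sdim S) {} f"
    by (intro mat_carrier_eqI[of _ "sdim S" "sdim S"]) (auto simp: smult_entry[of _ "sdim S" "sdim S"])
  moreover have "0 \<cdot>\<^sub>m Phi (msum (sdim S) {} f) = msum m {} (\<lambda>i. Phi (f i))"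
    using car[OF 0] by (intro mat_carrier_eqI[of _ m m]) auto
  ultimately show ?case by simp
next
  case (insert i I)
  have "Phi (msum (sdim S) (insert i I) f) = Phi (f i + msum (sdim S) I f)"
    using insert by (subst msum_insert) (auto intro: ops_carrier)
  also have "\<dots> = Phi (f i) + Phi (msum (sdim S) I f)"
    using lin insert ops_msum[OF idem, of I f] by (simp add: linear_on_def)
  also have "\<dots> = msum m (insert i I) (\<lambda>i. Phi (f i))"
    using insert car by (subst msum_insert) auto
  finally show ?case .
qed

lemma linear_on_smult: "linear_on S Phi \<Longrightarrow> X \<in> ops S \<Longrightarrow> Phi (c \<cdot>\<^sub>m X) = c \<cdot>\<^sub>m Phi X"
  by (simp add: linear_on_def)

text \<open>The workhorse for evaluating \<open>Phi\<close>: it suffices to match the entries of the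
  argument with scalar coefficients, and no sum of matrices has to be formed by the caller.\<close>

lemma linear_on_lincomb_entry:
  assumes idem: "idem (sdim S) (sproj S)" and lin: "linear_on S Phi"
    and car: "\<And>X. X \<in> ops S \<Longrightarrow> Phi X \<in> carrier_mat m m"
    and fin: "finite I" and f: "\<And>i. i \<in> I \<Longrightarrow> f i \<in> ops S"
    and X: "X \<in> carrier_mat (sdim S) (sdim S)"
    and eq: "\<And>a b. a < sdim S \<Longrightarrow> b < sdim S \<Longrightarrow> X $$ (a,b) = (\<Sum>i\<in>I. c i * f i $$ (a,b))"
    and ij: "i < m" "j < m"
  shows "Phi X $$ (i,j) = (\<Sum>k\<in>I. c k * Phi (f k) $$ (i,j))"
proof -
  have cf: "\<And>i. i \<in> I \<Longrightarrow> c i \<cdot>\<^sub>m f i \<in> ops S" using f ops_smult[OF idem] by blast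
  have "X = msum (sdim S) I (\<lambda>i. c i \<cdot>\<^sub>m f i)"
    using X eq f by (intro mat_carrier_eqI[of _ "sdim S" "sdim S"]) (auto simp: ops_carrier smult_entry[of _ "sdim S" "sdim S"] intro!: sum.cong)
  then have "Phi X = msum m I (\<lambda>i. Phi (c i \<cdot>\<^sub>m f i))"
    using linear_on_msum[OF idem lin car fin, where f = "\<lambda>i. c i \<cdot>\<^sub>m f i"] cf by auto
  also have "\<dots> = msum m I (\<lambda>i. c i \<cdot>\<^sub>m Phi (f i))"
    by (intro msum_cong linear_on_smult[OF lin] f)
  finally show ?thesis using ij car[OF f] by (auto simp: smult_entry[of _ m m] intro!: sum.cong)
qed

text \<open>\<open>X E\<^sub>c\<^sub>d Y\<close> for a matrix unit \<open>E\<^sub>c\<^sub>d\<close>; with \<open>X = Y = P\<close> these span the operators on the range of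
  the projector \<open>P\<close>.\<close>
definition dyad :: "nat \<Rightarrow> cmat \<Rightarrow> cmat \<Rightarrow> nat \<Rightarrow> nat \<Rightarrow> cmat" where
  "dyad n X Y c d = mat n n (\<lambda>(x,y). X $$ (x,c) * Y $$ (d,y))"

lemma dyad_carrier [simp]: "dyad n X Y c d \<in> carrier_mat n n"
  by (simp add: dyad_def)

lemma dyad_entry [simp]: "x < n \<Longrightarrow> y < n \<Longrightarrow> dyad n X Y c d $$ (x,y) = X $$ (x,c) * Y $$ (d,y)"
  by (simp add: dyad_def)

lemma mult_dyad:
  assumes "U \<in> carrier_mat n n" "X \<in> carrier_mat n n" "c < n"
  shows "U * dyad n X Y c d = dyad n (U * X) Y c d"
  using assms
  by (intro mat_carrier_eqI[of _ n n])
     (auto simp: mult_entry[of _ n n _ n] sum_distrib_right mult.assoc)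

lemma dyad_mult:
  assumes "V \<in> carrier_mat n n" "Y \<in> carrier_mat n n" "d < n"
  shows "dyad n X Y c d * V = dyad n X (Y * V) c d"
  using assms
  by (intro mat_carrier_eqI[of _ n n])
     (auto simp: mult_entry[of _ n n _ n] sum_distrib_left mult.assoc)

lemma ops_entry:
  assumes "idem (sdim S) (sproj S)" "X \<in> ops S" "i < sdim S" "j < sdim S"
  shows "(\<Sum>l<sdim S. sproj S $$ (i,l) * X $$ (l,j)) = X $$ (i,j)"
    and "(\<Sum>l<sdim S. X $$ (i,l) * sproj S $$ (l,j)) = X $$ (i,j)"
  using mult_entry[of "sproj S" "sdim S" "sdim S" X "sdim S" i j]
    mult_entry[of X "sdim S" "sdim S" "sproj S" "sdim S" i j] assms
  by (auto simp: ops_iff idem_def)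

lemma sproj_ops: "idem (sdim S) (sproj S) \<Longrightarrow> sproj S \<in> ops S"
  by (auto simp: ops_def idem_def)

lemma dyad_ops:
  assumes "idem (sdim S) (sproj S)" "X \<in> ops S" "Y \<in> ops S" "c < sdim S" "d < sdim S"
  shows "dyad (sdim S) X Y c d \<in> ops S"
  using assms idem_carrier[OF assms(1)] by (simp add: ops_iff mult_dyad dyad_mult)

text \<open>Expanding \<open>X = P X P\<close> in matrix units gives the entries of \<open>X\<close>
  themselves as coefficients of the compressed units. A bare matrix unit may lie outside
  \<open>ops S\<close>, where nothing is known about \<open>Phi\<close>.\<close>

lemma linear_on_entry:
  assumes idem: "idem (sdim S) (sproj S)" and lin: "linear_on S Phi"
    and car: "\<And>X. X \<in> ops S \<Longrightarrow> Phi X \<in> carrier_mat m m"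
    and X: "X \<in> ops S" and ij: "i < m" "j < m"
  shows "Phi X $$ (i,j) = (\<Sum>c<sdim S. \<Sum>d<sdim S.
    X $$ (c,d) * Phi (dyad (sdim S) (sproj S) (sproj S) c d) $$ (i,j))"
proof -
  have "Phi X $$ (i,j) = (\<Sum>k\<in>{..<sdim S}\<times>{..<sdim S}.
     X $$ k * Phi (dyad (sdim S) (sproj S) (sproj S) (fst k) (snd k)) $$ (i,j))"
  proof (rule linear_on_lincomb_entry[OF idem lin car])
    fix a b assume ab: "a < sdim S" "b < sdim S"
    have "X $$ (a,b) = (\<Sum>c<sdim S. sproj S $$ (a,c) * (\<Sum>d<sdim S. X $$ (c,d) * sproj S $$ (d,b)))"
      using ops_entry[OF idem X] ab by simp
    also have "\<dots> = (\<Sum>c<sdim S. \<Sum>d<sdim S. X $$ (c,d) * dyad (sdim S) (sproj S) (sproj S) c d $$ (a,b))"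
      using ab by (simp add: sum_distrib_left mult_ac)
    finally show "X $$ (a,b) = (\<Sum>k\<in>{..<sdim S}\<times>{..<sdim S}.
        X $$ k * dyad (sdim S) (sproj S) (sproj S) (fst k) (snd k) $$ (a,b))"
      by (simp add: sum.cartesian_product case_prod_beta)
  qed (use X ij dyad_ops[OF idem] sproj_ops[OF idem] in \<open>auto dest: ops_carrier\<close>)
  then show ?thesis by (simp add: sum.cartesian_product case_prod_beta)
qed

section \<open>Tensor products\<close>

text \<open>The block (\<langle>a| \<otimes> 1) M (|c\<rangle> \<otimes> 1); \<open>sliceL\<close>
  is its mirror image with basis vectors in the second factor. \<open>map_right\<close> and
  \<open>map_left\<close> act slice by slice.\<close>

definition sliceR :: "nat \<Rightarrow> cmat \<Rightarrow> nat \<Rightarrow> nat \<Rightarrow> cmat" where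
  "sliceR n M a c = mat n n (\<lambda>(b,d). M $$ (a*n+b, c*n+d))"

definition sliceL :: "nat \<Rightarrow> nat \<Rightarrow> cmat \<Rightarrow> nat \<Rightarrow> nat \<Rightarrow> cmat" where
  "sliceL k n M b d = mat k k (\<lambda>(a,c). M $$ (a*n+b, c*n+d))"

lemma sliceR_carrier [simp]: "sliceR n M a c \<in> carrier_mat n n"
  by (simp add: sliceR_def)

lemma sliceL_carrier [simp]: "sliceL k n M b d \<in> carrier_mat k k"
  by (simp add: sliceL_def)

lemma sliceR_entry: "b < n \<Longrightarrow> d < n \<Longrightarrow> sliceR n M a c $$ (b,d) = M $$ (a*n+b, c*n+d)"
  by (simp add: sliceR_def)

lemma sliceL_entry: "a < k \<Longrightarrow> c < k \<Longrightarrow> sliceL k n M b d $$ (a,c) = M $$ (a*n+b, c*n+d)"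
  by (simp add: sliceL_def)

lemma sliceR_eqI:
  assumes "X \<in> carrier_mat (k*n) (k*n)" "Y \<in> carrier_mat (k*n) (k*n)"
    and "\<And>a c. a < k \<Longrightarrow> c < k \<Longrightarrow> sliceR n X a c = sliceR n Y a c"
  shows "X = Y"
  using assms(1,2)
proof (rule tensor_mat_eqI)
  fix a b c d assume *: "a < k" "b < n" "c < k" "d < n"
  then show "X $$ (a*n+b, c*n+d) = Y $$ (a*n+b, c*n+d)"
    using arg_cong[OF assms(3)[of a c], of "\<lambda>M. M $$ (b,d)"] by (simp add: sliceR_entry)
qed

lemma sliceL_eqI:
  assumes "X \<in> carrier_mat (k*n) (k*n)" "Y \<in> carrier_mat (k*n) (k*n)"
    and "\<And>b d. b < n \<Longrightarrow> d < n \<Longrightarrow> sliceL k n X b d = sliceL k n Y b d"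
  shows "X = Y"
  using assms(1,2)
proof (rule tensor_mat_eqI)
  fix a b c d assume *: "a < k" "b < n" "c < k" "d < n"
  then show "X $$ (a*n+b, c*n+d) = Y $$ (a*n+b, c*n+d)"
    using arg_cong[OF assms(3)[of b d], of "\<lambda>M. M $$ (a,c)"] by (simp add: sliceL_entry)
qed

lemma kron_carrier [simp]:
  "X \<in> carrier_mat k k' \<Longrightarrow> Y \<in> carrier_mat n n' \<Longrightarrow> kron X Y \<in> carrier_mat (k*n) (k'*n')"
  by (auto simp: kron_def)

lemma kron_entry:
  assumes "X \<in> carrier_mat k k'" "Y \<in> carrier_mat n n'" "a < k" "b < n" "c < k'" "d < n'"
  shows "kron X Y $$ (a*n+b, c*n'+d) = X $$ (a,c) * Y $$ (b,d)"
  using assms by (auto simp: kron_def)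

lemma kron_left_entry:
  assumes "X \<in> carrier_mat k k" "Y \<in> carrier_mat n n" "M \<in> carrier_mat (k*n) (k*n)" 
    "a < k" "b < n" "j < k*n"
  shows "(kron X Y * M) $$ (a*n+b, j) = (\<Sum>a'<k. \<Sum>b'<n. X $$ (a,a') * Y $$ (b,b') * M $$ (a'*n+b', j))"
  using assms
  by (simp add: mult_entry[of _ "k*n" "k*n" _ "k*n"] sum_tensor kron_entry[of _ k k _ n n])

lemma kron_right_entry:
  assumes "X \<in> carrier_mat k k" "Y \<in> carrier_mat n n" "M \<in> carrier_mat (k*n) (k*n)" 
    "c < k" "d < n" "i < k*n"
  shows "(M * kron X Y) $$ (i, c*n+d) = (\<Sum>c'<k. \<Sum>d'<n. M $$ (i, c'*n+d') * (X $$ (c',c) * Y $$ (d',d)))"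
  using assms
  by (simp add: mult_entry[of _ "k*n" "k*n" _ "k*n"] sum_tensor kron_entry[of _ k k _ n n])

lemma kron_mult:
  assumes "X \<in> carrier_mat k k" "Y \<in> carrier_mat n n" "X' \<in> carrier_mat k k" "Y' \<in> carrier_mat n n"
  shows "kron X Y * kron X' Y' = kron (X*X') (Y*Y')"
proof (rule tensor_mat_eqI[of _ k n])
  fix a b c d assume "a < k" "b < n" "c < k" "d < n"
  then show "(kron X Y * kron X' Y') $$ (a*n+b, c*n+d) = kron (X*X') (Y*Y') $$ (a*n+b, c*n+d)"
    using assms
    by (simp add: kron_left_entry[of _ k _ n] kron_entry[of _ k k _ n n] mult_entry[of _ k k _ k]
        mult_entry[of _ n n _ n] sum_product mult_ac)
qed (use assms in auto)

lemma sum_delta_mult: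
  fixes f :: "nat \<Rightarrow> 'a::semiring_1"
  assumes "a < k"
  shows "(\<Sum>x<k. (if a = x then 1 else 0) * f x) = f a"
    and "(\<Sum>x<k. (if x = a then 1 else 0) * f x) = f a"
    and "(\<Sum>x<k. f x * (if a = x then 1 else 0)) = f a"
    and "(\<Sum>x<k. f x * (if x = a then 1 else 0)) = f a"
  using assms by (simp_all add: if_distrib if_distribR sum.delta sum.delta' cong: if_cong)

lemma sliceR_kron_one:
  assumes "Y \<in> carrier_mat n n" "M \<in> carrier_mat (k*n) (k*n)" "a < k" "c < k"
  shows "sliceR n (kron (1\<^sub>m k) Y * M) a c = Y * sliceR n M a c"
    and "sliceR n (M * kron (1\<^sub>m k) Y) a c = sliceR n M a c * Y"
proof -
  show "sliceR n (kron (1\<^sub>m k) Y * M) a c = Y * sliceR n M a c"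
  proof (rule mat_carrier_eqI[of _ n n])
    fix b d assume bd: "b < n" "d < n"
    have "sliceR n (kron (1\<^sub>m k) Y * M) a c $$ (b,d)
        = (\<Sum>a'<k. (if a = a' then 1 else 0) * (\<Sum>b'<n. Y $$ (b,b') * M $$ (a'*n+b', c*n+d)))"
      using assms bd by (simp add: sliceR_entry kron_left_entry[of _ k _ n] sum_distrib_left mult.assoc)
    also have "\<dots> = (Y * sliceR n M a c) $$ (b,d)"
      using assms bd by (simp add: sum_delta_mult mult_entry[of _ n n _ n] sliceR_entry)
    finally show "sliceR n (kron (1\<^sub>m k) Y * M) a c $$ (b,d) = (Y * sliceR n M a c) $$ (b,d)" .
  qed (use assms in auto)
  show "sliceR n (M * kron (1\<^sub>m k) Y) a c = sliceR n M a c * Y"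
  proof (rule mat_carrier_eqI[of _ n n])
    fix b d assume bd: "b < n" "d < n"
    have "sliceR n (M * kron (1\<^sub>m k) Y) a c $$ (b,d)
        = (\<Sum>c'<k. (if c' = c then 1 else 0) * (\<Sum>d'<n. M $$ (a*n+b, c'*n+d') * Y $$ (d',d)))"
      using assms bd by (simp add: sliceR_entry kron_right_entry[of _ k _ n] sum_distrib_left mult_ac)
    also have "\<dots> = (sliceR n M a c * Y) $$ (b,d)"
      using assms bd by (simp add: sum_delta_mult mult_entry[of _ n n _ n] sliceR_entry)
    finally show "sliceR n (M * kron (1\<^sub>m k) Y) a c $$ (b,d) = (sliceR n M a c * Y) $$ (b,d)" .
  qed (use assms in auto)
qed

lemma sliceL_kron_one:
  assumes "X \<in> carrier_mat k k" "M \<in> carrier_mat (k*n) (k*n)" "b < n" "d < n"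
  shows "sliceL k n (kron X (1\<^sub>m n) * M) b d = X * sliceL k n M b d"
    and "sliceL k n (M * kron X (1\<^sub>m n)) b d = sliceL k n M b d * X"
proof -
  show "sliceL k n (kron X (1\<^sub>m n) * M) b d = X * sliceL k n M b d"
  proof (rule mat_carrier_eqI[of _ k k])
    fix a c assume ac: "a < k" "c < k"
    have "sliceL k n (kron X (1\<^sub>m n) * M) b d $$ (a,c)
        = (\<Sum>a'<k. \<Sum>b'<n. (if b = b' then 1 else 0) * (X $$ (a,a') * M $$ (a'*n+b', c*n+d)))"
      using assms ac by (simp add: sliceL_entry kron_left_entry[of _ k _ n] mult_ac)
    also have "\<dots> = (X * sliceL k n M b d) $$ (a,c)"
      using assms ac by (simp add: sum_delta_mult mult_entry[of _ k k _ k] sliceL_entry)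
    finally show "sliceL k n (kron X (1\<^sub>m n) * M) b d $$ (a,c) = (X * sliceL k n M b d) $$ (a,c)" .
  qed (use assms in auto)
  show "sliceL k n (M * kron X (1\<^sub>m n)) b d = sliceL k n M b d * X"
  proof (rule mat_carrier_eqI[of _ k k])
    fix a c assume ac: "a < k" "c < k"
    have "sliceL k n (M * kron X (1\<^sub>m n)) b d $$ (a,c)
        = (\<Sum>c'<k. \<Sum>d'<n. (if d' = d then 1 else 0) * (M $$ (a*n+b, c'*n+d') * X $$ (c',c)))"
      using assms ac by (simp add: sliceL_entry kron_right_entry[of _ k _ n] mult_ac)
    also have "\<dots> = (sliceL k n M b d * X) $$ (a,c)"
      using assms ac by (simp add: sum_delta_mult mult_entry[of _ k k _ k] sliceL_entry)
    finally show "sliceL k n (M * kron X (1\<^sub>m n)) b d $$ (a,c) = (sliceL k n M b d * X) $$ (a,c)" .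
  qed (use assms in auto)
qed

lemma sdim_stensor [simp]: "sdim (stensor S T) = sdim S * sdim T"
  by (simp add: stensor_def sdim_def)

lemma sproj_stensor [simp]: "sproj (stensor S T) = kron (sproj S) (sproj T)"
  by (simp add: stensor_def sproj_def)

lemma sdim_triv [simp]: "sdim triv_sys = 1" and sproj_triv [simp]: "sproj triv_sys = 1\<^sub>m 1"
  by (simp_all add: triv_sys_def sdim_def sproj_def)

lemma sdim_full [simp]: "sdim (full_sys k) = k" and sproj_full [simp]: "sproj (full_sys k) = 1\<^sub>m k"
  by (simp_all add: full_sys_def sdim_def sproj_def)

lemma sdim_Pair [simp]: "sdim (n, P) = n" and sproj_Pair [simp]: "sproj (n, P) = P"
  by (simp_all add: sdim_def sproj_def)

lemma idem_kron: "idem k P \<Longrightarrow> idem n Q \<Longrightarrow> idem (k*n) (kron P Q)"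
  by (auto simp: idem_def kron_mult[of _ k _ n])

lemma idem_stensor:
  "idem (sdim S) (sproj S) \<Longrightarrow> idem (sdim T) (sproj T) \<Longrightarrow> idem (sdim (stensor S T)) (sproj (stensor S T))"
  by (simp add: idem_kron)

text \<open>P \<otimes> Q is the product of the commuting P \<otimes> 1 and 1 \<otimes> Q. The
  latter acts on each right slice and the former on each left slice, so membership is decided one
  factor at a time.\<close>

lemma ops_tensor_slices:
  assumes S: "idem (sdim S) (sproj S)" and T: "idem (sdim T) (sproj T)"
  shows "M \<in> ops (stensor S T) \<longleftrightarrow> M \<in> carrier_mat (sdim S * sdim T) (sdim S * sdim T)
    \<and> (\<forall>a<sdim S. \<forall>c<sdim S. sliceR (sdim T) M a c \<in> ops T)
    \<and> (\<forall>b<sdim T. \<forall>d<sdim T. sliceL (sdim S) (sdim T) M b d \<in> ops S)"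
proof -
  define k n P Q where defs: "k = sdim S" "n = sdim T" "P = sproj S" "Q = sproj T"
  have P: "P \<in> carrier_mat k k" "P * P = P" and Q: "Q \<in> carrier_mat n n" "Q * Q = Q"
    using S T by (auto simp: idem_def defs)
  define KP KQ K where K: "KP = kron P (1\<^sub>m n)" "KQ = kron (1\<^sub>m k) Q" "K = kron P Q"
  have car: "KP \<in> carrier_mat (k*n) (k*n)" "KQ \<in> carrier_mat (k*n) (k*n)" "K \<in> carrier_mat (k*n) (k*n)"
    using P Q by (auto simp: K)
  have prods: "KP * K = K" "K * KP = K" "KQ * K = K" "K * KQ = K" "KP * KQ = K" "KQ * KP = K"
    using P Q by (simp_all add: K kron_mult[of _ k _ n])
  have iff: "M \<in> ops (stensor S T) \<longleftrightarrow> M \<in> carrier_mat (k*n) (k*n) \<and> K * M = M \<and> M * K = M"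
    using ops_iff[OF idem_stensor[OF S T]] by (simp add: defs K)
  have opsS: "X \<in> ops S \<longleftrightarrow> X \<in> carrier_mat k k \<and> P * X = X \<and> X * P = X" for X
    using ops_iff[OF S] by (simp add: defs)
  have opsT: "X \<in> ops T \<longleftrightarrow> X \<in> carrier_mat n n \<and> Q * X = X \<and> X * Q = X" for X
    using ops_iff[OF T] by (simp add: defs)
  show ?thesis
  proof
    assume "M \<in> ops (stensor S T)"
    then have M: "M \<in> carrier_mat (k*n) (k*n)" "K * M = M" "M * K = M" using iff by auto
    have "KP * (K * M) = K * M" "M * K * KP = M * K" "KQ * (K * M) = K * M" "M * K * KQ = M * K"
      using assoc_mult_mat[OF car(1,3) M(1)] assoc_mult_mat[OF M(1) car(3,1)]
        assoc_mult_mat[OF car(2,3) M(1)] assoc_mult_mat[OF M(1) car(3,2)] prods by metis+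
    then have e: "KP * M = M" "M * KP = M" "KQ * M = M" "M * KQ = M" using M by auto
    have "sliceR n M a c \<in> ops T" if "a < k" "c < k" for a c
      using sliceR_kron_one[OF Q(1) M(1) that] e(3,4) by (simp add: opsT K(2))
    moreover have "sliceL k n M b d \<in> ops S" if "b < n" "d < n" for b d
      using sliceL_kron_one[OF P(1) M(1) that] e(1,2) by (simp add: opsS K(1))
    ultimately show "M \<in> carrier_mat (sdim S * sdim T) (sdim S * sdim T)
    \<and> (\<forall>a<sdim S. \<forall>c<sdim S. sliceR (sdim T) M a c \<in> ops T)
    \<and> (\<forall>b<sdim T. \<forall>d<sdim T. sliceL (sdim S) (sdim T) M b d \<in> ops S)"
      using M(1) by (simp add: defs)
  next
    assume "M \<in> carrier_mat (sdim S * sdim T) (sdim S * sdim T)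
    \<and> (\<forall>a<sdim S. \<forall>c<sdim S. sliceR (sdim T) M a c \<in> ops T)
    \<and> (\<forall>b<sdim T. \<forall>d<sdim T. sliceL (sdim S) (sdim T) M b d \<in> ops S)"
    then have M: "M \<in> carrier_mat (k*n) (k*n)"
      and R: "\<And>a c. a < k \<Longrightarrow> c < k \<Longrightarrow> sliceR n M a c \<in> ops T"
      and L: "\<And>b d. b < n \<Longrightarrow> d < n \<Longrightarrow> sliceL k n M b d \<in> ops S"
      by (auto simp: defs)
    have "Q * sliceR n M a c = sliceR n M a c" "sliceR n M a c * Q = sliceR n M a c" if "a < k" "c < k" for a c
      using R[OF that] by (simp_all add: opsT)
    then have sl: "sliceR n (KQ * M) a c = sliceR n M a c" "sliceR n (M * KQ) a c = sliceR n M a c"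
      if "a < k" "c < k" for a c
      using sliceR_kron_one[OF Q(1) M that] that by (simp_all add: K(2))
    have KQ: "KQ * M = M" "M * KQ = M"
      by (rule sliceR_eqI[OF _ M], use car M sl in auto)+
    have "P * sliceL k n M b d = sliceL k n M b d" "sliceL k n M b d * P = sliceL k n M b d" if "b < n" "d < n" for b d
      using L[OF that] by (simp_all add: opsS)
    then have sl: "sliceL k n (KP * M) b d = sliceL k n M b d" "sliceL k n (M * KP) b d = sliceL k n M b d"
      if "b < n" "d < n" for b d
      using sliceL_kron_one[OF P(1) M that] that by (simp_all add: K(1))
    have KP: "KP * M = M" "M * KP = M"
      by (rule sliceL_eqI[OF _ M], use car M sl in auto)+
    have "KP * KQ * M = M" by (subst assoc_mult_mat[OF car(1,2) M]) (simp add: KP KQ)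
    moreover have "M * (KQ * KP) = M"
      by (subst assoc_mult_mat[OF M car(2,1), symmetric]) (simp add: KP KQ)
    ultimately have "K * M = M" "M * K = M" using prods by simp_all
    with M show "M \<in> ops (stensor S T)" using iff by blast
  qed
qed

lemma map_right_carrier [simp]: "map_right k n m Phi M \<in> carrier_mat (k*m) (k*m)"
  by (simp add: map_right_def)

lemma map_left_carrier [simp]: "map_left n k m Phi M \<in> carrier_mat (m*k) (m*k)"
  by (simp add: map_left_def)

lemma map_right_entry:
  "a < k \<Longrightarrow> b < m \<Longrightarrow> c < k \<Longrightarrow> d < m \<Longrightarrow>
    map_right k n m Phi M $$ (a*m+b, c*m+d) = Phi (sliceR n M a c) $$ (b,d)"
  by (simp add: map_right_def sliceR_def)

lemma map_left_entry:
  "a < m \<Longrightarrow> b < k \<Longrightarrow> c < m \<Longrightarrow> d < k \<Longrightarrow>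
    map_left n k m Phi M $$ (a*k+b, c*k+d) = Phi (sliceL n k M b d) $$ (a,c)"
  by (simp add: map_left_def sliceL_def)

lemma sliceR_map_right:
  "a < k \<Longrightarrow> c < k \<Longrightarrow> Phi (sliceR n M a c) \<in> carrier_mat m m \<Longrightarrow>
   sliceR m (map_right k n m Phi M) a c = Phi (sliceR n M a c)"
  by (rule mat_carrier_eqI[of _ m m]) (auto simp: sliceR_entry map_right_entry)

lemma sliceL_map_left:
  "b < k \<Longrightarrow> d < k \<Longrightarrow> Phi (sliceL n k M b d) \<in> carrier_mat m m \<Longrightarrow>
   sliceL m k (map_left n k m Phi M) b d = Phi (sliceL n k M b d)"
  by (rule mat_carrier_eqI[of _ m m]) (auto simp: sliceL_entry map_left_entry)

section \<open>Linear maps between systems\<close>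

text \<open>The common core of \<open>is_channel\<close> and \<open>is_cptni\<close>. Positivity is
  left out so that \<open>fp A B Phi\<close>, viewed as a map from \<open>A\<close> to A \<otimes>
  B, qualifies although it need not be positive.\<close>

definition lin_map :: "system \<Rightarrow> system \<Rightarrow> (cmat \<Rightarrow> cmat) \<Rightarrow> bool" where
  "lin_map S T Phi \<longleftrightarrow> linear_on S Phi \<and> (\<forall>X\<in>ops S. Phi X \<in> ops T)"

lemma channel_lin_map: "is_channel S T Phi \<Longrightarrow> lin_map S T Phi"
  by (simp add: lin_map_def is_channel_def)

lemma cptni_lin_map: "is_cptni S T Phi \<Longrightarrow> lin_map S T Phi"
  by (simp add: lin_map_def is_cptni_def)

lemma lin_map_comp: "lin_map R S Phi \<Longrightarrow> lin_map S T Psi \<Longrightarrow> lin_map R T (Psi \<circ> Phi)"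
  by (simp add: lin_map_def linear_on_def)

lemma lin_map_carrier: "lin_map S T Phi \<Longrightarrow> X \<in> ops S \<Longrightarrow> Phi X \<in> carrier_mat (sdim T) (sdim T)"
  by (simp add: lin_map_def ops_carrier)

lemma lin_map_ops: "lin_map S T Phi \<Longrightarrow> X \<in> ops S \<Longrightarrow> Phi X \<in> ops T"
  by (simp add: lin_map_def)

lemma lin_map_lincomb_entry:
  assumes "idem (sdim S) (sproj S)" "lin_map S T Phi"
    and "finite I" "\<And>i. i \<in> I \<Longrightarrow> f i \<in> ops S"
    and "X \<in> carrier_mat (sdim S) (sdim S)"
    and "\<And>a b. a < sdim S \<Longrightarrow> b < sdim S \<Longrightarrow> X $$ (a,b) = (\<Sum>i\<in>I. c i * f i $$ (a,b))"
    and "i < sdim T" "j < sdim T"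
  shows "Phi X $$ (i,j) = (\<Sum>k\<in>I. c k * Phi (f k) $$ (i,j))"
  using assms(2)
  by (intro linear_on_lincomb_entry[OF assms(1) _ lin_map_carrier[OF assms(2)] assms(3-8)])
     (auto simp: lin_map_def)

text \<open>The values on dyads stand as coefficients in front of the entries of \<open>X\<close>
  and are summed over a single index set, which is the shape that
  \<open>lin_map_lincomb_entry\<close> and \<open>ops_lincomb\<close> expect.\<close>

lemma lin_map_entry:
  assumes "idem (sdim S) (sproj S)" "lin_map S T Phi" "X \<in> ops S" "i < sdim T" "j < sdim T"
  shows "Phi X $$ (i,j) = (\<Sum>p\<in>{..<sdim S}\<times>{..<sdim S}.
    Phi (dyad (sdim S) (sproj S) (sproj S) (fst p) (snd p)) $$ (i,j) * X $$ p)"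
proof -
  have "linear_on S Phi" using assms(2) by (simp add: lin_map_def)
  from linear_on_entry[OF assms(1) this lin_map_carrier[OF assms(2)] assms(3-5)]
  show ?thesis by (simp add: sum.cartesian_product case_prod_beta mult.commute)
qed

lemma ops_lincomb:
  assumes "idem (sdim S) (sproj S)" "\<And>i. i \<in> I \<Longrightarrow> f i \<in> ops S"
    and "X \<in> carrier_mat (sdim S) (sdim S)"
    and "\<And>a b. a < sdim S \<Longrightarrow> b < sdim S \<Longrightarrow> X $$ (a,b) = (\<Sum>i\<in>I. c i * f i $$ (a,b))"
  shows "X \<in> ops S"
proof -
  have "X = msum (sdim S) I (\<lambda>i. c i \<cdot>\<^sub>m f i)"
    using assms
    by (intro mat_carrier_eqI[of _ "sdim S" "sdim S"])
       (auto simp: ops_carrier smult_entry[of _ "sdim S" "sdim S"] intro!: sum.cong)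
  then show ?thesis using assms(1,2) by (simp add: ops_msum ops_smult)
qed

lemma sliceR_ops:
  assumes "idem (sdim S) (sproj S)" "idem (sdim T) (sproj T)" "M \<in> ops (stensor S T)" "a < sdim S" "c < sdim S"
  shows "sliceR (sdim T) M a c \<in> ops T"
  using assms by (simp add: ops_tensor_slices)

lemma sliceL_ops:
  assumes "idem (sdim S) (sproj S)" "idem (sdim T) (sproj T)" "M \<in> ops (stensor S T)" "b < sdim T" "d < sdim T"
  shows "sliceL (sdim S) (sdim T) M b d \<in> ops S"
  using assms by (simp add: ops_tensor_slices)

text \<open>Right slices of the image are values of \<open>Phi\<close>. Left slices of the image are
  linear combinations of left slices of \<open>M\<close>, the coefficients being the matrix elements
  of \<open>Phi\<close> on dyads.\<close>

lemma map_right_ops: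
  assumes R: "idem (sdim R) (sproj R)" and S: "idem (sdim S) (sproj S)" and T: "idem (sdim T) (sproj T)"
    and Phi: "lin_map S T Phi" and M: "M \<in> ops (stensor R S)"
  shows "map_right (sdim R) (sdim S) (sdim T) Phi M \<in> ops (stensor R T)"
proof -
  let ?N = "map_right (sdim R) (sdim S) (sdim T) Phi M"
  have "sliceR (sdim T) ?N a c \<in> ops T" if "a < sdim R" "c < sdim R" for a c
    using sliceR_ops[OF R S M that] Phi that by (simp add: sliceR_map_right lin_map_carrier lin_map_ops)
  moreover have "sliceL (sdim R) (sdim T) ?N b d \<in> ops R" if bd: "b < sdim T" "d < sdim T" for b d
  proof (rule ops_lincomb[OF R])
    fix a c assume ac: "a < sdim R" "c < sdim R"
    show "sliceL (sdim R) (sdim T) ?N b d $$ (a,c) = (\<Sum>p\<in>{..<sdim S}\<times>{..<sdim S}.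
        Phi (dyad (sdim S) (sproj S) (sproj S) (fst p) (snd p)) $$ (b,d)
        * sliceL (sdim R) (sdim S) M (fst p) (snd p) $$ (a,c))"
      using ac bd lin_map_entry[OF S Phi sliceR_ops[OF R S M ac] bd]
      by (auto simp: sliceL_entry map_right_entry sliceR_entry intro!: sum.cong)
  qed (use sliceL_ops[OF R S M] in auto)
  ultimately show ?thesis by (simp add: ops_tensor_slices[OF R T])
qed

lemma map_left_ops:
  assumes R: "idem (sdim R) (sproj R)" and S: "idem (sdim S) (sproj S)" and T: "idem (sdim T) (sproj T)"
    and Phi: "lin_map S T Phi" and M: "M \<in> ops (stensor S R)"
  shows "map_left (sdim S) (sdim R) (sdim T) Phi M \<in> ops (stensor T R)"
proof -
  let ?N = "map_left (sdim S) (sdim R) (sdim T) Phi M"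
  have "sliceL (sdim T) (sdim R) ?N b d \<in> ops T" if "b < sdim R" "d < sdim R" for b d
    using sliceL_ops[OF S R M that] Phi that by (simp add: sliceL_map_left lin_map_carrier lin_map_ops)
  moreover have "sliceR (sdim R) ?N a c \<in> ops R" if ac: "a < sdim T" "c < sdim T" for a c
  proof (rule ops_lincomb[OF R])
    fix b d assume bd: "b < sdim R" "d < sdim R"
    show "sliceR (sdim R) ?N a c $$ (b,d) = (\<Sum>p\<in>{..<sdim S}\<times>{..<sdim S}.
        Phi (dyad (sdim S) (sproj S) (sproj S) (fst p) (snd p)) $$ (a,c)
        * sliceR (sdim R) M (fst p) (snd p) $$ (b,d))"
      using ac bd lin_map_entry[OF S Phi sliceL_ops[OF S R M bd] ac]
      by (auto simp: sliceL_entry map_left_entry sliceR_entry intro!: sum.cong)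
  qed (use sliceR_ops[OF S R M] in auto)
  ultimately show ?thesis by (simp add: ops_tensor_slices[OF T R])
qed

text \<open>Maps on different tensor factors commute: after expanding \<open>Phi\<close> over dyads,
  both sides become the same combination of \<open>I\<close> applied to right slices of
  \<open>M\<close>. This is the compatibility with spectator operations demanded by (E).\<close>

lemma map_right_map_left:
  assumes S: "idem (sdim S) (sproj S)" and R: "idem (sdim R) (sproj R)" and R': "idem (sdim R') (sproj R')"
    and Phi: "lin_map S T Phi" and I: "lin_map R R' I" and M: "M \<in> ops (stensor S R)"
  shows "map_right (sdim T) (sdim R) (sdim R') I (map_left (sdim S) (sdim R) (sdim T) Phi M)
    = map_left (sdim S) (sdim R') (sdim T) Phi (map_right (sdim S) (sdim R) (sdim R') I M)"
proof (rule tensor_mat_eqI[of _ "sdim T" "sdim R'"])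
  let ?D = "\<lambda>p. dyad (sdim S) (sproj S) (sproj S) (fst p) (snd p)"
  let ?M' = "map_right (sdim S) (sdim R) (sdim R') I M"
  have M': "?M' \<in> ops (stensor S R')" by (rule map_right_ops[OF S R R' I M])
  fix a b c d assume ac: "a < sdim T" "c < sdim T" and bd: "b < sdim R'" "d < sdim R'"
  have "I (sliceR (sdim R) (map_left (sdim S) (sdim R) (sdim T) Phi M) a c) $$ (b,d)
      = (\<Sum>p\<in>{..<sdim S}\<times>{..<sdim S}. Phi (?D p) $$ (a,c) * I (sliceR (sdim R) M (fst p) (snd p)) $$ (b,d))"
  proof (rule lin_map_lincomb_entry[OF R I])
    fix x y assume xy: "x < sdim R" "y < sdim R"
    then show "sliceR (sdim R) (map_left (sdim S) (sdim R) (sdim T) Phi M) a c $$ (x,y)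
      = (\<Sum>p\<in>{..<sdim S}\<times>{..<sdim S}. Phi (?D p) $$ (a,c) * sliceR (sdim R) M (fst p) (snd p) $$ (x,y))"
      using ac lin_map_entry[OF S Phi sliceL_ops[OF S R M xy] ac]
      by (auto simp: sliceL_entry map_left_entry sliceR_entry intro!: sum.cong)
  qed (use sliceR_ops[OF S R M] bd in auto)
  also have "\<dots> = (\<Sum>p\<in>{..<sdim S}\<times>{..<sdim S}. Phi (?D p) $$ (a,c) * sliceL (sdim S) (sdim R') ?M' b d $$ p)"
    using bd by (auto simp: sliceL_entry map_right_entry intro!: sum.cong)
  also have "\<dots> = Phi (sliceL (sdim S) (sdim R') ?M' b d) $$ (a,c)"
    using lin_map_entry[OF S Phi sliceL_ops[OF S R' M' bd] ac] by simp
  finally show "map_right (sdim T) (sdim R) (sdim R') I (map_left (sdim S) (sdim R) (sdim T) Phi M) $$ (a * sdim R' + b, c * sdim R' + d)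
    = map_left (sdim S) (sdim R') (sdim T) Phi ?M' $$ (a * sdim R' + b, c * sdim R' + d)"
    using ac bd by (simp add: map_right_entry map_left_entry)
qed auto

lemma map_right_comp:
  assumes "\<And>a c. a < k \<Longrightarrow> c < k \<Longrightarrow> Phi (sliceR n M a c) \<in> carrier_mat m m"
  shows "map_right k m p Psi (map_right k n m Phi M) = map_right k n p (Psi \<circ> Phi) M"
  by (rule tensor_mat_eqI[of _ k p]) (auto simp: map_right_entry sliceR_map_right assms)

lemma map_right_ident: "M \<in> carrier_mat (k*n) (k*n) \<Longrightarrow> map_right k n n (\<lambda>X. X) M = M"
  by (rule tensor_mat_eqI[of _ k n]) (auto simp: map_right_entry sliceR_entry)

lemma map_left_triv:
  assumes "X \<in> carrier_mat n n" "Phi X \<in> carrier_mat m m"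
  shows "map_left n 1 m Phi X = Phi X"
proof -
  have "mat n n (\<lambda>(a,c). X $$ (a,c)) = X" using assms by (intro mat_carrier_eqI[of _ n n]) auto
  then show ?thesis
    using assms(2) by (intro mat_carrier_eqI[of _ m m]) (auto simp: map_left_def)
qed

section \<open>Swapping tensor factors\<close>

lemma swapmat_carrier [simp]: "swapmat n m \<in> carrier_mat (m*n) (n*m)"
  by (simp add: swapmat_def)

lemma swapmat_entry:
  "a < n \<Longrightarrow> b < m \<Longrightarrow> a' < n \<Longrightarrow> b' < m \<Longrightarrow>
   swapmat n m $$ (b'*n+a', a*m+b) = (if b' = b \<and> a' = a then 1 else 0)"
proof -
  assume A: "a < n" "b < m" "a' < n" "b' < m"
  have "b'*n+a' = b*n+a \<longleftrightarrow> b' = b \<and> a' = a"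
    using A by (metis div_mult_self3 mod_mult_self3 div_less mod_less add_0_right less_nat_zero_code)
  then show ?thesis using A by (simp add: swapmat_def)
qed

lemma swap_conj_carrier [simp]:
  "X \<in> carrier_mat (sdim S * sdim T) (sdim S * sdim T) \<Longrightarrow>
   swap_conj S T X \<in> carrier_mat (sdim T * sdim S) (sdim T * sdim S)"
  unfolding swap_conj_def
  using mult_carrier_mat[OF mult_carrier_mat[OF swapmat_carrier] swapmat_carrier] by blast

lemma sum_sum_delta:
  fixes f :: "nat \<Rightarrow> nat \<Rightarrow> 'a::semiring_1"
  assumes "x < n" "y < m"
  shows "(\<Sum>a<n. \<Sum>b<m. (if a = x \<and> b = y then 1 else 0) * f a b) = f x y"
    and "(\<Sum>a<n. \<Sum>b<m. (if x = a \<and> y = b then 1 else 0) * f a b) = f x y"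
    and "(\<Sum>a<n. \<Sum>b<m. f a b * (if a = x \<and> b = y then 1 else 0)) = f x y"
    and "(\<Sum>a<n. \<Sum>b<m. f a b * (if x = a \<and> y = b then 1 else 0)) = f x y"
    and "(\<Sum>a<n. \<Sum>b<m. (if y = b \<and> x = a then 1 else 0) * f a b) = f x y"
proof -
  have "(\<Sum>a<n. \<Sum>b<m. if a = x \<and> b = y then f a b else 0) = f x y"
  proof -
    have "(\<Sum>a<n. \<Sum>b<m. if a = x \<and> b = y then f a b else 0) = (\<Sum>a<n. if a = x then f a y else 0)"
      using assms by (intro sum.cong refl) (simp add: sum.delta)
    then show ?thesis using assms by (simp add: sum.delta)
  qed
  moreover have "(x = a \<and> y = b) = (a = x \<and> b = y)" "(y = b \<and> x = a) = (a = x \<and> b = y)" for a b by auto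
  ultimately show "(\<Sum>a<n. \<Sum>b<m. (if a = x \<and> b = y then 1 else 0) * f a b) = f x y"
    "(\<Sum>a<n. \<Sum>b<m. (if x = a \<and> y = b then 1 else 0) * f a b) = f x y"
    "(\<Sum>a<n. \<Sum>b<m. f a b * (if a = x \<and> b = y then 1 else 0)) = f x y"
    "(\<Sum>a<n. \<Sum>b<m. f a b * (if x = a \<and> y = b then 1 else 0)) = f x y"
    "(\<Sum>a<n. \<Sum>b<m. (if y = b \<and> x = a then 1 else 0) * f a b) = f x y"
    by (simp_all add: if_distrib if_distribR cong: if_cong)
qed

lemma swap_conj_entry:
  assumes X: "X \<in> carrier_mat (sdim S * sdim T) (sdim S * sdim T)"
    and ac: "a < sdim S" "c < sdim S" and bd: "b < sdim T" "d < sdim T"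
  shows "swap_conj S T X $$ (b * sdim S + a, d * sdim S + c) = X $$ (a * sdim T + b, c * sdim T + d)"
proof -
  let ?s = "sdim S" and ?t = "sdim T"
  have XF: "(X * swapmat ?t ?s) $$ (i, d*?s+c) = X $$ (i, c*?t+d)" if i: "i < ?s * ?t" for i
    using X ac bd i
    by (simp add: mult_entry[of _ "?s*?t" "?s*?t" _ "?t*?s"] sum_tensor swapmat_entry sum_sum_delta)
  have car: "X * swapmat ?t ?s \<in> carrier_mat (?s*?t) (?t*?s)" using X by auto
  have "swap_conj S T X = swapmat ?s ?t * (X * swapmat ?t ?s)"
    unfolding swap_conj_def by (rule assoc_mult_mat[OF swapmat_carrier X swapmat_carrier])
  also have "\<dots> $$ (b*?s+a, d*?s+c) = (\<Sum>a'<?s. \<Sum>b'<?t. swapmat ?s ?t $$ (b*?s+a, a'*?t+b') * X $$ (a'*?t+b', c*?t+d))"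
    using ac bd car
    by (simp add: mult_entry[of _ "?t*?s" "?s*?t" _ "?t*?s"] sum_tensor XF)
  also have "\<dots> = (\<Sum>a'<?s. \<Sum>b'<?t. (if a = a' \<and> b = b' then 1 else 0) * X $$ (a'*?t+b', c*?t+d))"
    using ac bd by (intro sum.cong refl) (auto simp: swapmat_entry)
  also have "\<dots> = X $$ (a*?t+b, c*?t+d)" using ac bd by (rule_tac sum_sum_delta) auto
  finally show ?thesis .
qed

lemma swap_conj_ops:
  assumes S: "idem (sdim S) (sproj S)" and T: "idem (sdim T) (sproj T)" and X: "X \<in> ops (stensor S T)"
  shows "swap_conj S T X \<in> ops (stensor T S)"
proof -
  have car: "X \<in> carrier_mat (sdim S * sdim T) (sdim S * sdim T)" using ops_carrier[OF X] by simp
  have "sliceR (sdim S) (swap_conj S T X) b d = sliceL (sdim S) (sdim T) X b d" if "b < sdim T" "d < sdim T" for b d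
    using that by (intro mat_carrier_eqI[of _ "sdim S" "sdim S"]) (auto simp: sliceR_entry sliceL_entry swap_conj_entry[OF car])
  moreover have "sliceL (sdim T) (sdim S) (swap_conj S T X) a c = sliceR (sdim T) X a c" if "a < sdim S" "c < sdim S" for a c
    using that by (intro mat_carrier_eqI[of _ "sdim T" "sdim T"]) (auto simp: sliceR_entry sliceL_entry swap_conj_entry[OF car])
  ultimately show ?thesis
    using X car by (auto simp: ops_tensor_slices[OF S T] ops_tensor_slices[OF T S])
qed

text \<open>Extensions keep the input in the first factor and the spectator last, whereas
  composition acts on the output factor. Conjugation by swaps translates between the two
  orders.\<close>

lemma swap_map_left_swap:
  assumes M: "M \<in> carrier_mat (sdim A * sdim B) (sdim A * sdim B)"
  shows "swap_conj C A (map_left (sdim B) (sdim A) (sdim C) Psi (swap_conj A B M))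
    = map_right (sdim A) (sdim B) (sdim C) Psi M"
proof (rule tensor_mat_eqI[of _ "sdim A" "sdim C"])
  fix a b c d assume ac: "a < sdim A" "c < sdim A" and bd: "b < sdim C" "d < sdim C"
  have "sliceL (sdim B) (sdim A) (swap_conj A B M) a c = sliceR (sdim B) M a c"
    using ac by (intro mat_carrier_eqI[of _ "sdim B" "sdim B"]) (auto simp: sliceR_entry sliceL_entry swap_conj_entry[OF M])
  then show "swap_conj C A (map_left (sdim B) (sdim A) (sdim C) Psi (swap_conj A B M)) $$ (a * sdim C + b, c * sdim C + d)
    = map_right (sdim A) (sdim B) (sdim C) Psi M $$ (a * sdim C + b, c * sdim C + d)"
    using ac bd by (simp add: swap_conj_entry map_left_entry map_right_entry)
qed auto

lemma swap_op_carrier [simp]: "idem (sdim A) (sproj A) \<Longrightarrow> swap_op A \<in> carrier_mat (sdim A * sdim A) (sdim A * sdim A)"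
  by (simp add: swap_op_def idem_def)

lemma swap_op_entry:
  assumes A: "idem (sdim A) (sproj A)"
    and lt: "a < sdim A" "b < sdim A" "c < sdim A" "d < sdim A"
  shows "swap_op A $$ (a * sdim A + b, c * sdim A + d) = sproj A $$ (a,d) * sproj A $$ (b,c)"
proof -
  let ?n = "sdim A" and ?P = "sproj A"
  have P: "?P \<in> carrier_mat ?n ?n" using A by (simp add: idem_def)
  have "(kron ?P ?P * swapmat ?n ?n) $$ (a*?n+b, e*?n+f) = ?P $$ (a,f) * ?P $$ (b,e)" if "e < ?n" "f < ?n" for e f
    using P lt that by (simp add: kron_left_entry[of _ ?n _ ?n] swapmat_entry sum_sum_delta)
  then have "swap_op A $$ (a*?n+b, c*?n+d)
      = (\<Sum>e<?n. \<Sum>f<?n. ?P $$ (a,f) * ?P $$ (b,e) * (?P $$ (e,c) * ?P $$ (f,d)))"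
    using P lt unfolding swap_op_def by (simp add: kron_right_entry[of _ ?n _ ?n])
  also have "\<dots> = (\<Sum>e<?n. ?P $$ (b,e) * ?P $$ (e,c)) * (\<Sum>f<?n. ?P $$ (a,f) * ?P $$ (f,d))"
    by (simp add: sum_product mult_ac)
  also have "\<dots> = ?P $$ (a,d) * ?P $$ (b,c)"
    using ops_entry[OF A sproj_ops[OF A]] lt by simp
  finally show ?thesis .
qed

section \<open>The Fullwood--Parzygnat function\<close>

text \<open>The value of the function on the identity channel: \<open>1/2 {s \<otimes> P, F}\<close> with \<open>F\<close> the swap on the
  range of \<open>P \<otimes> P\<close>.\<close>
definition fpker :: "nat \<Rightarrow> cmat \<Rightarrow> cmat \<Rightarrow> cmat" where
  "fpker n P s = mat (n*n) (n*n) (\<lambda>(i,j). (1/2) * (P $$ (i mod n, j div n) * s $$ (i div n, j mod n)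
     + s $$ (i mod n, j div n) * P $$ (i div n, j mod n)))"

lemma fpker_carrier [simp]: "fpker n P s \<in> carrier_mat (n*n) (n*n)"
  by (simp add: fpker_def)

lemma fpker_entry:
  "a < n \<Longrightarrow> x < n \<Longrightarrow> c < n \<Longrightarrow> y < n \<Longrightarrow> fpker n P s $$ (a*n+x, c*n+y)
    = (1/2) * (P $$ (x,c) * s $$ (a,y) + s $$ (x,c) * P $$ (a,y))"
  by (simp add: fpker_def)

lemma sliceR_fpker:
  "a < n \<Longrightarrow> c < n \<Longrightarrow> sliceR n (fpker n P s) a c = (1/2) \<cdot>\<^sub>m (dyad n P s c a + dyad n s P c a)"
  by (intro mat_carrier_eqI[of _ n n]) (auto simp: sliceR_entry fpker_entry smult_entry[of _ n n] add_entry[of _ n n])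

lemma sliceL_fpker:
  "b < n \<Longrightarrow> d < n \<Longrightarrow> sliceL n n (fpker n P s) b d = (1/2) \<cdot>\<^sub>m (dyad n s P d b + dyad n P s d b)"
  by (intro mat_carrier_eqI[of _ n n])
     (auto simp: sliceL_entry fpker_entry smult_entry[of _ n n] add_entry[of _ n n] mult.commute[of "P $$ _"])

lemma ops_add:
  "idem (sdim S) (sproj S) \<Longrightarrow> X \<in> ops S \<Longrightarrow> Y \<in> ops S \<Longrightarrow> X + Y \<in> ops S"
  using idem_carrier[of "sdim S" "sproj S"]
  by (auto simp: ops_iff mult_add_distrib_mat[of _ "sdim S" "sdim S"] add_mult_distrib_mat[of _ "sdim S" "sdim S"])

lemma fpker_ops:
  assumes A: "idem (sdim A) (sproj A)" and s: "s \<in> ops A"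
  shows "fpker (sdim A) (sproj A) s \<in> ops (stensor A A)"
  using assms by (auto simp: ops_tensor_slices sliceR_fpker sliceL_fpker sproj_ops intro!: ops_smult ops_add dyad_ops)

lemma jam_carrier [simp]: "jam A B Phi \<in> carrier_mat (sdim A * sdim B) (sdim A * sdim B)"
  by (simp add: jam_def)

text \<open>In both products with the Jamiolkowski operator the factor \<open>sproj B\<close> is
  absorbed, because values of \<open>Phi\<close> lie in \<open>ops B\<close>. The factor
  \<open>s\<close> merely forms linear combinations of blocks, so by linearity it moves inside
  \<open>Phi\<close> and turns P E P into P E s or s E P.\<close>

lemma fp_formula:
  assumes A: "idem (sdim A) (sproj A)" and B: "idem (sdim B) (sproj B)"
    and Phi: "lin_map A B Phi" and s: "s \<in> ops A"
  shows "fp A B Phi s = map_right (sdim A) (sdim A) (sdim B) Phi (fpker (sdim A) (sproj A) s)"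
proof (rule tensor_mat_eqI[of _ "sdim A" "sdim B"])
  let ?n = "sdim A" and ?m = "sdim B" and ?P = "sproj A" and ?Q = "sproj B"
  have P: "?P \<in> carrier_mat ?n ?n" and Q: "?Q \<in> carrier_mat ?m ?m" and sc: "s \<in> carrier_mat ?n ?n"
    using A B s by (auto simp: idem_def ops_carrier)
  note Pops = sproj_ops[OF A]
  have dy: "dyad ?n ?P ?P c d \<in> ops A" if "c < ?n" "d < ?n" for c d using dyad_ops[OF A Pops Pops that] .
  have jam: "jam A B Phi $$ (c*?m+b, a*?m+d) = Phi (dyad ?n ?P ?P a c) $$ (b,d)"
    if "a < ?n" "c < ?n" "b < ?m" "d < ?m" for a b c d
  proof -
    \<comment> \<open>The blocks of the swap operator are compressed matrix units with exchanged
      indices.\<close>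
    have "sliceR ?n (swap_op A) c a = dyad ?n ?P ?P a c"
      using that by (intro mat_carrier_eqI[of _ ?n ?n]) (auto simp: sliceR_entry swap_op_entry[OF A])
    then show ?thesis using that by (simp add: jam_def map_right_entry)
  qed
  fix a b c d assume ac: "a < ?n" "c < ?n" and bd: "b < ?m" "d < ?m"
  have "(kron s ?Q * jam A B Phi) $$ (a*?m+b, c*?m+d)
      = (\<Sum>e<?n. s $$ (a,e) * (\<Sum>f<?m. ?Q $$ (b,f) * Phi (dyad ?n ?P ?P c e) $$ (f,d)))"
    using sc Q ac bd by (simp add: kron_left_entry[of _ ?n _ ?m] jam sum_distrib_left mult.assoc)
  also have "\<dots> = (\<Sum>e<?n. s $$ (a,e) * Phi (dyad ?n ?P ?P c e) $$ (b,d))"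
    using ops_entry(1)[OF B lin_map_ops[OF Phi dy]] ac bd by simp
  also have "\<dots> = Phi (dyad ?n ?P s c a) $$ (b,d)"
  proof (rule lin_map_lincomb_entry[OF A Phi, symmetric])
    fix x y assume "x < ?n" "y < ?n"
    then show "dyad ?n ?P s c a $$ (x,y) = (\<Sum>e<?n. s $$ (a,e) * dyad ?n ?P ?P c e $$ (x,y))"
      using ops_entry(2)[OF A s ac(1)] by (simp add: mult.left_commute[of "s $$ _"] sum_distrib_left[symmetric])
  qed (use ac bd dy in auto)
  finally have left: "(kron s ?Q * jam A B Phi) $$ (a*?m+b, c*?m+d) = Phi (dyad ?n ?P s c a) $$ (b,d)" .
  have "(jam A B Phi * kron s ?Q) $$ (a*?m+b, c*?m+d)
      = (\<Sum>e<?n. s $$ (e,c) * (\<Sum>f<?m. Phi (dyad ?n ?P ?P e a) $$ (b,f) * ?Q $$ (f,d)))"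
    using sc Q ac bd by (simp add: kron_right_entry[of _ ?n _ ?m] jam sum_distrib_left mult_ac)
  also have "\<dots> = (\<Sum>e<?n. s $$ (e,c) * Phi (dyad ?n ?P ?P e a) $$ (b,d))"
    using ops_entry(2)[OF B lin_map_ops[OF Phi dy]] ac bd by simp
  also have "\<dots> = Phi (dyad ?n s ?P c a) $$ (b,d)"
  proof (rule lin_map_lincomb_entry[OF A Phi, symmetric])
    fix x y assume "x < ?n" "y < ?n"
    then show "dyad ?n s ?P c a $$ (x,y) = (\<Sum>e<?n. s $$ (e,c) * dyad ?n ?P ?P e a $$ (x,y))"
      using ops_entry(1)[OF A s _ ac(2), of x]
      by (simp add: mult.assoc[symmetric] sum_distrib_right[symmetric] mult.commute[of "s $$ _"])
  qed (use ac bd dy in auto)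
  finally have right: "(jam A B Phi * kron s ?Q) $$ (a*?m+b, c*?m+d) = Phi (dyad ?n s ?P c a) $$ (b,d)" .
  have ds: "dyad ?n ?P s c a \<in> ops A" "dyad ?n s ?P c a \<in> ops A"
    using dyad_ops[OF A] Pops s ac by auto
  have "Phi (sliceR ?n (fpker ?n ?P s) a c) = (1/2) \<cdot>\<^sub>m (Phi (dyad ?n ?P s c a) + Phi (dyad ?n s ?P c a))"
    using Phi ds ops_add[OF A ds] ac by (simp add: sliceR_fpker lin_map_def linear_on_def)
  then show "fp A B Phi s $$ (a*?m+b, c*?m+d)
      = map_right ?n ?n ?m Phi (fpker ?n ?P s) $$ (a*?m+b, c*?m+d)"
    using ac bd sc Q left right lin_map_carrier[OF Phi ds(1)] lin_map_carrier[OF Phi ds(2)]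
    by (simp add: fp_def map_right_entry smult_entry[of _ "?n*?m" "?n*?m"] add_entry[of _ "?n*?m" "?n*?m"]
        smult_entry[of _ ?m ?m] add_entry[of _ ?m ?m])
next
  show "fp A B Phi s \<in> carrier_mat (sdim A * sdim B) (sdim A * sdim B)"
    using idem_carrier[OF B] ops_carrier[OF s] by (auto simp: fp_def)
qed auto

lemma fp_entry:
  assumes A: "idem (sdim A) (sproj A)" and B: "idem (sdim B) (sproj B)"
    and Phi: "lin_map A B Phi" and s: "s \<in> ops A"
    and "a < sdim A" "c < sdim A" "b < sdim B" "d < sdim B"
  shows "fp A B Phi s $$ (a * sdim B + b, c * sdim B + d)
    = Phi (sliceR (sdim A) (fpker (sdim A) (sproj A) s) a c) $$ (b,d)"
  using assms by (simp add: fp_formula map_right_entry)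

lemma fp_ops:
  assumes A: "idem (sdim A) (sproj A)" and B: "idem (sdim B) (sproj B)"
    and Phi: "lin_map A B Phi" and s: "s \<in> ops A"
  shows "fp A B Phi s \<in> ops (stensor A B)"
  using map_right_ops[OF A A B Phi fpker_ops[OF A s]] by (simp add: fp_formula assms)

lemma kron_add_left:
  assumes "X \<in> carrier_mat n n" "Y \<in> carrier_mat n n" "Q \<in> carrier_mat m m"
  shows "kron (X + Y) Q = kron X Q + kron Y Q"
  using assms
  by (intro tensor_mat_eqI[of _ n m])
     (auto simp: kron_entry[of _ n n _ m m] add_entry[of _ n n] add_entry[of _ "n*m" "n*m"] distrib_right)

lemma kron_smult_left:
  assumes "X \<in> carrier_mat n n" "Q \<in> carrier_mat m m"
  shows "kron (c \<cdot>\<^sub>m X) Q = c \<cdot>\<^sub>m kron X Q"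
  using assms
  by (intro tensor_mat_eqI[of _ n m])
     (auto simp: kron_entry[of _ n n _ m m] smult_entry[of _ n n] smult_entry[of _ "n*m" "n*m"])

lemma fp_lin_map:
  assumes A: "idem (sdim A) (sproj A)" and B: "idem (sdim B) (sproj B)" and Phi: "lin_map A B Phi"
  shows "lin_map A (stensor A B) (fp A B Phi)"
proof -
  let ?n = "sdim A" and ?m = "sdim B" and ?Q = "sproj B" and ?J = "jam A B Phi"
  have Q: "?Q \<in> carrier_mat ?m ?m" using B by (simp add: idem_def)
  have J: "?J \<in> carrier_mat (?n*?m) (?n*?m)" by simp
  have "fp A B Phi (X + Y) = fp A B Phi X + fp A B Phi Y" if "X \<in> ops A" "Y \<in> ops A" for X Y
  proof -
    have XY: "X \<in> carrier_mat ?n ?n" "Y \<in> carrier_mat ?n ?n" using that by (auto simp: ops_carrier)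
    have K: "kron X ?Q \<in> carrier_mat (?n*?m) (?n*?m)" "kron Y ?Q \<in> carrier_mat (?n*?m) (?n*?m)"
      using XY Q by auto
    show ?thesis unfolding fp_def kron_add_left[OF XY Q] add_mult_distrib_mat[OF K J] mult_add_distrib_mat[OF J K]
      using K J
      by (intro mat_carrier_eqI[of _ "?n*?m" "?n*?m"])
         (auto simp: add_entry[of _ "?n*?m" "?n*?m"] smult_entry[of _ "?n*?m" "?n*?m"] algebra_simps)
  qed
  moreover have "fp A B Phi (c \<cdot>\<^sub>m X) = c \<cdot>\<^sub>m fp A B Phi X" if "X \<in> ops A" for X c
  proof -
    have X: "X \<in> carrier_mat ?n ?n" using that by (auto simp: ops_carrier)
    have K: "kron X ?Q \<in> carrier_mat (?n*?m) (?n*?m)" using X Q by auto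
    show ?thesis unfolding fp_def kron_smult_left[OF X Q] mult_smult_assoc_mat[OF K J] mult_smult_distrib[OF J K]
      using K J
      by (intro mat_carrier_eqI[of _ "?n*?m" "?n*?m"])
         (auto simp: add_entry[of _ "?n*?m" "?n*?m"] smult_entry[of _ "?n*?m" "?n*?m"] algebra_simps)
  qed
  ultimately show ?thesis using fp_ops[OF A B Phi] by (simp add: lin_map_def linear_on_def)
qed

text \<open>The diagonal blocks of the kernel add up to (P s + s P)/2 = s, and \<open>Phi\<close> is
  linear.\<close>

lemma fp_ptrace_left:
  assumes A: "idem (sdim A) (sproj A)" and B: "idem (sdim B) (sproj B)"
    and Phi: "lin_map A B Phi" and s: "s \<in> ops A"
  shows "ptrace_left (sdim A) (sdim B) (fp A B Phi s) = Phi s"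
proof (rule mat_carrier_eqI[of _ "sdim B" "sdim B"])
  let ?n = "sdim A" and ?K = "fpker (sdim A) (sproj A) s"
  fix b d assume bd: "b < sdim B" "d < sdim B"
  have "Phi s $$ (b,d) = (\<Sum>a<?n. 1 * Phi (sliceR ?n ?K a a) $$ (b,d))"
  proof (rule lin_map_lincomb_entry[OF A Phi])
    fix x y assume xy: "x < ?n" "y < ?n"
    have "(\<Sum>a<?n. 1 * sliceR ?n ?K a a $$ (x,y))
        = (\<Sum>a<?n. (1/2) * (sproj A $$ (x,a) * s $$ (a,y) + s $$ (x,a) * sproj A $$ (a,y)))"
      using xy by (intro sum.cong refl) (simp add: sliceR_entry fpker_entry)
    also have "\<dots> = (1/2) * ((\<Sum>a<?n. sproj A $$ (x,a) * s $$ (a,y)) + (\<Sum>a<?n. s $$ (x,a) * sproj A $$ (a,y)))"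
      by (simp only: sum_distrib_left sum.distrib distrib_left)
    finally show "s $$ (x,y) = (\<Sum>a<?n. 1 * sliceR ?n ?K a a $$ (x,y))"
      using ops_entry[OF A s xy] by simp
  qed (use sliceR_ops[OF A A fpker_ops[OF A s]] ops_carrier[OF s] bd in auto)
  then show "ptrace_left (sdim A) (sdim B) (fp A B Phi s) $$ (b,d) = Phi s $$ (b,d)"
    using bd by (simp add: ptrace_left_def fp_entry assms)
qed (use lin_map_carrier[OF Phi s] in \<open>auto simp: ptrace_left_def\<close>)

text \<open>Trace preservation removes \<open>Phi\<close> from each block, and the trace of the
  block at \<open>a\<close>, \<open>c\<close> of the kernel is the entry of (s P + P s)/2 =
  s.\<close>

lemma fp_ptrace_right:
  assumes A: "idem (sdim A) (sproj A)" and B: "idem (sdim B) (sproj B)"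
    and Phi: "lin_map A B Phi" and tr: "\<And>X. X \<in> ops A \<Longrightarrow> mtrace (Phi X) = mtrace X" and s: "s \<in> ops A"
  shows "ptrace_right (sdim A) (sdim B) (fp A B Phi s) = s"
proof (rule mat_carrier_eqI[of _ "sdim A" "sdim A"])
  let ?n = "sdim A" and ?K = "fpker (sdim A) (sproj A) s"
  fix a c assume ac: "a < ?n" "c < ?n"
  have sl: "sliceR ?n ?K a c \<in> ops A" using sliceR_ops[OF A A fpker_ops[OF A s] ac] .
  have "ptrace_right (sdim A) (sdim B) (fp A B Phi s) $$ (a,c) = (\<Sum>b<sdim B. Phi (sliceR ?n ?K a c) $$ (b,b))"
    using ac by (simp add: ptrace_right_def fp_entry assms)
  also have "\<dots> = mtrace (Phi (sliceR ?n ?K a c))"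
    using lin_map_carrier[OF Phi sl] by (simp add: mtrace_def)
  also have "\<dots> = (\<Sum>x<?n. sliceR ?n ?K a c $$ (x,x))"
    using tr[OF sl] ops_carrier[OF sl] by (simp add: mtrace_def)
  also have "\<dots> = (\<Sum>x<?n. (1/2) * (s $$ (a,x) * sproj A $$ (x,c) + sproj A $$ (a,x) * s $$ (x,c)))"
    using ac by (intro sum.cong refl) (simp add: sliceR_entry fpker_entry mult.commute[of "s $$ _"])
  also have "\<dots> = (1/2) * ((\<Sum>x<?n. s $$ (a,x) * sproj A $$ (x,c)) + (\<Sum>x<?n. sproj A $$ (a,x) * s $$ (x,c)))"
    by (simp only: sum_distrib_left sum.distrib distrib_left)
  also have "\<dots> = s $$ (a,c)" using ops_entry[OF A s ac] by simp
  finally show "ptrace_right (sdim A) (sdim B) (fp A B Phi s) $$ (a,c) = s $$ (a,c)" .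
qed (use ops_carrier[OF s] in \<open>auto simp: ptrace_right_def\<close>)

section \<open>The Fullwood--Parzygnat function: marginals, completeness and
  compositionality\<close>

lemma sotfD:
  assumes "is_sotf star" "is_system A" "is_system B" "is_channel A B Phi" "is_state A rho"
  shows "star A B Phi rho \<in> ops (stensor A B)"
    and "ptrace_left (sdim A) (sdim B) (star A B Phi rho) = Phi rho"
    and "ptrace_right (sdim A) (sdim B) (star A B Phi rho) = rho"
    and "star A B Phi rho \<in> carrier_mat (sdim A * sdim B) (sdim A * sdim B)"
proof -
  show *: "star A B Phi rho \<in> ops (stensor A B)"
    and "ptrace_left (sdim A) (sdim B) (star A B Phi rho) = Phi rho"
    and "ptrace_right (sdim A) (sdim B) (star A B Phi rho) = rho"
    using assms unfolding is_sotf_def by blast+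
  show "star A B Phi rho \<in> carrier_mat (sdim A * sdim B) (sdim A * sdim B)"
    using ops_carrier[OF *] by simp
qed

lemma is_sotf_fp: "is_sotf fp"
  unfolding is_sotf_def
  by (auto simp: fp_ops fp_ptrace_left fp_ptrace_right idem_sproj channel_lin_map is_state_def is_channel_def)

lemma qsost_ops:
  assumes star: "is_sotf star" and A: "is_system A" and E: "is_system E" and X: "qsost star A E X"
  shows "X \<in> ops (stensor A E)"
  using X unfolding qsost_def
proof (elim disjE exE conjE)
  fix F sigma assume "is_channel A E F" "is_state A sigma" "X = star A E F sigma"
  then show ?thesis using star A E by (simp add: sotfD)
next
  fix F sigma assume "is_channel E A F" "is_state E sigma" "X = swap_conj E A (star E A F sigma)"
  then show ?thesis using star A E by (simp add: swap_conj_ops idem_sproj sotfD(1))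
qed (simp add: is_state_def)

text \<open>Fixing the spectator indices reduces the claim to the marginal of a single slice; the
  two index conventions differ only in the bracketing of the triple tensor product.\<close>

lemma ptrace_left_map_left_fp:
  assumes A: "idem (sdim A) (sproj A)" and B: "idem (sdim B) (sproj B)" and E: "idem (sdim E) (sproj E)"
    and Phi: "lin_map A B Phi" and X: "X \<in> ops (stensor A E)"
  shows "ptrace_left (sdim A) (sdim B * sdim E) (map_left (sdim A) (sdim E) (sdim A * sdim B) (fp A B Phi) X)
    = map_left (sdim A) (sdim E) (sdim B) Phi X"
proof (rule tensor_mat_eqI[of _ "sdim B" "sdim E"])
  fix b e d f assume bd: "b < sdim B" "d < sdim B" and ef: "e < sdim E" "f < sdim E"
  let ?s = "sliceL (sdim A) (sdim E) X e f"
  have idx: "a * (sdim B * sdim E) + (b * sdim E + e) = (a * sdim B + b) * sdim E + e" for a b e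
    by (simp add: algebra_simps)
  have s: "?s \<in> ops A" using sliceL_ops[OF A E X ef] .
  have "(\<Sum>a<sdim A. fp A B Phi ?s $$ (a * sdim B + b, a * sdim B + d)) = Phi ?s $$ (b,d)"
    using arg_cong[OF fp_ptrace_left[OF A B Phi s], of "\<lambda>M. M $$ (b,d)"] bd by (simp add: ptrace_left_def)
  then show "ptrace_left (sdim A) (sdim B * sdim E) (map_left (sdim A) (sdim E) (sdim A * sdim B) (fp A B Phi) X)
       $$ (b * sdim E + e, d * sdim E + f) = map_left (sdim A) (sdim E) (sdim B) Phi X $$ (b * sdim E + e, d * sdim E + f)"
    using bd ef by (simp add: ptrace_left_def idx map_left_entry)
qed (auto simp: ptrace_left_def)

lemma valid_ext_fp:
  "valid_ext fp (\<lambda>A B E Phi. map_left (sdim A) (sdim E) (sdim A * sdim B) (fp A B Phi))"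
  unfolding valid_ext_def
proof (intro conjI allI impI; elim conjE)
  fix A B Phi rho c
  assume *: "is_system A" "is_system B" "is_channel A B Phi" "is_state A rho"
  then have rho: "rho \<in> ops A" by (simp add: is_state_def)
  note A = idem_sproj[OF *(1)] and B = idem_sproj[OF *(2)]
  note fp = fp_lin_map[OF A B channel_lin_map[OF *(3)]]
  show "map_left (sdim A) (sdim triv_sys) (sdim A * sdim B) (fp A B Phi) (c \<cdot>\<^sub>m rho) = c \<cdot>\<^sub>m fp A B Phi rho"
    using fp rho ops_carrier[OF rho] lin_map_carrier[OF fp ops_smult[OF A rho]]
    by (simp add: map_left_triv lin_map_def linear_on_def del: One_nat_def)
next
  fix A B E Phi rho
  assume *: "is_system A" "is_system B" "is_system E" "is_channel A B Phi" "qsost fp A E rho"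
  note A = idem_sproj[OF *(1)] and B = idem_sproj[OF *(2)] and E = idem_sproj[OF *(3)] and Phi = channel_lin_map[OF *(4)]
  note rho = qsost_ops[OF is_sotf_fp *(1,3,5)]
  note fp = fp_lin_map[OF A B Phi]
  show "map_left (sdim A) (sdim E) (sdim A * sdim B) (fp A B Phi) rho \<in> ops (stensor (stensor A B) E)"
    using map_left_ops[OF E A idem_stensor[OF A B] fp rho] by simp
  show "ptrace_left (sdim A) (sdim B * sdim E) (map_left (sdim A) (sdim E) (sdim A * sdim B) (fp A B Phi) rho)
     = map_left (sdim A) (sdim E) (sdim B) Phi rho"
    by (rule ptrace_left_map_left_fp[OF A B E Phi rho])
  fix E' I assume "is_system E'" "is_cptni E E' I"
  then show "map_right (sdim A * sdim B) (sdim E) (sdim E') I (map_left (sdim A) (sdim E) (sdim A * sdim B) (fp A B Phi) rho)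
     = map_left (sdim A) (sdim E') (sdim A * sdim B) (fp A B Phi) (map_right (sdim A) (sdim E) (sdim E') I rho)"
    using map_right_map_left[OF A E idem_sproj fp cptni_lin_map rho] by simp
qed

lemma axiom_E_fp: "axiom_E fp"
  using valid_ext_fp unfolding axiom_E_def by blast

text \<open>The spectator marginal fixed by a valid extension makes compositionality explicit.\<close>
lemma valid_ext_compose:
  assumes star: "is_sotf star" and ext: "valid_ext star ext"
    and A: "is_system A" and B: "is_system B" and C: "is_system C"
    and Phi: "is_channel A B Phi" and Psi: "is_channel B C Psi" and rho: "is_state A rho"
  shows "swap_conj C A (ptrace_left (sdim B) (sdim C * sdim A) (ext B C A Psi (swap_conj A B (star A B Phi rho))))
    = map_right (sdim A) (sdim B) (sdim C) Psi (star A B Phi rho)"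
proof -
  have car: "star A B Phi rho \<in> carrier_mat (sdim A * sdim B) (sdim A * sdim B)"
    by (rule sotfD[OF star A B Phi rho])
  \<comment> \<open>The input of \<open>Psi\<close> has to be the first factor, so the state over
    time is presented in swapped order, which the last clause of \<open>qsost\<close>
    admits.\<close>
  have "qsost star B A (swap_conj A B (star A B Phi rho))"
    using Phi rho unfolding qsost_def by blast
  then have "ptrace_left (sdim B) (sdim C * sdim A) (ext B C A Psi (swap_conj A B (star A B Phi rho)))
      = map_left (sdim B) (sdim A) (sdim C) Psi (swap_conj A B (star A B Phi rho))"
    using ext A B C Psi unfolding valid_ext_def by blast
  then show ?thesis by (simp add: swap_map_left_swap[OF car])
qed

lemma axiom_P_fp: "axiom_P fp"
  unfolding axiom_P_def
proof (intro exI conjI allI impI; (elim conjE)?)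
  show "valid_ext fp (\<lambda>A B E Phi. map_left (sdim A) (sdim E) (sdim A * sdim B) (fp A B Phi))"
    by (rule valid_ext_fp)
  fix A B C Phi Psi rho
  assume *: "is_system A" "is_system B" "is_system C" "is_channel A B Phi" "is_channel B C Psi" "is_state A rho"
  note A = idem_sproj[OF *(1)] and B = idem_sproj[OF *(2)] and C = idem_sproj[OF *(3)]
    and Phi = channel_lin_map[OF *(4)] and Psi = channel_lin_map[OF *(5)]
  have rho: "rho \<in> ops A" using * by (simp add: is_state_def)
  \<comment> \<open>Both sides apply a map to the second factor of one kernel that depends on the
    state but not on the channel.\<close>
  have "map_right (sdim A) (sdim B) (sdim C) Psi (fp A B Phi rho) = fp A C (Psi \<circ> Phi) rho"
    unfolding fp_formula[OF A B Phi rho] fp_formula[OF A C lin_map_comp[OF Phi Psi] rho]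
    by (rule map_right_comp) (rule lin_map_carrier[OF Phi sliceR_ops[OF A A fpker_ops[OF A rho]]])
  then show "swap_conj C A (ptrace_left (sdim B) (sdim C * sdim A)
      (map_left (sdim B) (sdim A) (sdim B * sdim C) (fp B C Psi) (swap_conj A B (fp A B Phi rho))))
      = fp A C (Psi \<circ> Phi) rho"
    using valid_ext_compose[OF is_sotf_fp valid_ext_fp *] by simp
qed

section \<open>Time reversal symmetry of the Fullwood--Parzygnat function\<close>

lemma lin_map_ident: "lin_map A A (\<lambda>X. X)"
  by (simp add: lin_map_def linear_on_def)

lemma fp_ident:
  assumes "idem (sdim A) (sproj A)" "s \<in> ops A"
  shows "fp A A (\<lambda>X. X) s = fpker (sdim A) (sproj A) s"
  using assms by (simp add: fp_formula lin_map_ident map_right_ident)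

lemma swap_op_eq:
  assumes A: "idem (sdim A) (sproj A)"
  shows "swap_op A = kron (sproj A) (sproj A) * swapmat (sdim A) (sdim A)"
    and "swap_op A = swapmat (sdim A) (sdim A) * kron (sproj A) (sproj A)"
proof -
  let ?n = "sdim A" and ?P = "sproj A"
  have P: "?P \<in> carrier_mat ?n ?n" using A by (simp add: idem_def)
  show "swap_op A = kron ?P ?P * swapmat ?n ?n"
    using P A by (intro tensor_mat_eqI[of _ ?n ?n])
      (auto simp: swap_op_entry kron_left_entry[of _ ?n _ ?n] swapmat_entry sum_sum_delta)
  show "swap_op A = swapmat ?n ?n * kron ?P ?P"
    using P A by (intro tensor_mat_eqI[of _ ?n ?n])
      (auto simp: swap_op_entry kron_right_entry[of _ ?n _ ?n] swapmat_entry sum_sum_delta mult.commute)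
qed

text \<open>The compressions contained in \<open>swap_op\<close> are absorbed by \<open>M\<close>,
  which makes axiom (T) a plain symmetry of entries.\<close>

lemma swap_op_conj:
  assumes A: "idem (sdim A) (sproj A)" and M: "M \<in> ops (stensor A A)"
  shows "swap_op A * M * swap_op A = swap_conj A A M"
proof -
  let ?n = "sdim A" let ?N = "?n * ?n" and ?F = "swapmat ?n ?n" and ?K = "kron (sproj A) (sproj A)"
  have car: "?F \<in> carrier_mat ?N ?N" "?K \<in> carrier_mat ?N ?N" "M \<in> carrier_mat ?N ?N"
    using idem_carrier[OF A] ops_carrier[OF M] by auto
  have KF: "?K * ?F \<in> carrier_mat ?N ?N" using car by simp
  have KM: "?K * M = M" "M * ?K = M" using M ops_iff[OF idem_stensor[OF A A]] by auto
  have "swap_op A * M * swap_op A = ?F * ?K * M * (?K * ?F)"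
    using swap_op_eq[OF A] by simp
  also have "\<dots> = ?F * (?K * M) * (?K * ?F)" using assoc_mult_mat[OF car] by simp
  also have "\<dots> = ?F * (M * (?K * ?F))" using assoc_mult_mat[OF car(1,3) KF] KM by simp
  also have "\<dots> = ?F * (M * ?K * ?F)" using assoc_mult_mat[OF car(3,2,1)] by simp
  also have "\<dots> = swap_conj A A M" unfolding swap_conj_def KM using assoc_mult_mat[OF car(1,3,1)] by simp
  finally show ?thesis .
qed

lemma axiom_T_fp: "axiom_T fp"
  unfolding axiom_T_def
proof (intro allI impI; elim conjE)
  fix A rho assume "is_system A" "is_state A rho"
  then have A: "idem (sdim A) (sproj A)" and rho: "rho \<in> ops A" by (auto simp: idem_sproj is_state_def)
  \<comment> \<open>The swap exchanges the two summands of the anticommutator.\<close>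
  have "swap_conj A A (fpker (sdim A) (sproj A) rho) = fpker (sdim A) (sproj A) rho"
    by (rule tensor_mat_eqI[of _ "sdim A" "sdim A"])
       (auto simp: swap_conj_entry fpker_entry mult.commute[of "sproj A $$ _"])
  then show "swap_op A * fp A A (\<lambda>X. X) rho * swap_op A = fp A A (\<lambda>X. X) rho"
    by (simp add: fp_ident[OF A rho] swap_op_conj[OF A fpker_ops[OF A rho]])
qed

section \<open>Classical conditionability of the Fullwood--Parzygnat function\<close>

lemma mult_orthogonal_family:
  assumes "finite I" "i \<in> I" "\<And>j. j \<in> I \<Longrightarrow> Ps j \<in> carrier_mat n n" "Ps i * Ps i = Ps i"
    and "\<And>j. j \<in> I \<Longrightarrow> j \<noteq> i \<Longrightarrow> Ps i * Ps j = 0\<^sub>m n n"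
    and "\<And>j. j \<in> I \<Longrightarrow> j \<noteq> i \<Longrightarrow> Ps j * Ps i = 0\<^sub>m n n"
  shows "Ps i * msum n I (\<lambda>j. c j \<cdot>\<^sub>m Ps j) = c i \<cdot>\<^sub>m Ps i"
    and "msum n I (\<lambda>j. c j \<cdot>\<^sub>m Ps j) * Ps i = c i \<cdot>\<^sub>m Ps i"
proof -
  have car: "Ps i \<in> carrier_mat n n" using assms by auto
  have "Ps i * msum n I (\<lambda>j. c j \<cdot>\<^sub>m Ps j) = msum n I (\<lambda>j. c j \<cdot>\<^sub>m (Ps i * Ps j))"
    using assms car by (subst mult_msum) (auto simp: mult_smult_distrib[of _ n n _ n] intro!: msum_cong)
  also have "\<dots> = msum n I (\<lambda>j. if j = i then c i \<cdot>\<^sub>m Ps i else 0\<^sub>m n n)"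
    using assms by (intro msum_cong) auto
  also have "\<dots> = c i \<cdot>\<^sub>m Ps i"
    using assms car by (intro mat_carrier_eqI[of _ n n]) (auto simp: if_distrib if_distribR sum.delta cong: if_cong)
  finally show "Ps i * msum n I (\<lambda>j. c j \<cdot>\<^sub>m Ps j) = c i \<cdot>\<^sub>m Ps i" .
  have "msum n I (\<lambda>j. c j \<cdot>\<^sub>m Ps j) * Ps i = msum n I (\<lambda>j. c j \<cdot>\<^sub>m (Ps j * Ps i))"
    using assms car by (subst msum_mult) (auto simp: mult_smult_assoc_mat[of _ n n _ n] intro!: msum_cong)
  also have "\<dots> = msum n I (\<lambda>j. if j = i then c i \<cdot>\<^sub>m Ps i else 0\<^sub>m n n)"
    using assms by (intro msum_cong) auto
  also have "\<dots> = c i \<cdot>\<^sub>m Ps i"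
    using assms car by (intro mat_carrier_eqI[of _ n n]) (auto simp: if_distrib if_distribR sum.delta cong: if_cong)
  finally show "msum n I (\<lambda>j. c j \<cdot>\<^sub>m Ps j) * Ps i = c i \<cdot>\<^sub>m Ps i" .
qed

lemma one_smult: "X \<in> carrier_mat n n \<Longrightarrow> (1::complex) \<cdot>\<^sub>m X = X"
  by (intro mat_carrier_eqI[of _ n n]) auto

text \<open>The averaged state is a scalar on each block: multiplying it by \<open>Ps i\<close>
  gives a multiple of \<open>Ps i\<close>. Pinching a block of its kernel therefore leaves multiples
  of the dyads built from \<open>Ps i\<close>, and these are also the blocks of the kernel of the
  maximally mixed state of the subsystem.\<close>

lemma axiom_CC_fp: "axiom_CC fp"
  unfolding axiom_CC_def
proof (intro allI impI; elim conjE)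
  fix A B Phi and I :: "nat set" and Ps and lam :: "nat \<Rightarrow> real"
  assume sysA: "is_system A" and sysB: "is_system B" and fin: "finite I"
    and sys: "\<forall>i\<in>I. is_system (sdim A, Ps i)"
    and orth: "\<forall>i\<in>I. \<forall>j\<in>I. i \<noteq> j \<longrightarrow> Ps i * Ps j = 0\<^sub>m (sdim A) (sdim A)"
    and sum: "msum (sdim A) I Ps = sproj A"
    and chan: "is_channel A B Phi"
    and pinch: "\<forall>X\<in>ops A. Phi (msum (sdim A) I (\<lambda>i. Ps i * X * Ps i)) = Phi X"
  let ?n = "sdim A" and ?m = "sdim B" and ?P = "sproj A"
  let ?t = "\<lambda>i. 1 / mtrace (Ps i)"
  \<comment> \<open>The eigenvalue of the averaged state on the range of \<open>Ps i\<close>: the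
    weight divided by the dimension of the block.\<close>
  let ?c = "\<lambda>i. complex_of_real (lam i) * ?t i"
  let ?D = "\<lambda>i c a. dyad ?n (Ps i) (Ps i) c a"
  have A: "idem ?n ?P" and B: "idem ?m (sproj B)" using sysA sysB by (auto intro: idem_sproj)
  have Phi: "lin_map A B Phi" using chan by (rule channel_lin_map)
  have Pi: "Ps i \<in> carrier_mat ?n ?n" "Ps i * Ps i = Ps i" "idem ?n (Ps i)" if "i \<in> I" for i
    using that sys idem_sproj[of "(?n, Ps i)"] by (auto simp: idem_def)
  have fam: "Ps i * msum ?n I (\<lambda>j. c j \<cdot>\<^sub>m Ps j) = c i \<cdot>\<^sub>m Ps i" "msum ?n I (\<lambda>j. c j \<cdot>\<^sub>m Ps j) * Ps i = c i \<cdot>\<^sub>m Ps i"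
    if "i \<in> I" for i c
    using mult_orthogonal_family[OF fin that, of Ps ?n c] Pi orth that by auto
  have P: "?P = msum ?n I (\<lambda>j. 1 \<cdot>\<^sub>m Ps j)"
    unfolding sum[symmetric] by (rule msum_cong) (simp add: one_smult[OF Pi(1)])
  have PPi: "?P * Ps i = Ps i" "Ps i * ?P = Ps i" if "i \<in> I" for i
    using fam[OF that, of "\<lambda>_. 1"] Pi(1)[OF that] unfolding P[symmetric] by (simp_all add: one_smult)
  have Piops: "Ps i \<in> ops A" if "i \<in> I" for i
    using that Pi PPi by (simp add: ops_iff[OF A])
  define s where "s = msum ?n I (\<lambda>i. ?c i \<cdot>\<^sub>m Ps i)"
  have s: "s \<in> ops A" unfolding s_def by (rule ops_msum[OF A]) (simp add: ops_smult[OF A] Piops)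
  have sPi: "Ps i * s = ?c i \<cdot>\<^sub>m Ps i" "s * Ps i = ?c i \<cdot>\<^sub>m Ps i" if "i \<in> I" for i
    unfolding s_def using fam[OF that] by auto
  have s_eq: "msum ?n I (\<lambda>i. complex_of_real (lam i) \<cdot>\<^sub>m maxmix (?n, Ps i)) = s"
    unfolding s_def maxmix_def using Pi(1)
    by (intro mat_carrier_eqI[of _ ?n ?n]) (auto simp: smult_entry[of _ ?n ?n] intro!: sum.cong)
  have lhs: "fp A B Phi s $$ (a*?m+b, c*?m+d) = (\<Sum>i\<in>I. ?c i * Phi (?D i c a) $$ (b,d))"
    if ac: "a < ?n" "c < ?n" and bd: "b < ?m" "d < ?m" for a b c d
  proof -
    let ?S = "sliceR ?n (fpker ?n ?P s) a c"
    have S: "?S \<in> ops A" using sliceR_ops[OF A A fpker_ops[OF A s] ac] .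
    have "Ps i * ?S * Ps i = ?c i \<cdot>\<^sub>m ?D i c a" if i: "i \<in> I" for i
    proof -
      have cars: "?P \<in> carrier_mat ?n ?n" "s \<in> carrier_mat ?n ?n" "Ps i \<in> carrier_mat ?n ?n"
        using idem_carrier[OF A] ops_carrier[OF s] Pi i by auto
      have 1: "Ps i * dyad ?n X Y c a * Ps i = dyad ?n (Ps i * X) (Y * Ps i) c a"
        if "X \<in> carrier_mat ?n ?n" "Y \<in> carrier_mat ?n ?n" for X Y
        using that cars ac by (simp add: mult_dyad dyad_mult)
      have "Ps i * ?S * Ps i = (1/2) \<cdot>\<^sub>m (Ps i * dyad ?n ?P s c a * Ps i + Ps i * dyad ?n s ?P c a * Ps i)"
        using ac cars
        by (simp add: sliceR_fpker mult_smult_distrib[of _ ?n ?n _ ?n] mult_smult_assoc_mat[of _ ?n ?n _ ?n]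
            mult_add_distrib_mat[of _ ?n ?n _ ?n] add_mult_distrib_mat[of _ ?n ?n _ _ ?n])
      also have "\<dots> = ?c i \<cdot>\<^sub>m ?D i c a"
        unfolding 1[OF cars(1,2)] 1[OF cars(2,1)] sPi[OF i] PPi[OF i] using ac cars
        by (intro mat_carrier_eqI[of _ ?n ?n])
           (auto simp: smult_entry[of _ ?n ?n] add_entry[of _ ?n ?n])
      finally show ?thesis .
    qed
    then have "msum ?n I (\<lambda>i. Ps i * ?S * Ps i) = msum ?n I (\<lambda>i. ?c i \<cdot>\<^sub>m ?D i c a)"
      by (rule msum_cong)
    \<comment> \<open>The invariance of the channel allows its argument to be pinched first, which
      deletes all terms between different blocks.\<close>
    with pinch S have "Phi ?S = Phi (msum ?n I (\<lambda>i. ?c i \<cdot>\<^sub>m ?D i c a))" by metis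
    also have "\<dots> $$ (b,d) = (\<Sum>i\<in>I. ?c i * Phi (?D i c a) $$ (b,d))"
      by (rule lin_map_lincomb_entry[OF A Phi fin])
         (use dyad_ops[OF A Piops Piops] ac bd in \<open>auto simp: smult_entry[of _ ?n ?n]\<close>)
    finally show ?thesis using ac bd by (simp add: fp_entry[OF A B Phi s])
  qed
  have rhs: "fp (?n, Ps i) B (\<lambda>X. Phi (Ps i * X * Ps i)) (maxmix (?n, Ps i)) $$ (a*?m+b, c*?m+d)
      = ?t i * Phi (?D i c a) $$ (b,d)"
    if i: "i \<in> I" and ac: "a < ?n" "c < ?n" and bd: "b < ?m" "d < ?m" for i a b c d
  proof -
    let ?Ai = "(?n, Ps i)" let ?Phi = "\<lambda>X. Phi (Ps i * X * Ps i)"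
    have Ai: "idem (sdim ?Ai) (sproj ?Ai)" using Pi(3)[OF i] by simp
    \<comment> \<open>On the subsystem the sandwich does nothing, so there the conditioned map is
      just the restriction of \<open>Phi\<close>.\<close>
    have incl: "X \<in> ops A" "Ps i * X * Ps i = X" if "X \<in> ops ?Ai" for X
    proof -
      have X: "X \<in> carrier_mat ?n ?n" "Ps i * X = X" "X * Ps i = X" using that ops_iff[OF Ai] by auto
      then show "Ps i * X * Ps i = X" by simp
      have "?P * X = X" "X * ?P = X"
        using X assoc_mult_mat[OF idem_carrier[OF A] Pi(1)[OF i] X(1)]
          assoc_mult_mat[OF X(1) Pi(1)[OF i] idem_carrier[OF A]] PPi[OF i] by simp_all
      then show "X \<in> ops A" using X ops_iff[OF A] by simp
    qed
    have lin: "lin_map ?Ai B ?Phi"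
      using Phi incl by (auto simp: lin_map_def linear_on_def ops_add[OF Ai] ops_smult[OF Ai])
    have mm: "maxmix ?Ai \<in> ops ?Ai"
      using ops_smult[OF Ai sproj_ops[OF Ai]] by (simp add: maxmix_def)
    let ?S = "sliceR ?n (fpker ?n (Ps i) (maxmix ?Ai)) a c"
    have S: "?S = ?t i \<cdot>\<^sub>m ?D i c a"
      using ac Pi(1)[OF i] by (intro mat_carrier_eqI[of _ ?n ?n])
        (auto simp: sliceR_entry fpker_entry maxmix_def smult_entry[of _ ?n ?n])
    have D: "?D i c a \<in> ops A" using dyad_ops[OF A Piops Piops] ac i by auto
    have Si: "?S \<in> ops ?Ai"
      using sliceR_ops[OF Ai Ai fpker_ops[OF Ai mm]] ac by simp
    have "fp ?Ai B ?Phi (maxmix ?Ai) $$ (a*?m+b, c*?m+d) = ?Phi ?S $$ (b,d)"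
      using fp_entry[OF Ai B lin mm, of a c b d] ac bd by simp
    also have "\<dots> = Phi (?t i \<cdot>\<^sub>m ?D i c a) $$ (b,d)"
      using incl(2)[OF Si] S by simp
    also have "\<dots> = ?t i * Phi (?D i c a) $$ (b,d)"
      using Phi D lin_map_carrier[OF Phi D] bd by (simp add: lin_map_def linear_on_def smult_entry[of _ ?m ?m])
    finally show ?thesis .
  qed
  have car: "fp (?n, Ps i) B (\<lambda>X. Phi (Ps i * X * Ps i)) (maxmix (?n, Ps i)) \<in> carrier_mat (?n*?m) (?n*?m)" if "i \<in> I" for i
    using Pi(1)[OF that] idem_carrier[OF B] jam_carrier[of "(?n, Ps i)" B] by (auto simp: fp_def maxmix_def)
  show "fp A B Phi (msum ?n I (\<lambda>i. complex_of_real (lam i) \<cdot>\<^sub>m maxmix (?n, Ps i)))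
      = msum (?n*?m) I (\<lambda>i. complex_of_real (lam i) \<cdot>\<^sub>m
          fp (?n, Ps i) B (\<lambda>X. Phi (Ps i * X * Ps i)) (maxmix (?n, Ps i)))"
    unfolding s_eq
  proof (rule tensor_mat_eqI[of _ ?n ?m])
    show "fp A B Phi s \<in> carrier_mat (?n*?m) (?n*?m)" using ops_carrier[OF fp_ops[OF A B Phi s]] by simp
    fix a b c d assume "a < ?n" "b < ?m" "c < ?n" "d < ?m"
    then show "fp A B Phi s $$ (a*?m+b, c*?m+d) = msum (?n*?m) I (\<lambda>i. complex_of_real (lam i) \<cdot>\<^sub>m
          fp (?n, Ps i) B (\<lambda>X. Phi (Ps i * X * Ps i)) (maxmix (?n, Ps i))) $$ (a*?m+b, c*?m+d)"
      using car rhs lhs by (auto simp: smult_entry[of _ "?n*?m" "?n*?m"] mult.assoc intro!: sum.cong)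
  qed simp
qed

section \<open>Sesquilinear forms and positivity\<close>

text \<open>Takes functions instead of vectors, so that substitutions such as u + v carry no
  dimension conditions; values beyond \<open>n\<close> do not matter.\<close>

definition sesq :: "nat \<Rightarrow> cmat \<Rightarrow> (nat \<Rightarrow> complex) \<Rightarrow> (nat \<Rightarrow> complex) \<Rightarrow> complex" where
  "sesq n X u v = (\<Sum>i<n. \<Sum>j<n. cnj (u i) * X $$ (i,j) * v j)"

lemma sesq_add_left: "sesq n X (\<lambda>i. u i + w i) v = sesq n X u v + sesq n X w v"
  by (simp add: sesq_def distrib_right sum.distrib)

lemma sesq_add_right: "sesq n X u (\<lambda>i. v i + w i) = sesq n X u v + sesq n X u w"
  by (simp add: sesq_def distrib_left sum.distrib)

lemma sesq_scale_left: "sesq n X (\<lambda>i. c * u i) v = cnj c * sesq n X u v"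
  by (simp add: sesq_def sum_distrib_left mult_ac)

lemma sesq_scale_right: "sesq n X u (\<lambda>i. c * v i) = c * sesq n X u v"
  by (simp add: sesq_def sum_distrib_left mult_ac)

lemma sesq_unit:
  assumes "i < n" "j < n"
  shows "sesq n X (\<lambda>k. if k = i then 1 else 0) (\<lambda>k. if k = j then 1 else 0) = X $$ (i,j)"
proof -
  have "sesq n X (\<lambda>k. if k = i then 1 else 0) (\<lambda>k. if k = j then 1 else 0)
      = (\<Sum>a<n. \<Sum>b<n. if a = i then (if b = j then X $$ (a,b) else 0) else 0)"
    unfolding sesq_def by (intro sum.cong refl) auto
  also have "\<dots> = (\<Sum>a<n. if a = i then X $$ (a,j) else 0)"
    using assms by (intro sum.cong refl) (auto simp: sum.delta)
  also have "\<dots> = X $$ (i,j)" using assms by (simp add: sum.delta)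
  finally show ?thesis .
qed

text \<open>Evaluating at u + v gives the sum of the two mixed values, and evaluating at u + i v
  gives a multiple of their difference.\<close>

lemma sesq_polarize:
  assumes "\<And>v. sesq n X v v = 0"
  shows "sesq n X u v = 0"
proof -
  have 1: "sesq n X u v + sesq n X v u = 0"
    using assms[of "\<lambda>i. u i + v i"] by (simp add: sesq_add_left sesq_add_right assms)
  have "\<i> * sesq n X u v - \<i> * sesq n X v u = 0"
    using assms[of "\<lambda>i. u i + \<i> * v i"]
    by (simp add: sesq_add_left sesq_add_right sesq_scale_left sesq_scale_right assms)
  then have "\<i> * (sesq n X u v - sesq n X v u) = 0" by (simp add: right_diff_distrib)
  then have "sesq n X u v - sesq n X v u = 0" by simp
  with 1 show ?thesis by (simp add: add_eq_0_iff)
qed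

lemma sesq_zero:
  assumes "\<And>v. sesq n X v v = 0" "i < n" "j < n"
  shows "X $$ (i,j) = 0"
  using sesq_polarize[OF assms(1)] sesq_unit[OF assms(2,3), of X] by simp

text \<open>The order on complex numbers expresses realness and nonnegativity in one inequality, and
  padding with \<open>vec\<close> lets arbitrary functions stand for vectors.\<close>

lemma psd_iff: "psd n X \<longleftrightarrow> X \<in> carrier_mat n n \<and> (\<forall>v. 0 \<le> sesq n X v v)"
proof -
  have form: "(\<Sum>i<n. cnj (v $ i) * (X *\<^sub>v v) $ i) = sesq n X (\<lambda>i. v $ i) (\<lambda>i. v $ i)"
    if "X \<in> carrier_mat n n" "v \<in> carrier_vec n" for v
    using that unfolding sesq_def
    by (intro sum.cong refl) (auto simp: scalar_prod_def lessThan_atLeast0 sum_distrib_left mult.assoc)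
  have vec: "sesq n X (\<lambda>i. vec n v $ i) (\<lambda>i. vec n v $ i) = sesq n X v v" for v
    by (simp add: sesq_def)
  have *: "Im (\<Sum>i<n. cnj (v $ i) * (X *\<^sub>v v) $ i) = 0 \<and> 0 \<le> Re (\<Sum>i<n. cnj (v $ i) * (X *\<^sub>v v) $ i)
      \<longleftrightarrow> 0 \<le> sesq n X (\<lambda>i. v $ i) (\<lambda>i. v $ i)"
    if "X \<in> carrier_mat n n" "v \<in> carrier_vec n" for v
    unfolding form[OF that] less_eq_complex_def by auto
  show ?thesis
  proof (intro iffI conjI allI; (elim conjE)?)
    fix v assume psd: "psd n X"
    then have X: "X \<in> carrier_mat n n" by (simp add: psd_def)
    have "0 \<le> sesq n X (\<lambda>i. vec n v $ i) (\<lambda>i. vec n v $ i)"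
      using psd *[OF X, of "vec n v"] unfolding psd_def by (meson vec_carrier)
    then show "0 \<le> sesq n X v v" by (simp only: vec)
  next
    assume X: "X \<in> carrier_mat n n" "\<forall>v. 0 \<le> sesq n X v v"
    show "psd n X" unfolding psd_def using X(1) *[OF X(1)] X(2) by blast
  qed (simp add: psd_def)
qed

lemma psd_carrier: "psd n X \<Longrightarrow> X \<in> carrier_mat n n"
  by (simp add: psd_def)

lemma psd_diag: "psd n X \<Longrightarrow> i < n \<Longrightarrow> 0 \<le> X $$ (i,i)"
  using sesq_unit[of i n i X] by (metis psd_iff)

lemma adj_carrier [simp]: "X \<in> carrier_mat n m \<Longrightarrow> adj X \<in> carrier_mat m n"
  by (auto simp: adj_def)

lemma adj_entry: "X \<in> carrier_mat n m \<Longrightarrow> i < m \<Longrightarrow> j < n \<Longrightarrow> adj X $$ (i,j) = cnj (X $$ (j,i))"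
  by (auto simp: adj_def)

lemma adj_mult:
  assumes "X \<in> carrier_mat n n" "Y \<in> carrier_mat n n"
  shows "adj (X * Y) = adj Y * adj X"
  using assms
  by (intro mat_carrier_eqI[of _ n n])
     (auto simp: adj_entry[of _ n n] mult_entry[of _ n n _ n] mult.commute)

lemma adj_eq_entry: "adj X = X \<Longrightarrow> X \<in> carrier_mat n n \<Longrightarrow> i < n \<Longrightarrow> j < n \<Longrightarrow> cnj (X $$ (i,j)) = X $$ (j,i)"
  by (metis adj_entry)

text \<open>\<open>psd\<close> does not ask for self-adjointness. It follows because the quadratic
  form is real, so that the form of \<open>adj X - X\<close> vanishes on the diagonal and hence
  everywhere by polarization.\<close>

lemma psd_adj:
  assumes "psd n X"
  shows "adj X = X"
proof (rule mat_carrier_eqI[of _ n n])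
  have X: "X \<in> carrier_mat n n" using assms by (rule psd_carrier)
  then show "adj X \<in> carrier_mat n n" "X \<in> carrier_mat n n" by auto
  have "sesq n (adj X) v v = cnj (sesq n X v v)" for v
  proof -
    have "sesq n (adj X) v v = (\<Sum>i<n. \<Sum>j<n. cnj (cnj (v j) * X $$ (j,i) * v i))"
      unfolding sesq_def using X by (intro sum.cong refl) (simp add: adj_entry[OF X])
    also have "\<dots> = (\<Sum>j<n. \<Sum>i<n. cnj (cnj (v j) * X $$ (j,i) * v i))" by (rule sum.swap)
    finally show ?thesis by (simp add: sesq_def)
  qed
  moreover have "cnj (sesq n X v v) = sesq n X v v" for v
    using assms by (auto simp: psd_iff less_eq_complex_def complex_eq_iff)
  ultimately have "sesq n (adj X - X) v v = 0" for v
    using X by (auto simp: sesq_def adj_def algebra_simps sum_subtractf)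
  then have "(adj X - X) $$ (i,j) = 0" if "i < n" "j < n" for i j
    using sesq_zero that by blast
  then show "adj X $$ (i,j) = X $$ (i,j)" if "i < n" "j < n" for i j
    using that X by (force simp: adj_def)
qed

lemma sesq_congruence:
  assumes "K \<in> carrier_mat n n" "X \<in> carrier_mat n n"
  shows "sesq n (adj K * X * K) u v = sesq n X (\<lambda>i. \<Sum>j<n. K $$ (i,j) * u j) (\<lambda>i. \<Sum>j<n. K $$ (i,j) * v j)"
proof -
  have "sesq n (adj K * X * K) u v
      = (\<Sum>i<n. \<Sum>j<n. \<Sum>a<n. \<Sum>b<n. cnj (u i) * cnj (K $$ (a,i)) * X $$ (a,b) * K $$ (b,j) * v j)"
    unfolding sesq_def
  proof (intro sum.cong refl)
    fix i j assume "i \<in> {..<n}" "j \<in> {..<n}"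
    then have ij: "i < n" "j < n" by auto
    have "(adj K * X * K) $$ (i,j) = (\<Sum>b<n. \<Sum>a<n. cnj (K $$ (a,i)) * X $$ (a,b) * K $$ (b,j))"
      using assms ij
      by (simp add: mult_entry[of "adj K * X" n n _ n] mult_entry[of "adj K" n n _ n] adj_entry[of _ n n]
          sum_distrib_right del: assoc_mult_mat)
    also have "\<dots> = (\<Sum>a<n. \<Sum>b<n. cnj (K $$ (a,i)) * X $$ (a,b) * K $$ (b,j))" by (rule sum.swap)
    finally show "cnj (u i) * (adj K * X * K) $$ (i,j) * v j
        = (\<Sum>a<n. \<Sum>b<n. cnj (u i) * cnj (K $$ (a,i)) * X $$ (a,b) * K $$ (b,j) * v j)"
      by (simp add: sum_distrib_left sum_distrib_right mult.assoc)
  qed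
  also have "\<dots> = (\<Sum>i<n. \<Sum>a<n. \<Sum>j<n. \<Sum>b<n. cnj (u i) * cnj (K $$ (a,i)) * X $$ (a,b) * K $$ (b,j) * v j)"
    by (intro sum.cong refl sum.swap)
  also have "\<dots> = (\<Sum>a<n. \<Sum>i<n. \<Sum>j<n. \<Sum>b<n. cnj (u i) * cnj (K $$ (a,i)) * X $$ (a,b) * K $$ (b,j) * v j)"
    by (rule sum.swap)
  also have "\<dots> = (\<Sum>a<n. \<Sum>i<n. \<Sum>b<n. \<Sum>j<n. cnj (u i) * cnj (K $$ (a,i)) * X $$ (a,b) * K $$ (b,j) * v j)"
    by (intro sum.cong refl sum.swap)
  also have "\<dots> = (\<Sum>a<n. \<Sum>b<n. \<Sum>i<n. \<Sum>j<n. cnj (u i) * cnj (K $$ (a,i)) * X $$ (a,b) * K $$ (b,j) * v j)"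
    by (intro sum.cong refl sum.swap)
  also have "\<dots> = sesq n X (\<lambda>i. \<Sum>j<n. K $$ (i,j) * u j) (\<lambda>i. \<Sum>j<n. K $$ (i,j) * v j)"
    unfolding sesq_def
  proof (intro sum.cong refl)
    fix a b
    have "(\<Sum>i<n. \<Sum>j<n. cnj (u i) * cnj (K $$ (a,i)) * X $$ (a,b) * K $$ (b,j) * v j)
        = (\<Sum>i<n. \<Sum>j<n. (cnj (K $$ (a,i)) * cnj (u i)) * (X $$ (a,b) * (K $$ (b,j) * v j)))"
      by (intro sum.cong refl) (simp add: mult_ac)
    also have "\<dots> = (\<Sum>i<n. cnj (K $$ (a,i)) * cnj (u i)) * (\<Sum>j<n. X $$ (a,b) * (K $$ (b,j) * v j))"
      by (simp add: sum_product)
    finally show "(\<Sum>i<n. \<Sum>j<n. cnj (u i) * cnj (K $$ (a,i)) * X $$ (a,b) * K $$ (b,j) * v j)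
        = cnj (\<Sum>j<n. K $$ (a,j) * u j) * X $$ (a,b) * (\<Sum>j<n. K $$ (b,j) * v j)"
      by (simp add: sum_distrib_left mult.assoc)
  qed
  finally show ?thesis .
qed

lemma psd_congruence: "psd n X \<Longrightarrow> K \<in> carrier_mat n n \<Longrightarrow> psd n (adj K * X * K)"
  by (auto simp: psd_iff sesq_congruence simp del: assoc_mult_mat)

lemma sesq_msum:
  "sesq n (msum n I f) u v = (\<Sum>k\<in>I. sesq n (f k) u v)"
proof -
  have "sesq n (msum n I f) u v = (\<Sum>i<n. \<Sum>j<n. \<Sum>k\<in>I. cnj (u i) * f k $$ (i,j) * v j)"
    by (simp add: sesq_def sum_distrib_left sum_distrib_right)
  also have "\<dots> = (\<Sum>i<n. \<Sum>k\<in>I. \<Sum>j<n. cnj (u i) * f k $$ (i,j) * v j)" by (intro sum.cong refl sum.swap)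
  also have "\<dots> = (\<Sum>k\<in>I. \<Sum>i<n. \<Sum>j<n. cnj (u i) * f k $$ (i,j) * v j)" by (rule sum.swap)
  finally show ?thesis by (simp add: sesq_def)
qed

lemma psd_msum: "(\<And>i. i \<in> I \<Longrightarrow> psd n (f i)) \<Longrightarrow> psd n (msum n I f)"
  by (auto simp: psd_iff sesq_msum intro!: sum_nonneg)

section \<open>Spectral decomposition of positive operators\<close>

lemma mtrace_carrier: "X \<in> carrier_mat n m \<Longrightarrow> mtrace X = (\<Sum>i<n. X $$ (i,i))"
  by (auto simp: mtrace_def)

lemma mtrace_comm:
  assumes "X \<in> carrier_mat n n" "Y \<in> carrier_mat n n"
  shows "mtrace (X * Y) = mtrace (Y * X)"
proof -
  have "mtrace (X * Y) = (\<Sum>i<n. \<Sum>j<n. X $$ (i,j) * Y $$ (j,i))"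
    using assms by (simp add: mtrace_carrier[of _ n n] mult_entry[of _ n n _ n])
  also have "\<dots> = (\<Sum>j<n. \<Sum>i<n. X $$ (i,j) * Y $$ (j,i))" by (rule sum.swap)
  also have "\<dots> = mtrace (Y * X)"
    using assms by (simp add: mtrace_carrier[of _ n n] mult_entry[of _ n n _ n] mult.commute)
  finally show ?thesis .
qed

definition proj :: "nat \<Rightarrow> cmat \<Rightarrow> bool" where
  "proj n R \<longleftrightarrow> idem n R \<and> adj R = R"

lemma projD: "proj n R \<Longrightarrow> R \<in> carrier_mat n n" "proj n R \<Longrightarrow> R * R = R" "proj n R \<Longrightarrow> adj R = R" "proj n R \<Longrightarrow> idem n R"
  by (auto simp: proj_def idem_def)

text \<open>From R = R* R the trace is the squared Hilbert--Schmidt norm of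
  \<open>R\<close>.\<close>

lemma proj_mtrace:
  assumes "proj n R"
  shows "0 \<le> Re (mtrace R)" and "Re (mtrace R) \<le> 0 \<Longrightarrow> R = 0\<^sub>m n n"
proof -
  have R: "R \<in> carrier_mat n n" "R * R = R" "adj R = R" using assms by (auto dest: projD)
  have "R $$ (i,i) = (\<Sum>j<n. cnj (R $$ (j,i)) * R $$ (j,i))" if i: "i < n" for i
    using mult_entry[OF R(1,1) i i] adj_eq_entry[OF R(3,1)] that R(2) by simp
  then have "mtrace R = (\<Sum>i<n. \<Sum>j<n. cnj (R $$ (j,i)) * R $$ (j,i))"
    using R(1) by (simp add: mtrace_carrier[of _ n n])
  then have tr: "Re (mtrace R) = (\<Sum>i<n. \<Sum>j<n. (cmod (R $$ (j,i)))\<^sup>2)"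
    by (simp add: cmod_power2 power2_eq_square[of "Re _"] power2_eq_square[of "Im _"])
  show "0 \<le> Re (mtrace R)" unfolding tr by (intro sum_nonneg) auto
  assume "Re (mtrace R) \<le> 0"
  then have "(\<Sum>i<n. \<Sum>j<n. (cmod (R $$ (j,i)))\<^sup>2) = 0"
    unfolding tr by (intro antisym sum_nonneg) auto
  then have "R $$ (j,i) = 0" if "i < n" "j < n" for i j
    using that by (auto simp: sum_nonneg_eq_0_iff sum_nonneg)
  then show "R = 0\<^sub>m n n" using R(1) by (intro mat_carrier_eqI[of _ n n]) auto
qed

text \<open>Schur triangularization: the trace is invariant under similarity, and the diagonal of
  the triangular factor lists the eigenvalues.\<close>

lemma mtrace_sum_eigenvalues:
  assumes A: "A \<in> carrier_mat n n"
  obtains es where "char_poly A = (\<Prod>a\<leftarrow>es. [:- a, 1:])" "length es = n" "mtrace A = sum_list es"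
proof -
  obtain es where es: "char_poly A = (\<Prod>a\<leftarrow>es. [:- a, 1:])" "length es = n"
    using char_poly_factorized[OF A] by blast
  obtain B P Q where "schur_decomposition A es = (B,P,Q)" by (metis prod_cases3)
  from schur_decomposition[OF A es(1) this]
  have w: "similar_mat_wit A B P Q" and diag: "diag_mat B = es" by auto
  note w = similar_mat_witD2[OF A w]
  have "mtrace A = mtrace (P * (B * Q))" using w by simp
  also have "\<dots> = mtrace (B * Q * P)" by (rule mtrace_comm[of _ n]) (use w in auto)
  also have "\<dots> = mtrace B" using w by simp
  also have "\<dots> = sum_list es"
    using w(5) unfolding diag[symmetric] diag_mat_def
    by (simp add: mtrace_carrier[of _ n n] interv_sum_list_conv_sum_set_nat lessThan_atLeast0)
  finally show ?thesis using that es by blast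
qed

definition outer :: "nat \<Rightarrow> (nat \<Rightarrow> complex) \<Rightarrow> cmat" where
  "outer n u = mat n n (\<lambda>(a,c). u a * cnj (u c))"

definition unit_vec_fun :: "nat \<Rightarrow> (nat \<Rightarrow> complex) \<Rightarrow> bool" where
  "unit_vec_fun n u \<longleftrightarrow> (\<Sum>a<n. cnj (u a) * u a) = 1"

lemma outer_carrier [simp]: "outer n u \<in> carrier_mat n n"
  by (simp add: outer_def)

lemma outer_entry [simp]: "a < n \<Longrightarrow> c < n \<Longrightarrow> outer n u $$ (a,c) = u a * cnj (u c)"
  by (simp add: outer_def)

lemma outer_proj:
  assumes "unit_vec_fun n u"
  shows "proj n (outer n u)" and "mtrace (outer n u) = 1"
proof -
  have "outer n u * outer n u = outer n u"
  proof (rule mat_carrier_eqI[of _ n n])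
    fix i j assume ij: "i < n" "j < n"
    have "(outer n u * outer n u) $$ (i,j) = u i * cnj (u j) * (\<Sum>a<n. cnj (u a) * u a)"
      using ij by (simp add: mult_entry[of _ n n _ n] sum_distrib_left mult_ac)
    then show "(outer n u * outer n u) $$ (i,j) = outer n u $$ (i,j)"
      using assms ij by (simp add: unit_vec_fun_def)
  qed auto
  moreover have "adj (outer n u) = outer n u"
    by (intro mat_carrier_eqI[of _ n n]) (auto simp: adj_entry[of _ n n])
  ultimately show "proj n (outer n u)" by (simp add: proj_def idem_def)
  show "mtrace (outer n u) = 1"
    using assms by (simp add: mtrace_carrier[of _ n n] unit_vec_fun_def mult.commute)
qed

lemma outer_psd: "psd n (outer n u)"
proof -
  have "sesq n (outer n u) v v = cnj (\<Sum>i<n. cnj (u i) * v i) * (\<Sum>i<n. cnj (u i) * v i)" for v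
    by (simp add: sesq_def sum_product mult_ac)
  moreover have "0 \<le> cnj z * z" for z :: complex by (simp add: less_eq_complex_def)
  ultimately show ?thesis by (simp only: psd_iff outer_carrier simp_thms)
qed

lemma mult_outer:
  assumes "A \<in> carrier_mat n n" "\<And>i. i < n \<Longrightarrow> (\<Sum>j<n. A $$ (i,j) * u j) = e * u i"
  shows "A * outer n u = e \<cdot>\<^sub>m outer n u"
proof (rule mat_carrier_eqI[of _ n n])
  fix i j assume ij: "i < n" "j < n"
  have "(A * outer n u) $$ (i,j) = (\<Sum>l<n. A $$ (i,l) * u l) * cnj (u j)"
    using assms(1) ij by (simp add: mult_entry[of _ n n _ n] sum_distrib_right mult.assoc)
  then show "(A * outer n u) $$ (i,j) = (e \<cdot>\<^sub>m outer n u) $$ (i,j)"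
    using assms(2) ij by (simp add: smult_entry[of _ n n])
qed (use assms in auto)

text \<open>On the range of \<open>R\<close> and on its complement, \<open>X - (1 - R)\<close> acts as \<open>X\<close> and as \<open>-1\<close>.
  By the trace, not every eigenvalue of it can be \<open>-1\<close>.\<close>
lemma exists_eigenvector:
  assumes R: "proj n R" "R \<noteq> 0\<^sub>m n n" and X: "psd n X" "R * X = X" "X * R = X"
  obtains u lam where "unit_vec_fun n u" "0 \<le> lam" "R * outer n u = outer n u"
    "X * outer n u = complex_of_real lam \<cdot>\<^sub>m outer n u"
proof -
  have Rc: "R \<in> carrier_mat n n" "R * R = R" and Xc: "X \<in> carrier_mat n n"
    using R X by (auto dest: projD psd_carrier)
  define H where "H = X - (1\<^sub>m n - R)"
  have H: "H \<in> carrier_mat n n" using Rc Xc by (simp add: H_def minus_carrier_mat)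
  obtain es where es: "char_poly H = (\<Prod>a\<leftarrow>es. [:- a, 1:])" "length es = n" "mtrace H = sum_list es"
    using mtrace_sum_eigenvalues[OF H] by blast
  have trH: "mtrace H = mtrace X - of_nat n + mtrace R"
    using H Rc Xc by (simp add: mtrace_carrier[of _ n n] H_def sum_subtractf sum.distrib algebra_simps)
  have "\<not> (\<forall>e\<in>set es. e = -1)"
  proof
    assume "\<forall>e\<in>set es. e = -1"
    then have "sum_list es = - of_nat (length es)" by (induction es) auto
    then have "mtrace X + mtrace R = 0" using trH es by (simp add: algebra_simps)
    moreover have "0 \<le> Re (mtrace X)"
      using psd_diag[OF X(1)] Xc
      by (auto simp: mtrace_carrier[of _ n n] Re_sum less_eq_complex_def intro!: sum_nonneg)
    moreover have "0 < Re (mtrace R)" using proj_mtrace[OF R(1)] R(2) by fastforce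
    ultimately show False by (simp add: complex_eq_iff)
  qed
  then obtain e where e: "e \<in> set es" "e \<noteq> -1" by blast
  then have "poly (char_poly H) e = 0"
    unfolding es(1) by (auto simp: poly_prod_list prod_list_zero_iff image_iff)
  then have "eigenvalue H e" using eigenvalue_root_char_poly[OF H] by simp
  then obtain v where v: "v \<in> carrier_vec n" "v \<noteq> 0\<^sub>v n" "H *\<^sub>v v = e \<cdot>\<^sub>v v"
    using H by (auto simp: eigenvalue_def eigenvector_def)
  define w where "w = (\<lambda>i. v $ i)"
  have mv: "(A *\<^sub>v v) $ i = (\<Sum>j<n. A $$ (i,j) * w j)" if "A \<in> carrier_mat n n" "i < n" for A i
    using that v(1) by (auto simp: scalar_prod_def lessThan_atLeast0 w_def)
  \<comment> \<open>\<open>R\<close> kills the complement term of \<open>H\<close> and fixes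
    \<open>X\<close>. Applied to the eigenvector this gives X v = e R v.\<close>
  have "R * H = R * X - (R * 1\<^sub>m n - R * R)"
    using Rc Xc by (simp add: H_def mult_minus_distrib_mat[of _ n n _ n] minus_carrier_mat)
  also have "\<dots> = X"
    using Rc Xc X by (intro mat_carrier_eqI[of _ n n]) auto
  finally have "X *\<^sub>v v = R *\<^sub>v (H *\<^sub>v v)" using assoc_mult_mat_vec[OF Rc(1) H v(1)] by simp
  also have "\<dots> = e \<cdot>\<^sub>v (R *\<^sub>v v)" using v Rc(1) by (simp add: mult_mat_vec[of _ n n])
  finally have Xv: "X *\<^sub>v v = e \<cdot>\<^sub>v (R *\<^sub>v v)" .
  have Xw: "(\<Sum>j<n. X $$ (i,j) * w j) = e * (\<Sum>j<n. R $$ (i,j) * w j)" if "i < n" for i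
    using arg_cong[OF Xv, of "\<lambda>x. x $ i"] that Rc(1) by (simp add: mv[OF Xc] mv[OF Rc(1)] del: index_mult_mat_vec)
  \<comment> \<open>Compare H w = X w - w + R w = e w with X w = e R w. The choice of an eigenvalue
    other than -1 is what places \<open>w\<close> in the range of \<open>R\<close>.\<close>
  have Rw: "(\<Sum>j<n. R $$ (i,j) * w j) = w i" if i: "i < n" for i
  proof -
    have "(\<Sum>j<n. H $$ (i,j) * w j) = (\<Sum>j<n. X $$ (i,j) * w j) - w i + (\<Sum>j<n. R $$ (i,j) * w j)"
    proof -
      have "(\<Sum>j<n. H $$ (i,j) * w j)
          = (\<Sum>j<n. X $$ (i,j) * w j - (if i = j then 1 else 0) * w j + R $$ (i,j) * w j)"
        using i Rc Xc by (intro sum.cong refl) (simp add: H_def algebra_simps)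
      then show ?thesis using i by (simp add: sum.distrib sum_subtractf sum_delta_mult)
    qed
    moreover have "(\<Sum>j<n. H $$ (i,j) * w j) = e * w i"
      using arg_cong[OF v(3), of "\<lambda>x. x $ i"] i v(1) by (simp add: mv[OF H] w_def del: index_mult_mat_vec)
    ultimately have "(e + 1) * ((\<Sum>j<n. R $$ (i,j) * w j) - w i) = 0"
      using Xw[OF i] by (simp add: algebra_simps)
    moreover have "e + 1 \<noteq> 0" using e(2) by (simp add: eq_neg_iff_add_eq_0)
    ultimately show ?thesis by simp
  qed
  define S where "S = (\<Sum>i<n. (cmod (w i))\<^sup>2)"
  have S: "S > 0"
  proof -
    obtain i where "i < n" "w i \<noteq> 0" using v(1,2) by (metis eq_vecI carrier_vecD index_zero_vec w_def)
    then show ?thesis unfolding S_def by (intro sum_pos2[of _ i]) auto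
  qed
  define u where "u = (\<lambda>i. complex_of_real (1 / sqrt S) * w i)"
  have "(\<Sum>a<n. cnj (u a) * u a) = (\<Sum>a<n. complex_of_real (1 / S) * complex_of_real ((cmod (w a))\<^sup>2))"
  proof (intro sum.cong refl)
    fix a
    have "(1 / sqrt S)\<^sup>2 = 1 / S" using S by (simp add: power_divide)
    moreover have "cnj (u a) * u a = complex_of_real ((1 / sqrt S)\<^sup>2) * (w a * cnj (w a))"
      unfolding u_def power2_eq_square of_real_mult complex_cnj_mult complex_cnj_complex_of_real
      by (simp only: mult_ac)
    ultimately show "cnj (u a) * u a = complex_of_real (1 / S) * complex_of_real ((cmod (w a))\<^sup>2)"
      by (simp only: complex_norm_square)
  qed
  also have "\<dots> = complex_of_real (1 / S * S)"
    unfolding S_def of_real_mult of_real_sum by (simp add: sum_distrib_left)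
  finally have u: "unit_vec_fun n u" using S by (simp add: unit_vec_fun_def)
  have Ru: "(\<Sum>j<n. R $$ (i,j) * u j) = 1 * u i" and Xu: "(\<Sum>j<n. X $$ (i,j) * u j) = e * u i" if "i < n" for i
    using Rw[OF that] Xw[OF that]
    by (simp_all add: u_def mult.left_commute[of _ "complex_of_real _"] sum_distrib_left[symmetric] del: of_real_divide)
  \<comment> \<open>For the unit vector \<open>u\<close> this value equals \<open>e\<close>, so
    positivity of \<open>X\<close> makes the eigenvalue real and nonnegative.\<close>
  have "sesq n X u u = (\<Sum>i<n. cnj (u i) * (\<Sum>j<n. X $$ (i,j) * u j))"
    by (simp add: sesq_def sum_distrib_left mult.assoc)
  also have "\<dots> = (\<Sum>i<n. e * (cnj (u i) * u i))" by (intro sum.cong refl) (simp add: Xu)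
  also have "\<dots> = e * (\<Sum>i<n. cnj (u i) * u i)" by (simp only: sum_distrib_left)
  finally have "0 \<le> e" using X(1) u by (simp add: psd_iff unit_vec_fun_def) (metis)
  then have "e = complex_of_real (Re e)" "0 \<le> Re e" by (auto simp: less_eq_complex_def complex_eq_iff)
  then show ?thesis
    using that[OF u, of "Re e"] mult_outer[OF Rc(1) Ru] mult_outer[OF Xc Xu] by (simp add: one_smult[of _ n])
qed

text \<open>The adjoint of the eigenvector equation; the scalar survives conjugation because it is
  real.\<close>

lemma outer_mult_selfadjoint:
  assumes "X \<in> carrier_mat n n" "adj X = X" "X * outer n u = complex_of_real lam \<cdot>\<^sub>m outer n u"
  shows "outer n u * X = complex_of_real lam \<cdot>\<^sub>m outer n u"
proof -
  have adj_outer: "adj (outer n u) = outer n u"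
    by (intro mat_carrier_eqI[of _ n n]) (auto simp: adj_entry[of _ n n])
  have "outer n u * X = adj (X * outer n u)"
    unfolding adj_mult[OF assms(1) outer_carrier] adj_outer assms(2) ..
  also have "\<dots> = complex_of_real lam \<cdot>\<^sub>m outer n u"
    unfolding assms(3)
    by (intro mat_carrier_eqI[of _ n n]) (auto simp: adj_entry[of _ n n] smult_entry[of _ n n])
  finally show ?thesis .
qed

text \<open>Eigenvectors are split off one at a time; the trace of the projector counts those left.\<close>
lemma spectral_decomposition:
  assumes "proj n R" "psd n X" "R * X = X" "X * R = X"
  obtains m :: nat and u lam where
    "\<And>i. i < m \<Longrightarrow> unit_vec_fun n (u i)" "\<And>i. i < m \<Longrightarrow> 0 \<le> lam i"
    "\<And>i j. i < m \<Longrightarrow> j < m \<Longrightarrow> i \<noteq> j \<Longrightarrow> outer n (u i) * outer n (u j) = 0\<^sub>m n n"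
    "msum n {..<m} (\<lambda>i. outer n (u i)) = R"
    "msum n {..<m} (\<lambda>i. complex_of_real (lam i) \<cdot>\<^sub>m outer n (u i)) = X"
proof -
  \<comment> \<open>The induction runs over a natural upper bound of the trace, so integrality of
    the trace of a projector never has to be shown.\<close>
  have ex: "\<exists>(m::nat) u lam. (\<forall>i<m. unit_vec_fun n (u i)) \<and> (\<forall>i<m. 0 \<le> lam i)
      \<and> (\<forall>i<m. \<forall>j<m. i \<noteq> j \<longrightarrow> outer n (u i) * outer n (u j) = 0\<^sub>m n n)
      \<and> msum n {..<m} (\<lambda>i. outer n (u i)) = R
      \<and> msum n {..<m} (\<lambda>i. complex_of_real (lam i) \<cdot>\<^sub>m outer n (u i)) = X"
    if "Re (mtrace R) \<le> real N" for N
    using assms that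
  proof (induction N arbitrary: R X)
    case 0
    have "R = 0\<^sub>m n n" using proj_mtrace(2)[OF 0(1)] 0(5) by simp
    moreover have "X = 0\<^sub>m n n" using calculation 0(2,3) psd_carrier by fastforce
    ultimately show ?case
      by (intro exI[of _ "0::nat"]) auto
  next
    case (Suc N)
    show ?case
    proof (cases "R = 0\<^sub>m n n")
      case True
      moreover have "X = 0\<^sub>m n n" using True Suc(3,4) psd_carrier by fastforce
      ultimately show ?thesis
        by (intro exI[of _ "0::nat"]) auto
    next
      case False
      note Rp = projD[OF Suc.prems(1)] and Xc = psd_carrier[OF Suc.prems(2)]
      obtain u0 l0 where u0: "unit_vec_fun n u0" "0 \<le> l0" "R * outer n u0 = outer n u0"
        "X * outer n u0 = complex_of_real l0 \<cdot>\<^sub>m outer n u0"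
        using exists_eigenvector[OF Suc.prems(1) False Suc.prems(2-4)] by blast
      define U where "U = outer n u0"
      note Up = projD[OF outer_proj(1)[OF u0(1), folded U_def]]
      have RU: "R * U = U" and UR: "U * R = U"
        using outer_mult_selfadjoint[OF Rp(1,3), of u0 1] u0(3) by (simp_all add: U_def one_smult[of _ n])
      have XU: "X * U = complex_of_real l0 \<cdot>\<^sub>m U" and UX: "U * X = complex_of_real l0 \<cdot>\<^sub>m U"
        using outer_mult_selfadjoint[OF Xc psd_adj[OF Suc.prems(2)] u0(4)] u0(4) by (simp_all add: U_def)
      define R' where "R' = R - U"
      define X' where "X' = X - complex_of_real l0 \<cdot>\<^sub>m U"
      have R'c: "R' \<in> carrier_mat n n" and X'c: "X' \<in> carrier_mat n n"
        using Rp(1) Up(1) Xc by (auto simp: R'_def X'_def)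
      have UR': "U * R' = 0\<^sub>m n n" "R' * U = 0\<^sub>m n n"
        using Rp(1) Up(1) by (simp_all add: R'_def mult_minus_distrib_mat[of _ n n _ n] minus_mult_distrib_mat[of _ n n _ _ n] UR RU Up(2))
      have RR': "R * R' = R'"
        using Rp(1) Up(1) by (simp add: R'_def mult_minus_distrib_mat[of _ n n _ n] RU Rp(2))
      have "R' - 0\<^sub>m n n = R'" using R'c by (intro mat_carrier_eqI[of _ n n]) auto
      then have R'R': "R' * R' = R'"
        using minus_mult_distrib_mat[OF Rp(1) Up(1) R'c] RR' UR' R'c by (simp add: R'_def[symmetric])
      have "adj R' = R'"
        using Rp Up R'c
        by (intro mat_carrier_eqI[of _ n n]) (auto simp: adj_entry[of _ n n] R'_def adj_eq_entry)
      then have projR': "proj n R'" using R'c R'R' by (simp add: proj_def idem_def)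
      have R'X: "R' * X = X'" and XR': "X * R' = X'"
        using Rp(1) Up(1) Xc Suc.prems(3,4) by (simp_all add: R'_def X'_def mult_minus_distrib_mat[of _ n n _ n] minus_mult_distrib_mat[of _ n n _ _ n] UX XU)
      have R'X': "R' * X' = X'" using assoc_mult_mat[OF R'c R'c Xc] R'R' R'X by simp
      have X'R': "X' * R' = X'" using assoc_mult_mat[OF Xc R'c R'c] R'R' XR' by simp
      \<comment> \<open>Writing the remainder as a compression of \<open>X\<close> gives its
        positivity, which is not visible from the difference that defines it.\<close>
      have "adj R' * X * R' = X'" using projD(3)[OF projR'] R'X X'R' by simp
      then have psdX': "psd n X'" using psd_congruence[OF Suc.prems(2) R'c] by simp
      have "mtrace R' = mtrace R - mtrace U"
        using Rp(1) Up(1) R'c by (simp add: mtrace_carrier[of _ n n] R'_def sum_subtractf)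
      then have "Re (mtrace R') \<le> real N" using outer_proj(2)[OF u0(1)] Suc.prems(5) by (simp add: U_def)
      from Suc.IH[OF projR' psdX' R'X' X'R' this]
      obtain m :: nat and u lam where IH: "\<forall>i<m. unit_vec_fun n (u i)" "\<forall>i<m. 0 \<le> lam i"
        "\<forall>i<m. \<forall>j<m. i \<noteq> j \<longrightarrow> outer n (u i) * outer n (u j) = 0\<^sub>m n n"
        "msum n {..<m} (\<lambda>i. outer n (u i)) = R'"
        "msum n {..<m} (\<lambda>i. complex_of_real (lam i) \<cdot>\<^sub>m outer n (u i)) = X'"
        by blast
      \<comment> \<open>The remaining eigenprojections are absorbed by \<open>R'\<close>, which
        annihilates \<open>U\<close>; so they are orthogonal to the vector split off here.\<close>
      have Ui: "U * outer n (u i) = 0\<^sub>m n n" "outer n (u i) * U = 0\<^sub>m n n" if i: "i < m" for i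
      proof -
        have fam: "outer n (u i) * R' = outer n (u i)" "R' * outer n (u i) = outer n (u i)"
          using mult_orthogonal_family[of "{..<m}" i "\<lambda>i. outer n (u i)" n "\<lambda>_. 1"] IH(1,3,4) i
            outer_proj(1)[of n "u i", THEN projD(2)] by (simp_all add: one_smult[of _ n])
        show "U * outer n (u i) = 0\<^sub>m n n"
          using assoc_mult_mat[OF Up(1) R'c outer_carrier[of n "u i"]] fam UR' left_mult_zero_mat[OF outer_carrier[of n "u i"]] by simp
        show "outer n (u i) * U = 0\<^sub>m n n"
          using assoc_mult_mat[OF outer_carrier[of n "u i"] R'c Up(1)] fam UR' right_mult_zero_mat[OF outer_carrier[of n "u i"]] by simp
      qed
      define u' where "u' = u(m := u0)"
      define lam' where "lam' = lam(m := l0)"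
      have "msum n {..<Suc m} (\<lambda>i. outer n (u' i)) = R"
      proof (rule mat_carrier_eqI[of _ n n])
        fix i j assume ij: "i < n" "j < n"
        then have "(\<Sum>k<m. u k i * cnj (u k j)) = R $$ (i,j) - U $$ (i,j)"
          using arg_cong[OF IH(4), of "\<lambda>M. M $$ (i,j)"] Rp(1) Up(1) by (simp add: R'_def)
        then show "msum n {..<Suc m} (\<lambda>i. outer n (u' i)) $$ (i,j) = R $$ (i,j)"
          using ij by (simp add: u'_def U_def)
      qed (use Rp in auto)
      moreover have "msum n {..<Suc m} (\<lambda>i. complex_of_real (lam' i) \<cdot>\<^sub>m outer n (u' i)) = X"
      proof (rule mat_carrier_eqI[of _ n n])
        fix i j assume ij: "i < n" "j < n"
        then have "(\<Sum>k<m. complex_of_real (lam k) * (u k i * cnj (u k j))) = X $$ (i,j) - complex_of_real l0 * U $$ (i,j)"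
          using arg_cong[OF IH(5), of "\<lambda>M. M $$ (i,j)"] Xc Up(1) by (simp add: X'_def smult_entry[of _ n n])
        then show "msum n {..<Suc m} (\<lambda>i. complex_of_real (lam' i) \<cdot>\<^sub>m outer n (u' i)) $$ (i,j) = X $$ (i,j)"
          using ij by (simp add: u'_def lam'_def U_def smult_entry[of _ n n])
      qed (use Xc in auto)
      moreover have "\<forall>i<Suc m. unit_vec_fun n (u' i)" "\<forall>i<Suc m. 0 \<le> lam' i"
        using IH(1,2) u0 by (auto simp: u'_def lam'_def less_Suc_eq)
      moreover have "\<forall>i<Suc m. \<forall>j<Suc m. i \<noteq> j \<longrightarrow> outer n (u' i) * outer n (u' j) = 0\<^sub>m n n"
        using IH(3) Ui by (auto simp: u'_def less_Suc_eq U_def)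
      ultimately show ?thesis by blast
    qed
  qed
  obtain N :: nat where "Re (mtrace R) \<le> real N" using real_arch_simple by blast
  from ex[OF this] obtain m :: nat and u lam where
    "\<forall>i<m. unit_vec_fun n (u i)" "\<forall>i<m. 0 \<le> lam i"
    "\<forall>i<m. \<forall>j<m. i \<noteq> j \<longrightarrow> outer n (u i) * outer n (u j) = 0\<^sub>m n n"
    "msum n {..<m} (\<lambda>i. outer n (u i)) = R"
    "msum n {..<m} (\<lambda>i. complex_of_real (lam i) \<cdot>\<^sub>m outer n (u i)) = X"
    by blast
  then show ?thesis using that[of m u lam] by simp
qed

section \<open>Completeness and convex combinations\<close>

text \<open>The event \<open>S\<close> of a measurement in the standard basis, as an operation into
  the one-dimensional system. Singletons select one outcome, and the full index set gives the
  trace.\<close>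

definition diag_effect :: "nat set \<Rightarrow> cmat \<Rightarrow> cmat" where
  "diag_effect S X = mat 1 1 (\<lambda>_. \<Sum>k\<in>S. X $$ (k,k))"

lemma map_right_diag_effect_entry:
  assumes "S \<subseteq> {..<m}" "i < n" "j < n"
  shows "map_right n m (Suc 0) (diag_effect S) M $$ (i,j) = (\<Sum>s\<in>S. M $$ (i*m+s, j*m+s))"
proof -
  have "map_right n m (Suc 0) (diag_effect S) M $$ (i,j) = (\<Sum>s\<in>S. sliceR m M i j $$ (s,s))"
    using assms(2,3) by (simp add: map_right_def diag_effect_def sliceR_def)
  also have "\<dots> = (\<Sum>s\<in>S. M $$ (i*m+s, j*m+s))"
    using assms(1) by (intro sum.cong refl) (auto simp: sliceR_entry)
  finally show ?thesis .
qed

lemma diag_effect_cptni: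
  assumes S: "S \<subseteq> {..<m}"
  shows "is_cptni (full_sys m) triv_sys (diag_effect S)"
  unfolding is_cptni_def
proof (intro conjI ballI impI)
  show "linear_on (full_sys m) (diag_effect S)"
    unfolding linear_on_def
  proof (intro conjI ballI allI)
    fix X Y assume "X \<in> ops (full_sys m)" "Y \<in> ops (full_sys m)"
    then have "X \<in> carrier_mat m m" "Y \<in> carrier_mat m m" by (auto simp: ops_full)
    then have "(\<Sum>k\<in>S. (X + Y) $$ (k,k)) = (\<Sum>k\<in>S. X $$ (k,k)) + (\<Sum>k\<in>S. Y $$ (k,k))"
      using S unfolding sum.distrib[symmetric] by (intro sum.cong refl) (auto simp: add_entry[of _ m m])
    then show "diag_effect S (X + Y) = diag_effect S X + diag_effect S Y"
      by (intro mat_carrier_eqI[of _ 1 1]) (auto simp: diag_effect_def add_entry[of _ 1 1])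
  next
    fix X c assume "X \<in> ops (full_sys m)"
    then have "X \<in> carrier_mat m m" by (auto simp: ops_full)
    then have "(\<Sum>k\<in>S. (c \<cdot>\<^sub>m X) $$ (k,k)) = c * (\<Sum>k\<in>S. X $$ (k,k))"
      using S unfolding sum_distrib_left by (intro sum.cong refl) (auto simp: smult_entry[of _ m m])
    then show "diag_effect S (c \<cdot>\<^sub>m X) = c \<cdot>\<^sub>m diag_effect S X"
      by (intro mat_carrier_eqI[of _ 1 1]) (auto simp: diag_effect_def smult_entry[of _ 1 1])
  qed
  show "completely_positive (full_sys m) triv_sys (diag_effect S)"
    unfolding completely_positive_def
  proof (intro allI impI; elim conjE)
    fix k M assume "psd (k * sdim (full_sys m)) M"
    then have M: "psd (k*m) M" by simp
    let ?N = "map_right k m 1 (diag_effect S) M"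
    \<comment> \<open>The vector v \<otimes> e_s. The form of the image at \<open>v\<close> is the
      sum of the forms of \<open>M\<close> at these vectors over \<open>s\<close> in
      \<open>S\<close>.\<close>
    define w where "w = (\<lambda>v s (i::nat). if i mod m = s then v (i div m) else (0::complex))"
    have w: "w v s (a*m+b) = (if b = s then v a else 0)" if "b < m" for v s a b
      using that by (simp add: w_def)
    have "sesq k ?N v v = (\<Sum>s\<in>S. sesq (k*m) M (w v s) (w v s))" for v
    proof -
      have "sesq (k*m) M (w v s) (w v s) = (\<Sum>a<k. \<Sum>c<k. cnj (v a) * M $$ (a*m+s, c*m+s) * v c)" if "s \<in> S" for s
      proof -
        have s: "s < m" using that S by auto
        have "sesq (k*m) M (w v s) (w v s)
            = (\<Sum>a<k. \<Sum>b<m. \<Sum>c<k. \<Sum>d<m. if d = s then (if b = s then cnj (v a) * M $$ (a*m+b, c*m+d) * v c else 0) else 0)"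
          unfolding sesq_def sum_tensor by (intro sum.cong refl) (auto simp: w)
        also have "\<dots> = (\<Sum>a<k. \<Sum>b<m. \<Sum>c<k. if b = s then cnj (v a) * M $$ (a*m+b, c*m+s) * v c else 0)"
          using s by (intro sum.cong refl) (simp add: sum.delta)
        also have "\<dots> = (\<Sum>a<k. \<Sum>b<m. if b = s then (\<Sum>c<k. cnj (v a) * M $$ (a*m+b, c*m+s) * v c) else 0)"
          by (intro sum.cong refl) auto
        also have "\<dots> = (\<Sum>a<k. \<Sum>c<k. cnj (v a) * M $$ (a*m+s, c*m+s) * v c)"
          using s by simp
        finally show ?thesis .
      qed
      moreover have "sesq k ?N v v = (\<Sum>s\<in>S. \<Sum>a<k. \<Sum>c<k. cnj (v a) * M $$ (a*m+s, c*m+s) * v c)"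
      proof -
        have "sesq k ?N v v = (\<Sum>a<k. \<Sum>c<k. \<Sum>s\<in>S. cnj (v a) * M $$ (a*m+s, c*m+s) * v c)"
          unfolding sesq_def
          by (intro sum.cong refl) (simp add: map_right_diag_effect_entry[OF S] sum_distrib_left sum_distrib_right)
        also have "\<dots> = (\<Sum>a<k. \<Sum>s\<in>S. \<Sum>c<k. cnj (v a) * M $$ (a*m+s, c*m+s) * v c)"
          by (intro sum.cong refl sum.swap)
        also have "\<dots> = (\<Sum>s\<in>S. \<Sum>a<k. \<Sum>c<k. cnj (v a) * M $$ (a*m+s, c*m+s) * v c)"
          by (rule sum.swap)
        finally show ?thesis .
      qed
      ultimately show ?thesis by simp
    qed
    then have "psd k ?N"
      using M map_right_carrier[of k m 1] by (auto simp: psd_iff intro!: sum_nonneg)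
    then show "psd (k * sdim triv_sys) (map_right k (sdim (full_sys m)) (sdim triv_sys) (diag_effect S) M)"
      by simp
  qed
next
  fix X assume "X \<in> ops (full_sys m)" and X: "psd (sdim (full_sys m)) X"
  then have "(\<Sum>k\<in>S. Re (X $$ (k,k))) \<le> (\<Sum>k<m. Re (X $$ (k,k)))"
    using S psd_diag[of m X] by (intro sum_mono2) (auto simp: less_eq_complex_def)
  then show "Re (mtrace (diag_effect S X)) \<le> Re (mtrace X)"
    using psd_carrier[OF X] by (simp add: mtrace_carrier[of X m m] mtrace_def diag_effect_def Re_sum)
qed (simp add: ops_triv diag_effect_def)

lemma psd_half_sum:
  assumes "psd n X" "psd n Y"
  shows "psd n ((1/2) \<cdot>\<^sub>m (X + Y))"
proof -
  have car: "X \<in> carrier_mat n n" "Y \<in> carrier_mat n n" using assms by (auto intro: psd_carrier)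
  have "sesq n ((1/2) \<cdot>\<^sub>m (X + Y)) v v = (1/2) * (sesq n X v v + sesq n Y v v)" for v
    using car
    by (simp add: sesq_def smult_entry[of _ n n] add_entry[of _ n n] distrib_left distrib_right
        sum.distrib sum_divide_distrib add_divide_distrib)
  moreover have "0 \<le> (1/2) * z" if "0 \<le> z" for z :: complex using that by (simp add: less_eq_complex_def)
  ultimately show ?thesis using assms car by (simp only: psd_iff) auto
qed

lemma state_half_sum:
  assumes A: "idem (sdim A) (sproj A)" and "is_state A rho" "is_state A sigma"
  shows "is_state A ((1/2) \<cdot>\<^sub>m (rho + sigma))"
proof -
  have car: "rho \<in> carrier_mat (sdim A) (sdim A)" "sigma \<in> carrier_mat (sdim A) (sdim A)"
    using assms by (auto simp: is_state_def ops_carrier)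
  have "mtrace ((1/2) \<cdot>\<^sub>m (rho + sigma)) = (1/2) * (mtrace rho + mtrace sigma)"
    using car by (simp add: mtrace_carrier[of _ "sdim A" "sdim A"] sum.distrib sum_divide_distrib add_divide_distrib
        smult_entry[of _ "sdim A" "sdim A"] add_entry[of _ "sdim A" "sdim A"])
  then show ?thesis
    using assms by (simp add: is_state_def ops_smult ops_add psd_half_sum)
qed

lemma is_system_full:
  assumes "1 \<le> n"
  shows "is_system (full_sys n)"
proof -
  have "(1\<^sub>m n :: cmat) $$ (0,0) \<noteq> 0\<^sub>m n n $$ (0,0)" using assms by simp
  then have "(1\<^sub>m n :: cmat) \<noteq> 0\<^sub>m n n" by metis
  moreover have "adj (1\<^sub>m n) = 1\<^sub>m n"
    by (intro mat_carrier_eqI[of _ n n]) (auto simp: adj_entry[of _ n n])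
  ultimately show ?thesis using assms by (simp add: is_system_def)
qed

lemma sum_lessThan_2: "(\<Sum>b<2. f b) = f 0 + f (1::nat)"
  by (simp add: numeral_2_eq_2)

text \<open>Completeness, applied to a classical flag recording which of the two states was prepared.\<close>
lemma sotf_midpoint:
  assumes star: "is_sotf star" and ext: "valid_ext star ext"
    and A: "is_system A" and B: "is_system B" and Phi: "is_channel A B Phi"
    and rho: "is_state A rho" and sigma: "is_state A sigma"
  shows "star A B Phi ((1/2) \<cdot>\<^sub>m (rho + sigma)) = (1/2) \<cdot>\<^sub>m (star A B Phi rho + star A B Phi sigma)"
proof -
  let ?n = "sdim A" and ?m = "sdim B"
  define tau where "tau = (1/2) \<cdot>\<^sub>m (rho + sigma)"
  define st where "st = (\<lambda>s::nat. if s = 0 then rho else sigma)"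
  \<comment> \<open>The state (\<rho> \<otimes> |0\<rangle>\<langle>0| + \<sigma> \<otimes>
    |1\<rangle>\<langle>1|)/2, with the flag as spectator.\<close>
  define om where "om = mat (?n*2) (?n*2) (\<lambda>(i,j). if i mod 2 = j mod 2 then (1/2) * st (i mod 2) $$ (i div 2, j div 2) else 0)"
  note idA = idem_sproj[OF A]
  have st: "is_state A (st s)" for s using rho sigma by (simp add: st_def)
  have stc: "st s \<in> carrier_mat ?n ?n" for s using st by (simp add: is_state_def ops_carrier)
  have tau: "is_state A tau" unfolding tau_def by (rule state_half_sum[OF idA rho sigma])
  have omc: "om \<in> carrier_mat (?n*2) (?n*2)" by (simp add: om_def)
  have om: "om $$ (a*2+b, c*2+d) = (if b = d then (1/2) * st b $$ (a,c) else 0)"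
    if "a < ?n" "c < ?n" "b < 2" "d < 2" for a b c d
    using that tensor_less[of a ?n b 2] tensor_less[of c ?n d 2] unfolding om_def by simp
  have om4: "om $$ (a*2, c*2) = (1/2) * st 0 $$ (a,c)" "om $$ (a*2, Suc (c*2)) = 0"
    "om $$ (Suc (a*2), c*2) = 0" "om $$ (Suc (a*2), Suc (c*2)) = (1/2) * st (Suc 0) $$ (a,c)"
    if "a < ?n" "c < ?n" for a c
    using om[OF that, of 0 0] om[OF that, of 0 1] om[OF that, of 1 0] om[OF that, of 1 1] by simp_all
  have sys2: "is_system (full_sys 2)" by (rule is_system_full) simp
  have "is_state (stensor A (full_sys 2)) om"
    unfolding is_state_def
  proof (intro conjI)
    have "sliceL ?n 2 om b d \<in> ops A" if bd: "b < 2" "d < 2" for b d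
    proof -
      have "sliceL ?n 2 om b d = (if b = d then 1/2 else 0) \<cdot>\<^sub>m st b"
        using bd stc by (intro mat_carrier_eqI[of _ ?n ?n]) (auto simp: sliceL_entry om smult_entry[of _ ?n ?n])
      then show ?thesis using ops_smult[OF idA] st[of b] by (simp add: is_state_def)
    qed
    then show "om \<in> ops (stensor A (full_sys 2))"
      using omc ops_tensor_slices[OF idA, of "full_sys 2"] by (simp add: idem_one ops_full)
    have "sesq (?n*2) om v v = (1/2) * (sesq ?n (st 0) (\<lambda>a. v (a*2+0)) (\<lambda>a. v (a*2+0)) + sesq ?n (st 1) (\<lambda>a. v (a*2+1)) (\<lambda>a. v (a*2+1)))" for v
    proof -
      have "sesq (?n*2) om v v = (\<Sum>a<?n. \<Sum>c<?n. (1/2) * (cnj (v (a*2+0)) * st 0 $$ (a,c) * v (c*2+0))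
          + (1/2) * (cnj (v (a*2+1)) * st 1 $$ (a,c) * v (c*2+1)))"
        unfolding sesq_def sum_tensor sum_lessThan_2 sum.distrib[symmetric]
        by (intro sum.cong refl) (simp add: om4)
      then show ?thesis by (simp only: sum.distrib sum_distrib_left[symmetric] sesq_def distrib_left)
    qed
    moreover have "0 \<le> (1/2) * (z + w)" if "0 \<le> z" "0 \<le> w" for z w :: complex
      using that by (simp add: less_eq_complex_def)
    ultimately show "psd (sdim (stensor A (full_sys 2))) om"
      using omc st by (auto simp only: psd_iff is_state_def sdim_stensor sdim_full)
    have "mtrace om = (\<Sum>a<?n. (1/2) * st 0 $$ (a,a) + (1/2) * st 1 $$ (a,a))"
      unfolding mtrace_carrier[OF omc] sum_tensor sum_lessThan_2
      by (intro sum.cong refl) (simp add: om4)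
    also have "\<dots> = (1/2) * mtrace (st 0) + (1/2) * mtrace (st 1)"
      unfolding mtrace_carrier[OF stc] by (simp only: sum.distrib sum_distrib_left)
    finally show "mtrace om = 1" using st by (simp add: is_state_def)
  qed
  then have q: "qsost star A (full_sys 2) om" by (simp add: qsost_def)
  define Z where "Z = ext A B (full_sys 2) Phi om"
  have triv: "is_system triv_sys" using is_system_full[of 1] by (simp add: triv_sys_def full_sys_def)
  \<comment> \<open>Selecting a flag value leaves half of one state, and discarding the flag leaves
    the midpoint. As the effect of {0,1} is the sum of those of {0} and {1}, the same additivity
    holds for the extended operator \<open>Z\<close>.\<close>
  have eff: "map_right (?n*?m) 2 1 (diag_effect S) Z = ext A B triv_sys Phi (map_right ?n 2 1 (diag_effect S) om)"
    if "S \<subseteq> {..<2}" for S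
  proof -
    have "map_right (?n*?m) (sdim (full_sys 2)) (sdim triv_sys) (diag_effect S) Z
        = ext A B triv_sys Phi (map_right ?n (sdim (full_sys 2)) (sdim triv_sys) (diag_effect S) om)"
      using ext A B sys2 Phi q triv diag_effect_cptni[OF that] unfolding valid_ext_def Z_def by blast
    then show ?thesis by simp
  qed
  have homog: "ext A B triv_sys Phi (c \<cdot>\<^sub>m r) = c \<cdot>\<^sub>m star A B Phi r" if "is_state A r" for c r
    using ext A B Phi that unfolding valid_ext_def by blast
  have single: "map_right ?n 2 1 (diag_effect {s}) om = (1/2) \<cdot>\<^sub>m st s" if "s < 2" for s
    using that stc map_right_carrier[of ?n 2 1] om
    by (intro mat_carrier_eqI[of _ ?n ?n])
       (auto simp: map_right_diag_effect_entry[of _ 2] smult_entry[of _ ?n ?n])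
  have both: "map_right ?n 2 1 (diag_effect {0,1}) om = 1 \<cdot>\<^sub>m tau"
    using rho sigma map_right_carrier[of ?n 2 1] stc[of 0] stc[of 1]
    by (intro mat_carrier_eqI[of _ ?n ?n])
       (auto simp: map_right_diag_effect_entry[of _ 2] tau_def om4 st_def smult_entry[of _ ?n ?n] add_entry[of _ ?n ?n] distrib_left add_divide_distrib)
  have car: "star A B Phi r \<in> carrier_mat (?n*?m) (?n*?m)" if "is_state A r" for r
    by (rule sotfD(4)[OF star A B Phi that])
  have e1: "(1/2) \<cdot>\<^sub>m star A B Phi (st s) = map_right (?n*?m) 2 1 (diag_effect {s}) Z" if "s < 2" for s
    using eff[of "{s}"] homog[OF st, of "1/2" s] single[OF that] that by simp
  have e2: "1 \<cdot>\<^sub>m star A B Phi tau = map_right (?n*?m) 2 1 (diag_effect {0,1}) Z"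
    using eff[of "{0,1}"] homog[OF tau, of 1] both by simp
  have "star A B Phi tau = (1/2) \<cdot>\<^sub>m (star A B Phi (st 0) + star A B Phi (st 1))"
  proof (rule mat_carrier_eqI[of _ "?n*?m" "?n*?m"])
    fix i j assume ij: "i < ?n*?m" "j < ?n*?m"
    have "star A B Phi tau $$ (i,j) = Z $$ (i*2+0, j*2+0) + Z $$ (i*2+1, j*2+1)"
      using arg_cong[OF e2, of "\<lambda>X. X $$ (i,j)"] ij car[OF tau]
      by (simp add: map_right_diag_effect_entry[of _ 2] smult_entry[of _ "?n*?m" "?n*?m"])
    moreover have "(1/2) * star A B Phi (st s) $$ (i,j) = Z $$ (i*2+s, j*2+s)" if "s < 2" for s
      using arg_cong[OF e1[OF that], of "\<lambda>X. X $$ (i,j)"] ij car[OF st] that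
      by (simp add: map_right_diag_effect_entry[of _ 2] smult_entry[of _ "?n*?m" "?n*?m"])
    from this[of 0] this[of 1] 
    have "(1/2) * star A B Phi (st 0) $$ (i,j) = Z $$ (i*2+0, j*2+0)" "(1/2) * star A B Phi (st 1) $$ (i,j) = Z $$ (i*2+1, j*2+1)"
      by auto
    ultimately show "star A B Phi tau $$ (i,j) = ((1/2) \<cdot>\<^sub>m (star A B Phi (st 0) + star A B Phi (st 1))) $$ (i,j)"
      using ij car[OF st] by (simp only: smult_entry[of _ "?n*?m" "?n*?m"] add_entry[of _ "?n*?m" "?n*?m"] add_carrier_mat distrib_left)
  qed (use car[OF tau] car[OF st] in auto)
  then show ?thesis by (simp add: tau_def st_def)
qed

section \<open>Consequences of compositionality and classical conditionability\<close>

text \<open>Covers the identity channel and also maps that are written differently but fix each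
  operator of the subsystem, such as compression followed by pinching.\<close>

lemma inclusion_channel:
  assumes S: "idem (sdim S) (sproj S)" and dim: "sdim S = sdim T"
    and f: "\<And>X. X \<in> ops S \<Longrightarrow> f X = X" and ops: "\<And>X. X \<in> ops S \<Longrightarrow> X \<in> ops T"
  shows "is_channel S T f"
  unfolding is_channel_def
proof (intro conjI ballI)
  show "linear_on S f" using f ops_add[OF S] ops_smult[OF S] by (simp add: linear_on_def)
  show "completely_positive S T f"
    unfolding completely_positive_def
  proof (intro allI impI; elim conjE)
    fix k M assume M: "M \<in> ops (stensor (full_sys k) S)" "psd (k * sdim S) M"
    have "f (sliceR (sdim S) M a c) = sliceR (sdim S) M a c" if "a < k" "c < k" for a c
      using f[OF sliceR_ops[of "full_sys k" S M a c]] M S that by (simp add: idem_one)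
    then have "map_right k (sdim S) (sdim T) f M = M"
      using psd_carrier[OF M(2)] unfolding dim[symmetric]
      by (intro tensor_mat_eqI[of _ k "sdim S"]) (auto simp: map_right_entry sliceR_entry)
    then show "psd (k * sdim T) (map_right k (sdim S) (sdim T) f M)" using M(2) dim by simp
  qed
qed (use f ops in auto)

lemma axiom_P_factor:
  assumes star: "is_sotf star" and P: "axiom_P star"
    and A: "is_system A" and B: "is_system B" and Phi: "is_channel A B Phi" and rho: "is_state A rho"
  shows "star A B Phi rho = map_right (sdim A) (sdim A) (sdim B) Phi (star A A (\<lambda>X. X) rho)"
proof -
  have id: "is_channel A A (\<lambda>X. X)" by (rule inclusion_channel) (use idem_sproj[OF A] in auto)
  obtain ext where ext: "valid_ext star ext"
    and eq: "swap_conj B A (ptrace_left (sdim A) (sdim B * sdim A) (ext A B A Phi (swap_conj A A (star A A (\<lambda>X. X) rho))))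
        = star A B (Phi \<circ> (\<lambda>X. X)) rho"
    using P A B Phi rho id unfolding axiom_P_def by blast
  show ?thesis
    using eq valid_ext_compose[OF star ext A A B id Phi rho] by (simp add: comp_def)
qed

lemma mtrace_msum: "mtrace (msum n I f) = (\<Sum>i\<in>I. mtrace (f i))" if "\<And>i. i \<in> I \<Longrightarrow> f i \<in> carrier_mat n n"
proof -
  have "mtrace (msum n I f) = (\<Sum>a<n. \<Sum>i\<in>I. f i $$ (a,a))" by (simp add: mtrace_carrier[of _ n n])
  also have "\<dots> = (\<Sum>i\<in>I. \<Sum>a<n. f i $$ (a,a))" by (rule sum.swap)
  finally show ?thesis using that by (simp add: mtrace_carrier[of _ n n])
qed

lemma mtrace_smult: "X \<in> carrier_mat n n \<Longrightarrow> mtrace (c \<cdot>\<^sub>m X) = c * mtrace X"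
  by (simp add: mtrace_carrier[of _ n n] sum_distrib_left smult_entry[of _ n n])

lemma sliceR_msum: "a < k \<Longrightarrow> c < k \<Longrightarrow> sliceR n (msum (k*n) I f) a c = msum n I (\<lambda>i. sliceR n (f i) a c)"
  by (intro mat_carrier_eqI[of _ n n]) (auto simp: sliceR_entry)

lemma ops_sandwich:
  assumes S: "idem (sdim S) (sproj S)" and A: "A \<in> ops S" and B: "B \<in> ops S"
    and X: "X \<in> carrier_mat (sdim S) (sdim S)"
  shows "A * X * B \<in> ops S"
proof -
  let ?n = "sdim S" and ?P = "sproj S"
  have P: "?P \<in> carrier_mat ?n ?n" using S by (rule idem_carrier)
  have A': "A \<in> carrier_mat ?n ?n" "?P * A = A" and B': "B \<in> carrier_mat ?n ?n" "B * ?P = B"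
    using A B S by (auto simp: ops_iff)
  have "?P * (A * (X * B)) = A * (X * B)" using assoc_mult_mat[OF P A'(1), of "X * B" ?n] A' B' X by simp
  moreover have "A * X * B * ?P = A * X * B"
    using assoc_mult_mat[OF square_mult_carrier[OF A'(1) X] B'(1) P] B' by simp
  ultimately show ?thesis using A' B' X S by (simp add: ops_iff)
qed

text \<open>The projections serve as Kraus operators: after adding an ancilla the map is a sum of
  congruences by 1 \<otimes> P_i. The trace is kept by cyclicity and because the projections sum to
  \<open>sproj A\<close>.\<close>

lemma pinching_channel:
  assumes A: "idem (sdim A) (sproj A)"
    and Ps: "\<And>i. i \<in> I \<Longrightarrow> proj (sdim A) (Ps i)"
    and sum: "msum (sdim A) I Ps = sproj A" and PPs: "\<And>i. i \<in> I \<Longrightarrow> Ps i \<in> ops A"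
  shows "is_channel A A (\<lambda>X. msum (sdim A) I (\<lambda>i. Ps i * X * Ps i))"
  unfolding is_channel_def
proof (intro conjI ballI)
  let ?n = "sdim A"
  have Pc: "Ps i \<in> carrier_mat ?n ?n" "Ps i * Ps i = Ps i" "adj (Ps i) = Ps i" if "i \<in> I" for i
    using projD[OF Ps[OF that]] by auto
  show "linear_on A (\<lambda>X. msum ?n I (\<lambda>i. Ps i * X * Ps i))"
    unfolding linear_on_def
  proof (intro conjI ballI allI)
    fix X Y assume "X \<in> ops A" "Y \<in> ops A"
    then have XY: "X \<in> carrier_mat ?n ?n" "Y \<in> carrier_mat ?n ?n" by (auto dest: ops_carrier)
    have "Ps i * (X + Y) * Ps i = Ps i * X * Ps i + Ps i * Y * Ps i" if "i \<in> I" for i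
      using Pc[OF that] XY
      by (simp add: mult_add_distrib_mat[of _ ?n ?n _ ?n] add_mult_distrib_mat[of _ ?n ?n _ _ ?n] del: assoc_mult_mat)
    then have "msum ?n I (\<lambda>i. Ps i * (X + Y) * Ps i) = msum ?n I (\<lambda>i. Ps i * X * Ps i + Ps i * Y * Ps i)"
      by (rule msum_cong)
    also have "\<dots> = msum ?n I (\<lambda>i. Ps i * X * Ps i) + msum ?n I (\<lambda>i. Ps i * Y * Ps i)"
      using Pc XY by (intro mat_carrier_eqI[of _ ?n ?n])
        (simp_all add: add_entry[of _ ?n ?n] sum.distrib del: assoc_mult_mat)
    finally show "msum ?n I (\<lambda>i. Ps i * (X + Y) * Ps i) = msum ?n I (\<lambda>i. Ps i * X * Ps i) + msum ?n I (\<lambda>i. Ps i * Y * Ps i)" .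
  next
    fix X c assume "X \<in> ops A"
    then have X: "X \<in> carrier_mat ?n ?n" by (auto dest: ops_carrier)
    have "Ps i * (c \<cdot>\<^sub>m X) * Ps i = c \<cdot>\<^sub>m (Ps i * X * Ps i)" if "i \<in> I" for i
      using Pc[OF that] X
      by (simp add: mult_smult_distrib[of _ ?n ?n _ ?n] mult_smult_assoc_mat[of _ ?n ?n _ ?n] del: assoc_mult_mat)
    then have "msum ?n I (\<lambda>i. Ps i * (c \<cdot>\<^sub>m X) * Ps i) = msum ?n I (\<lambda>i. c \<cdot>\<^sub>m (Ps i * X * Ps i))"
      by (rule msum_cong)
    also have "\<dots> = c \<cdot>\<^sub>m msum ?n I (\<lambda>i. Ps i * X * Ps i)"
      using Pc X by (intro mat_carrier_eqI[of _ ?n ?n])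
        (simp_all add: smult_entry[of _ ?n ?n] sum_distrib_left del: assoc_mult_mat)
    finally show "msum ?n I (\<lambda>i. Ps i * (c \<cdot>\<^sub>m X) * Ps i) = c \<cdot>\<^sub>m msum ?n I (\<lambda>i. Ps i * X * Ps i)" .
  qed
  show "completely_positive A A (\<lambda>X. msum ?n I (\<lambda>i. Ps i * X * Ps i))"
    unfolding completely_positive_def
  proof (intro allI impI; elim conjE)
    fix k M assume M: "psd (k * ?n) M"
    note Mc = psd_carrier[OF M]
    let ?K = "\<lambda>i. kron (1\<^sub>m k) (Ps i)"
    have K: "?K i \<in> carrier_mat (k*?n) (k*?n)" "adj (?K i) = ?K i" if "i \<in> I" for i
    proof -
      show "?K i \<in> carrier_mat (k*?n) (k*?n)" using Pc[OF that] by auto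
      then show "adj (?K i) = ?K i"
        using Pc[OF that] by (intro tensor_mat_eqI[of _ k ?n])
          (auto simp: adj_entry[of _ "k*?n" "k*?n"] kron_entry[of _ k k _ ?n ?n] adj_eq_entry)
    qed
    have "map_right k ?n ?n (\<lambda>X. msum ?n I (\<lambda>i. Ps i * X * Ps i)) M = msum (k*?n) I (\<lambda>i. ?K i * M * ?K i)"
    proof (rule sliceR_eqI[of _ k ?n])
      fix a c assume ac: "a < k" "c < k"
      have "sliceR ?n (?K i * M * ?K i) a c = Ps i * sliceR ?n M a c * Ps i" if i: "i \<in> I" for i
        using sliceR_kron_one(2)[OF Pc(1)[OF i] square_mult_carrier[OF K(1)[OF i] Mc] ac]
          sliceR_kron_one(1)[OF Pc(1)[OF i] Mc ac] by simp
      then show "sliceR ?n (map_right k ?n ?n (\<lambda>X. msum ?n I (\<lambda>i. Ps i * X * Ps i)) M) a c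
          = sliceR ?n (msum (k*?n) I (\<lambda>i. ?K i * M * ?K i)) a c"
        using ac by (simp add: sliceR_map_right sliceR_msum del: assoc_mult_mat cong: msum_cong)
    qed auto
    moreover have "psd (k*?n) (?K i * M * ?K i)" if "i \<in> I" for i
      using psd_congruence[OF M K(1)[OF that]] K(2)[OF that] by simp
    ultimately show "psd (k*?n) (map_right k ?n ?n (\<lambda>X. msum ?n I (\<lambda>i. Ps i * X * Ps i)) M)"
      by (simp add: psd_msum)
  qed
  fix X assume X: "X \<in> ops A"
  then have Xc: "X \<in> carrier_mat ?n ?n" by (rule ops_carrier)
  have "Ps i * X * Ps i \<in> ops A" if "i \<in> I" for i
    by (rule ops_sandwich[OF A PPs[OF that] PPs[OF that] Xc])
  then show "msum ?n I (\<lambda>i. Ps i * X * Ps i) \<in> ops A" by (rule ops_msum[OF A])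
  have "mtrace (Ps i * X * Ps i) = mtrace (X * Ps i)" if "i \<in> I" for i
    using mtrace_comm[of "Ps i" ?n "X * Ps i"] Pc[OF that] Xc by simp
  then have "mtrace (msum ?n I (\<lambda>i. Ps i * X * Ps i)) = (\<Sum>i\<in>I. mtrace (X * Ps i))"
    using Pc Xc by (subst mtrace_msum) (auto simp del: assoc_mult_mat)
  also have "\<dots> = mtrace (msum ?n I (\<lambda>i. X * Ps i))" using Pc Xc by (subst mtrace_msum) auto
  also have "msum ?n I (\<lambda>i. X * Ps i) = X * sproj A" unfolding sum[symmetric] using Pc Xc by (subst mult_msum) auto
  also have "\<dots> = X" using X ops_iff[OF A] by blast
  finally show "mtrace (msum ?n I (\<lambda>i. Ps i * X * Ps i)) = mtrace X" .
qed

text \<open>A one-dimensional system carries only multiples of its projector, and the trace reads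
  off the multiple. Hence a state over time with such an input is fixed by its output
  marginal.\<close>

lemma ops_outer:
  assumes u: "unit_vec_fun n u" and X: "X \<in> ops (n, outer n u)"
  shows "X = mtrace X \<cdot>\<^sub>m outer n u"
proof -
  let ?P = "outer n u"
  have Xc: "X \<in> carrier_mat n n" and eq: "?P * X * ?P = X" using X by (auto simp: ops_def)
  have ent: "X $$ (a,c) = sesq n X u u * ?P $$ (a,c)" if ac: "a < n" "c < n" for a c
  proof -
    have "(?P * X * ?P) $$ (a,c) = (\<Sum>j<n. (\<Sum>i<n. u a * cnj (u i) * X $$ (i,j)) * (u j * cnj (u c)))"
      using ac Xc
      by (simp add: mult_entry[of "?P * X" n n _ n] mult_entry[of ?P n n _ n] del: assoc_mult_mat)
    also have "\<dots> = (\<Sum>j<n. \<Sum>i<n. u a * cnj (u c) * (cnj (u i) * X $$ (i,j) * u j))"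
      by (intro sum.cong refl) (simp add: sum_distrib_left sum_distrib_right mult_ac)
    also have "\<dots> = (\<Sum>i<n. \<Sum>j<n. u a * cnj (u c) * (cnj (u i) * X $$ (i,j) * u j))" by (rule sum.swap)
    finally show ?thesis using eq ac by (simp add: sesq_def sum_distrib_left mult_ac)
  qed
  have "mtrace X = sesq n X u u * mtrace ?P"
    using ent Xc by (simp add: mtrace_carrier[of _ n n] sum_distrib_left)
  then have "mtrace X = sesq n X u u" using outer_proj(2)[OF u] by simp
  then show ?thesis using ent Xc by (intro mat_carrier_eqI[of _ n n]) (auto simp: smult_entry[of _ n n])
qed

lemma mult_eigen_decomposition:
  assumes "\<And>i. i \<in> I \<Longrightarrow> Ps i \<in> carrier_mat n n" "Y \<in> carrier_mat n n"
  shows "Y * msum n I (\<lambda>i. c i \<cdot>\<^sub>m Ps i) = msum n I (\<lambda>i. c i \<cdot>\<^sub>m (Y * Ps i))"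
  using assms by (subst mult_msum) (auto simp: mult_smult_distrib[of _ n n _ n] intro!: msum_cong)

text \<open>Pinching in an eigenbasis of \<open>rho\<close> does not change the trace against \<open>rho\<close>, and classical
  conditionability determines the pinched state over time.\<close>
lemma sotf_square:
  assumes star: "is_sotf star" and P: "axiom_P star" and CC: "axiom_CC star"
    and A: "is_system A" and rho: "is_state A rho" and ac: "a < sdim A" "c < sdim A"
  shows "mtrace (sliceR (sdim A) (star A A (\<lambda>X. X) rho) a c * rho) = (rho * rho) $$ (a,c)"
proof -
  let ?n = "sdim A" and ?R = "sproj A"
  note idA = idem_sproj[OF A]
  have rhoc: "rho \<in> carrier_mat ?n ?n" "?R * rho = rho" "rho * ?R = rho" "psd ?n rho" "mtrace rho = 1"
    using rho ops_iff[OF idA] by (auto simp: is_state_def)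
  \<comment> \<open>Decomposing relative to \<open>sproj A\<close> also supplies eigenvectors for
    the kernel of \<open>rho\<close> inside \<open>A\<close>, so that the projections sum to
    \<open>sproj A\<close> as (CC) requires.\<close>
  have "proj ?n ?R" using A idA by (simp add: proj_def is_system_def)
  from spectral_decomposition[OF this rhoc(4,2,3)]
  obtain m :: nat and u lam where
    u: "\<And>i. i < m \<Longrightarrow> unit_vec_fun ?n (u i)" and lam: "\<And>i. i < m \<Longrightarrow> 0 \<le> lam i"
    and orth: "\<And>i j. i < m \<Longrightarrow> j < m \<Longrightarrow> i \<noteq> j \<Longrightarrow> outer ?n (u i) * outer ?n (u j) = 0\<^sub>m ?n ?n"
    and sumR: "msum ?n {..<m} (\<lambda>i. outer ?n (u i)) = ?R"
    and sumrho: "msum ?n {..<m} (\<lambda>i. complex_of_real (lam i) \<cdot>\<^sub>m outer ?n (u i)) = rho"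
    by blast
  define Ps where "Ps = (\<lambda>i. outer ?n (u i))"
  define I where "I = {..<m}"
  let ?D = "\<lambda>X. msum ?n I (\<lambda>i. Ps i * X * Ps i)"
  let ?l = "\<lambda>i. complex_of_real (lam i)"
  have Pp: "proj ?n (Ps i)" and Ptr: "mtrace (Ps i) = 1" if "i \<in> I" for i
    using outer_proj[OF u] that by (auto simp: Ps_def I_def)
  have Pc: "Ps i \<in> carrier_mat ?n ?n" for i by (simp add: Ps_def)
  have Pi: "Ps i * Ps i = Ps i" "idem ?n (Ps i)" "adj (Ps i) = Ps i" if "i \<in> I" for i
    using projD[OF Pp[OF that]] by auto
  have Porth: "Ps i * Ps j = 0\<^sub>m ?n ?n" if "i \<in> I" "j \<in> I" "i \<noteq> j" for i j
    using orth that by (simp add: Ps_def I_def)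
  have sumR: "msum ?n I Ps = ?R" and sumrho: "msum ?n I (\<lambda>i. ?l i \<cdot>\<^sub>m Ps i) = rho"
    using sumR sumrho by (simp_all add: Ps_def I_def)
  have fam: "Ps i * msum ?n I (\<lambda>j. c j \<cdot>\<^sub>m Ps j) = c i \<cdot>\<^sub>m Ps i" "msum ?n I (\<lambda>j. c j \<cdot>\<^sub>m Ps j) * Ps i = c i \<cdot>\<^sub>m Ps i"
    if "i \<in> I" for i c
    using mult_orthogonal_family[of I i Ps ?n c] Pc Pi Porth that by (auto simp: I_def)
  have Prho: "Ps i * rho = ?l i \<cdot>\<^sub>m Ps i" "rho * Ps i = ?l i \<cdot>\<^sub>m Ps i" if "i \<in> I" for i
    using fam[OF that, of ?l] sumrho by auto
  have "?R = msum ?n I (\<lambda>j. 1 \<cdot>\<^sub>m Ps j)"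
    unfolding sumR[symmetric] by (rule msum_cong) (simp add: one_smult[OF Pc])
  then have PR: "?R * Ps i = Ps i" "Ps i * ?R = Ps i" if "i \<in> I" for i
    using fam[OF that, of "\<lambda>_. 1"] by (simp_all add: one_smult[OF Pc])
  have Pops: "Ps i \<in> ops A" if "i \<in> I" for i using PR[OF that] Pc by (simp add: ops_iff[OF idA])
  \<comment> \<open>For blocks of trace one the maximally mixed states are the projections
    themselves, and the weights in (CC) become the eigenvalues of \<open>rho\<close>.\<close>
  have mm: "maxmix (?n, Ps i) = Ps i" if "i \<in> I" for i
    using Ptr[OF that] by (simp add: maxmix_def one_smult[OF Pc])
  have sysP: "is_system (?n, Ps i)" if "i \<in> I" for i
  proof -
    have "Ps i \<noteq> 0\<^sub>m ?n ?n" using Ptr[OF that] by (auto simp: mtrace_def)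
    then show ?thesis using A Pc Pi[OF that] by (simp add: is_system_def)
  qed
  have D: "is_channel A A ?D" by (rule pinching_channel[OF idA Pp sumR Pops])
  \<comment> \<open>Pinching fixes operators supported on one block, so the channels that (CC)
    attaches to the blocks are inclusions.\<close>
  have DP: "?D (Ps i * X * Ps i) = X" and PXP: "Ps i * X * Ps i = X" and XA: "X \<in> ops A"
    if i: "i \<in> I" and X: "X \<in> ops (?n, Ps i)" for i X
  proof -
    have Xc: "X \<in> carrier_mat ?n ?n" and e: "Ps i * X = X" "X * Ps i = X"
      using X ops_iff[of "(?n, Ps i)"] Pi(2)[OF i] by auto
    show PXP: "Ps i * X * Ps i = X" using e by simp
    have "Ps j * X * Ps j = (if j = i then X else 0\<^sub>m ?n ?n)" if j: "j \<in> I" for j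
    proof (cases "j = i")
      case False
      have "Ps j * X = Ps j * Ps i * X" using assoc_mult_mat[OF Pc Pc Xc, of j i] e by simp
      also have "\<dots> = 0\<^sub>m ?n ?n" using Porth[OF j i False] left_mult_zero_mat[OF Xc] by simp
      finally show ?thesis using False left_mult_zero_mat[OF Pc[of j]] by simp
    qed (use PXP in simp)
    then have "?D X = msum ?n I (\<lambda>j. if j = i then X else 0\<^sub>m ?n ?n)" by (rule msum_cong)
    also have "\<dots> = X"
      using i Xc by (intro mat_carrier_eqI[of _ ?n ?n]) (auto simp: I_def if_distrib if_distribR sum.delta cong: if_cong)
    finally show "?D (Ps i * X * Ps i) = X" using PXP by simp
    have "?R * X = X" "X * ?R = X"
      using assoc_mult_mat[OF idem_carrier[OF idA] Pc[of i] Xc] assoc_mult_mat[OF Xc Pc[of i] idem_carrier[OF idA]] e PR[OF i] by simp_all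
    then show "X \<in> ops A" using Xc by (simp add: ops_iff[OF idA])
  qed
  have incl: "is_channel (?n, Ps i) A (\<lambda>X. ?D (Ps i * X * Ps i))" if "i \<in> I" for i
    by (rule inclusion_channel) (use Pi(2)[OF that] DP[OF that] XA[OF that] in auto)
  have stP: "is_state (?n, Ps i) (Ps i)" if "i \<in> I" for i
    using Ptr[OF that] sproj_ops[of "(?n, Ps i)"] Pi(2)[OF that] outer_psd[of ?n "u i"] by (simp add: is_state_def Ps_def)
  \<comment> \<open>The state over time of a block is P_i \<otimes> P_i: each left slice is a
    multiple of P_i by \<open>ops_outer\<close>, and the multiple is an entry of the
    marginal.\<close>
  have N: "star (?n, Ps i) A (\<lambda>X. ?D (Ps i * X * Ps i)) (Ps i) $$ (a*?n+b, c*?n+d) = Ps i $$ (a,c) * Ps i $$ (b,d)"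
    if i: "i \<in> I" and lt: "a < ?n" "b < ?n" "c < ?n" "d < ?n" for i a b c d
  proof -
    let ?N = "star (?n, Ps i) A (\<lambda>X. ?D (Ps i * X * Ps i)) (Ps i)"
    note sD = sotfD[OF star sysP[OF i] A incl[OF i] stP[OF i]]
    have sl: "sliceL ?n ?n ?N b d \<in> ops (?n, Ps i)"
      using sliceL_ops[of "(?n, Ps i)" A ?N b d] sD(1) Pi(2)[OF i] idA lt by simp
    have "mtrace (sliceL ?n ?n ?N b d) = ptrace_left ?n ?n ?N $$ (b,d)"
      using lt by (simp add: mtrace_carrier[of _ ?n ?n] sliceL_entry ptrace_left_def)
    also have "\<dots> = Ps i $$ (b,d)"
      using sD(2) DP[OF i, of "Ps i"] stP[OF i] by (simp add: is_state_def)
    finally have tr: "mtrace (sliceL ?n ?n ?N b d) = Ps i $$ (b,d)" .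
    have "unit_vec_fun ?n (u i)" using u i by (simp add: I_def)
    from ops_outer[OF this, of "sliceL ?n ?n ?N b d"] sl
    have "sliceL ?n ?n ?N b d = mtrace (sliceL ?n ?n ?N b d) \<cdot>\<^sub>m Ps i" unfolding Ps_def .
    from arg_cong[OF this, of "\<lambda>X. X $$ (a,c)"] show ?thesis
      unfolding tr using lt Pc[of i] by (simp add: sliceL_entry smult_entry[of _ ?n ?n] mult.commute)
  qed
  let ?M = "star A A (\<lambda>X. X) rho" let ?Y = "sliceR ?n ?M a c"
  have lsum: "(\<Sum>i\<in>I. lam i) = 1"
  proof -
    have "mtrace rho = (\<Sum>i\<in>I. ?l i * mtrace (Ps i))"
      unfolding sumrho[symmetric] using Pc by (subst mtrace_msum) (auto simp: mtrace_smult[OF Pc])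
    also have "\<dots> = complex_of_real (\<Sum>i\<in>I. lam i)" using Ptr by simp
    finally show ?thesis using rhoc(5) by (metis of_real_eq_1_iff)
  qed
  have "star A A ?D (msum ?n I (\<lambda>i. ?l i \<cdot>\<^sub>m maxmix (?n, Ps i)))
      = msum (?n*?n) I (\<lambda>i. ?l i \<cdot>\<^sub>m star (?n, Ps i) A (\<lambda>X. ?D (Ps i * X * Ps i)) (maxmix (?n, Ps i)))"
  proof -
    \<comment> \<open>Idempotence of pinching is the invariance premise of (CC) for the pinching
      channel itself.\<close>
    have DD: "?D (?D X) = ?D X" if "X \<in> ops A" for X
    proof (rule msum_cong)
      fix i assume i: "i \<in> I"
      have Xc: "X \<in> carrier_mat ?n ?n" using ops_carrier[OF that] .
      have "Ps i * ?D X = msum ?n I (\<lambda>j. Ps i * (Ps j * X * Ps j))"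
        using Pc Xc by (subst mult_msum) (auto simp del: assoc_mult_mat)
      also have "\<dots> = msum ?n I (\<lambda>j. if j = i then Ps i * X * Ps i else 0\<^sub>m ?n ?n)"
      proof (rule msum_cong)
        fix j assume j: "j \<in> I"
        have "Ps i * (Ps j * X * Ps j) = Ps i * Ps j * (X * Ps j)"
          using assoc_mult_mat[OF Pc[of i] Pc[of j] square_mult_carrier[OF Xc Pc[of j]]] Pc[of j] Xc by simp
        then show "Ps i * (Ps j * X * Ps j) = (if j = i then Ps i * X * Ps i else 0\<^sub>m ?n ?n)"
          using Porth[OF i j] Pi[OF i] Pc[of j] Pc[of i] Xc left_mult_zero_mat[of "X * Ps j" ?n ?n] by auto
      qed
      also have "\<dots> = Ps i * X * Ps i"
        using i Xc Pc[of i] by (intro mat_carrier_eqI[of _ ?n ?n]) (auto simp: I_def if_distrib if_distribR sum.delta cong: if_cong simp del: assoc_mult_mat)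
      finally show "Ps i * ?D X * Ps i = Ps i * X * Ps i"
        using Pi(1)[OF i] assoc_mult_mat[OF square_mult_carrier[OF Pc[of i] Xc] Pc[of i] Pc[of i]] by simp
    qed
    have fin: "finite I" by (simp add: I_def)
    have lam0: "\<forall>i\<in>I. 0 \<le> lam i" using lam by (simp add: I_def)
    show ?thesis
      by (rule mp[OF CC[unfolded axiom_CC_def, THEN spec[of _ A], THEN spec[of _ A], THEN spec[of _ I],
              THEN spec[of _ Ps], THEN spec[of _ ?D], THEN spec[of _ lam]]],
          intro conjI A fin lam0 lsum sumR D ballI impI sysP Porth DD)
  qed
  then have SD: "star A A ?D rho = msum (?n*?n) I (\<lambda>i. ?l i \<cdot>\<^sub>m star (?n, Ps i) A (\<lambda>X. ?D (Ps i * X * Ps i)) (Ps i))"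
    using mm sumrho by (simp cong: msum_cong)
  \<comment> \<open>By \<open>axiom_P_factor\<close> the block at \<open>a\<close>, \<open>c\<close>
    of the state over time for the pinching channel is the pinched block \<open>?Y\<close>; (CC) has
    evaluated that state over time in \<open>SD\<close>.\<close>
  have "?D ?Y = msum ?n I (\<lambda>i. (?l i * Ps i $$ (a,c)) \<cdot>\<^sub>m Ps i)"
  proof (rule mat_carrier_eqI[of _ ?n ?n])
    fix b d assume bd: "b < ?n" "d < ?n"
    have "?D ?Y $$ (b,d) = star A A ?D rho $$ (a*?n+b, c*?n+d)"
      using axiom_P_factor[OF star P A A D rho] ac bd by (simp add: map_right_entry)
    also have "\<dots> = (\<Sum>i\<in>I. ?l i * (Ps i $$ (a,c) * Ps i $$ (b,d)))"
      unfolding SD using ac bd N sotfD(4)[OF star sysP A incl stP]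
      by (auto simp: smult_entry[of _ "?n*?n" "?n*?n"] intro!: sum.cong)
    finally show "?D ?Y $$ (b,d) = msum ?n I (\<lambda>i. (?l i * Ps i $$ (a,c)) \<cdot>\<^sub>m Ps i) $$ (b,d)"
      using bd Pc by (simp add: smult_entry[of _ ?n ?n] mult.assoc)
  qed auto
  then have "?D ?Y * rho = msum ?n I (\<lambda>i. (?l i * Ps i $$ (a,c)) \<cdot>\<^sub>m Ps i * rho)"
    using Pc rhoc(1) by (simp add: msum_mult)
  also have "\<dots> = msum ?n I (\<lambda>i. (?l i * Ps i $$ (a,c)) \<cdot>\<^sub>m (Ps i * rho))"
    by (rule msum_cong) (rule mult_smult_assoc_mat[OF Pc rhoc(1)])
  finally have "mtrace (?D ?Y * rho) = mtrace (msum ?n I (\<lambda>i. (?l i * Ps i $$ (a,c)) \<cdot>\<^sub>m (Ps i * rho)))"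
    by simp
  also have "\<dots> = (\<Sum>i\<in>I. ?l i * Ps i $$ (a,c) * ?l i)"
    using Pc rhoc(1) Ptr by (subst mtrace_msum) (auto simp: Prho mtrace_smult[of _ ?n] intro!: sum.cong)
  also have "\<dots> = (rho * rho) $$ (a,c)"
  proof -
    have "rho * rho = msum ?n I (\<lambda>i. ?l i \<cdot>\<^sub>m (rho * Ps i))"
      using mult_eigen_decomposition[of I Ps ?n rho ?l] Pc rhoc(1) by (simp add: sumrho)
    also have "\<dots> = msum ?n I (\<lambda>i. ?l i \<cdot>\<^sub>m (?l i \<cdot>\<^sub>m Ps i))" by (rule msum_cong) (simp add: Prho)
    finally show ?thesis using ac Pc by (simp add: smult_entry[of _ ?n ?n] mult_ac)
  qed
  \<comment> \<open>Next to a projection \<open>rho\<close> becomes the scalar \<open>lam i\<close>,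
    and cyclicity merges the two projections into one. Summing over the blocks restores
    \<open>rho\<close>.\<close>
  also have "mtrace (?D ?Y * rho) = mtrace (?Y * rho)"
  proof -
    have Yc: "?Y \<in> carrier_mat ?n ?n" by simp
    have "mtrace (?D ?Y * rho) = (\<Sum>i\<in>I. mtrace (Ps i * ?Y * Ps i * rho))"
      using Pc rhoc(1) Yc by (subst msum_mult) (auto simp: mtrace_msum simp del: assoc_mult_mat)
    also have "\<dots> = (\<Sum>i\<in>I. mtrace (?l i \<cdot>\<^sub>m (?Y * Ps i)))"
    proof (rule sum.cong[OF refl])
      fix i assume i: "i \<in> I"
      note P = Pc[of i] and YP = square_mult_carrier[OF Yc Pc[of i]]
      have "Ps i * ?Y * Ps i * rho = Ps i * ?Y * (Ps i * rho)"
        by (rule assoc_mult_mat[OF square_mult_carrier[OF P Yc] P rhoc(1)])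
      also have "\<dots> = Ps i * ?Y * (?l i \<cdot>\<^sub>m Ps i)" unfolding Prho(1)[OF i] ..
      also have "\<dots> = ?l i \<cdot>\<^sub>m (Ps i * (?Y * Ps i))"
        unfolding mult_smult_distrib[OF square_mult_carrier[OF P Yc] P] assoc_mult_mat[OF P Yc P] ..
      finally have "mtrace (Ps i * ?Y * Ps i * rho) = ?l i * mtrace (Ps i * (?Y * Ps i))"
        using mtrace_smult[OF square_mult_carrier[OF P YP]] by metis
      also have "mtrace (Ps i * (?Y * Ps i)) = mtrace (?Y * Ps i * Ps i)"
        by (rule mtrace_comm[OF P YP])
      also have "?Y * Ps i * Ps i = ?Y * Ps i" unfolding assoc_mult_mat[OF Yc P P] Pi(1)[OF i] ..
      finally show "mtrace (Ps i * ?Y * Ps i * rho) = mtrace (?l i \<cdot>\<^sub>m (?Y * Ps i))"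
        using mtrace_smult[OF YP] by simp
    qed
    also have "\<dots> = mtrace (msum ?n I (\<lambda>i. ?l i \<cdot>\<^sub>m (?Y * Ps i)))"
      using Pc Yc by (subst mtrace_msum) auto
    also have "\<dots> = mtrace (?Y * rho)"
      using mult_eigen_decomposition[of I Ps ?n ?Y ?l] Pc Yc by (simp add: sumrho)
    finally show ?thesis .
  qed
  finally show ?thesis .
qed

section \<open>Uniqueness\<close>

text \<open>The pairing of \<open>M\<close> with U \<otimes> V under the trace, written as a sum so
  that linearity in each argument is a termwise computation.\<close>

definition tpair :: "nat \<Rightarrow> cmat \<Rightarrow> cmat \<Rightarrow> cmat \<Rightarrow> complex" where
  "tpair n M U V = (\<Sum>a<n. \<Sum>b<n. \<Sum>c<n. \<Sum>d<n. M $$ (a*n+b, c*n+d) * (U $$ (c,a) * V $$ (d,b)))"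

lemma tpair_mtrace:
  assumes "M \<in> carrier_mat (n*n) (n*n)" "U \<in> carrier_mat n n" "V \<in> carrier_mat n n"
  shows "tpair n M U V = mtrace (M * kron U V)"
  using assms kron_carrier[OF assms(2,3)]
  by (simp add: tpair_def mtrace_carrier[of _ "n*n" "n*n"] sum_tensor mult_entry[of _ "n*n" "n*n" _ "n*n"]
      kron_entry[of _ n n _ n n])

lemma tpair_combination:
  assumes "X \<in> carrier_mat n n" "Y \<in> carrier_mat n n"
  shows "tpair n M (k \<cdot>\<^sub>m (X + Y)) V = k * (tpair n M X V + tpair n M Y V)"
    and "tpair n M U (k \<cdot>\<^sub>m (X + Y)) = k * (tpair n M U X + tpair n M U Y)"
proof -
  have e: "(k \<cdot>\<^sub>m (X + Y)) $$ (i,j) = k * (X $$ (i,j) + Y $$ (i,j))" if "i < n" "j < n" for i j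
    using assms that by (simp add: smult_entry[of _ n n] add_entry[of _ n n])
  show "tpair n M (k \<cdot>\<^sub>m (X + Y)) V = k * (tpair n M X V + tpair n M Y V)"
    unfolding tpair_def sum.distrib[symmetric] sum_distrib_left
    by (intro sum.cong refl) (simp add: e algebra_simps)
  show "tpair n M U (k \<cdot>\<^sub>m (X + Y)) = k * (tpair n M U X + tpair n M U Y)"
    unfolding tpair_def sum.distrib[symmetric] sum_distrib_left
    by (intro sum.cong refl) (simp add: e algebra_simps)
qed

lemma tpair_combination_op:
  assumes "M \<in> carrier_mat (n*n) (n*n)" "N \<in> carrier_mat (n*n) (n*n)"
  shows "tpair n (k \<cdot>\<^sub>m (M + N)) U V = k * (tpair n M U V + tpair n N U V)"
proof -
  have e: "(k \<cdot>\<^sub>m (M + N)) $$ (a*n+b, c*n+d) = k * (M $$ (a*n+b, c*n+d) + N $$ (a*n+b, c*n+d))"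
    if "a < n" "b < n" "c < n" "d < n" for a b c d
    using assms that by (simp add: smult_entry[of _ "n*n" "n*n"] add_entry[of _ "n*n" "n*n"])
  show ?thesis
    unfolding tpair_def sum.distrib[symmetric] sum_distrib_left
    by (intro sum.cong refl) (simp add: e distrib_left distrib_right mult.assoc)
qed

text \<open>Exposes the traces of slices against \<open>V\<close>, the quantities computed by
  \<open>sotf_square\<close>.\<close>

lemma tpair_slice:
  assumes "V \<in> carrier_mat n n"
  shows "tpair n M U V = (\<Sum>a<n. \<Sum>c<n. U $$ (c,a) * mtrace (sliceR n M a c * V))"
proof -
  have "tpair n M U V = (\<Sum>a<n. \<Sum>c<n. \<Sum>b<n. \<Sum>d<n. M $$ (a*n+b, c*n+d) * (U $$ (c,a) * V $$ (d,b)))"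
    unfolding tpair_def by (intro sum.cong refl sum.swap)
  also have "\<dots> = (\<Sum>a<n. \<Sum>c<n. U $$ (c,a) * mtrace (sliceR n M a c * V))"
  proof (rule sum.cong[OF refl], rule sum.cong[OF refl])
    fix a c
    have "mtrace (sliceR n M a c * V) = (\<Sum>b<n. \<Sum>d<n. M $$ (a*n+b, c*n+d) * V $$ (d,b))"
      using assms by (simp add: mtrace_carrier[of _ n n] mult_entry[of _ n n _ n] sliceR_entry)
    then show "(\<Sum>b<n. \<Sum>d<n. M $$ (a*n+b, c*n+d) * (U $$ (c,a) * V $$ (d,b)))
        = U $$ (c,a) * mtrace (sliceR n M a c * V)"
      by (simp add: sum_distrib_left mult.left_commute)
  qed
  finally show ?thesis .
qed

lemma tpair_swap:
  assumes "\<And>a b c d. a < n \<Longrightarrow> b < n \<Longrightarrow> c < n \<Longrightarrow> d < n \<Longrightarrow> M $$ (b*n+a, d*n+c) = M $$ (a*n+b, c*n+d)"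
  shows "tpair n M U V = tpair n M V U"
proof -
  have "tpair n M U V = (\<Sum>b<n. \<Sum>a<n. \<Sum>c<n. \<Sum>d<n. M $$ (a*n+b, c*n+d) * (U $$ (c,a) * V $$ (d,b)))"
    unfolding tpair_def by (rule sum.swap)
  also have "\<dots> = (\<Sum>b<n. \<Sum>a<n. \<Sum>d<n. \<Sum>c<n. M $$ (a*n+b, c*n+d) * (U $$ (c,a) * V $$ (d,b)))"
    by (intro sum.cong refl sum.swap)
  also have "\<dots> = tpair n M V U"
    unfolding tpair_def using assms by (intro sum.cong refl) (simp add: mult.commute)
  finally show ?thesis .
qed

text \<open>Product vectors suffice to separate operators on a tensor product over the complex
  numbers: polarization is applied once in each factor.\<close>

lemma tpair_outer_zero:
  assumes "\<And>v w. tpair n M (outer n v) (outer n w) = 0" "a < n" "b < n" "c < n" "d < n"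
  shows "M $$ (a*n+b, c*n+d) = 0"
proof -
  \<comment> \<open>The contraction of the second factor of \<open>M\<close> with \<open>w\<close>,
    an operator on the first factor.\<close>
  define X where "X = (\<lambda>w. mat n n (\<lambda>(a,c). sesq n (sliceR n M a c) w w))"
  have "sesq n (X w) v v = 0" for v w
  proof -
    have "sesq n (X w) v v = (\<Sum>a<n. \<Sum>c<n. \<Sum>b<n. \<Sum>d<n. M $$ (a*n+b, c*n+d) * (v c * cnj (v a) * (w d * cnj (w b))))"
      unfolding sesq_def[of n "X w"]
    proof (intro sum.cong refl)
      fix a c assume "a \<in> {..<n}" "c \<in> {..<n}"
      then show "cnj (v a) * X w $$ (a,c) * v c
          = (\<Sum>b<n. \<Sum>d<n. M $$ (a*n+b, c*n+d) * (v c * cnj (v a) * (w d * cnj (w b))))"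
        by (simp add: X_def sesq_def sliceR_entry sum_distrib_left sum_distrib_right mult_ac)
    qed
    also have "\<dots> = (\<Sum>a<n. \<Sum>b<n. \<Sum>c<n. \<Sum>d<n. M $$ (a*n+b, c*n+d) * (v c * cnj (v a) * (w d * cnj (w b))))"
      by (intro sum.cong refl sum.swap)
    also have "\<dots> = tpair n M (outer n v) (outer n w)"
      unfolding tpair_def by (intro sum.cong refl) simp
    finally show ?thesis using assms(1) by simp
  qed
  then have "X w $$ (a,c) = 0" for w using sesq_zero assms(2,4) by blast
  then have "sesq n (sliceR n M a c) w w = 0" for w using assms(2,4) by (simp add: X_def)
  then have "sliceR n M a c $$ (b,d) = 0" using sesq_zero assms(3,5) by blast
  then show ?thesis using assms(3,5) by (simp add: sliceR_entry)
qed

text \<open>Adding the projector before normalizing keeps the trace positive even for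
  \<open>X = 0\<close>; that case is used later to cancel the added term.\<close>

lemma normalized_state:
  assumes A: "is_system A" and X: "X \<in> ops A" "psd (sdim A) X"
  obtains t where "t \<noteq> 0" "is_state A ((1/t) \<cdot>\<^sub>m (X + sproj A))"
proof -
  let ?n = "sdim A"
  note idA = idem_sproj[OF A]
  have pr: "proj ?n (sproj A)" using A idA by (simp add: proj_def is_system_def)
  have Pc: "sproj A \<in> carrier_mat ?n ?n" and Xc: "X \<in> carrier_mat ?n ?n"
    using idem_carrier[OF idA] ops_carrier[OF X(1)] by auto
  define Z where "Z = X + sproj A"
  have Zc: "Z \<in> carrier_mat ?n ?n" using Pc by (simp add: Z_def)
  \<comment> \<open>A self-adjoint projector is a congruence of the identity by itself.\<close>
  have "psd ?n (adj (sproj A) * 1\<^sub>m ?n * sproj A)"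
    by (rule psd_congruence[OF _ Pc]) (auto simp: psd_iff less_eq_complex_def sesq_def sum_delta_mult mult.commute
        if_distrib if_distribR sum.delta sum.delta' intro!: sum_nonneg add_nonneg_nonneg cong: if_cong)
  then have psdP: "psd ?n (sproj A)" using projD[OF pr] by simp
  have psdZ: "psd ?n Z"
  proof -
    have "sesq ?n Z v v = sesq ?n X v v + sesq ?n (sproj A) v v" for v
      using Xc Pc by (simp add: Z_def sesq_def add_entry[of _ ?n ?n] distrib_left distrib_right sum.distrib)
    then show ?thesis using X(2) psdP Zc by (simp add: psd_iff)
  qed
  have tr: "mtrace Z = mtrace X + mtrace (sproj A)"
    using Xc Pc Zc by (simp add: mtrace_carrier[of _ ?n ?n] Z_def add_entry[of _ ?n ?n] sum.distrib)
  have diag: "0 \<le> mtrace Y" if "psd ?n Y" for Y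
    using psd_diag[OF that] psd_carrier[OF that] by (auto simp: mtrace_carrier[of _ ?n ?n] intro!: sum_nonneg)
  have "0 < Re (mtrace (sproj A))" using proj_mtrace[OF pr] A by (fastforce simp: is_system_def)
  then have Re: "0 < Re (mtrace Z)" using diag[OF X(2)] tr by (simp add: less_eq_complex_def)
  define t where "t = mtrace Z"
  have t: "t \<noteq> 0" "0 \<le> t" using Re diag[OF psdZ] by (auto simp: t_def)
  then have t': "0 \<le> 1/t" by (auto simp: less_eq_complex_def Re_divide Im_divide)
  have "sesq ?n ((1/t) \<cdot>\<^sub>m Z) v v = (1/t) * sesq ?n Z v v" for v
    using Zc by (simp add: sesq_def smult_entry[of _ ?n ?n] sum_divide_distrib)
  then have "psd ?n ((1/t) \<cdot>\<^sub>m Z)" using psdZ t' Zc by (simp add: psd_iff mult_nonneg_nonneg del: times_divide_eq_left)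
  moreover have "mtrace ((1/t) \<cdot>\<^sub>m Z) = 1" using mtrace_smult[OF Zc] t by (simp add: t_def)
  moreover have "(1/t) \<cdot>\<^sub>m Z \<in> ops A"
    using X(1) idA by (simp add: Z_def ops_smult ops_add sproj_ops)
  ultimately show ?thesis using that[OF t(1)] by (simp add: is_state_def Z_def)
qed

lemma sotf_ident_unique:
  assumes S: "is_sotf star" "axiom_P star" "axiom_CC star" "axiom_T star"
    and S': "is_sotf star'" "axiom_P star'" "axiom_CC star'" "axiom_T star'"
    and A: "is_system A" and rho: "is_state A rho"
  shows "star A A (\<lambda>X. X) rho = star' A A (\<lambda>X. X) rho"
proof -
  let ?n = "sdim A"
  note idA = idem_sproj[OF A]
  have id: "is_channel A A (\<lambda>X. X)" by (rule inclusion_channel) (use idA in auto)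
  have stc: "r \<in> carrier_mat ?n ?n" if "is_state A r" for r using that by (auto simp: is_state_def ops_carrier)
  have car: "st A A (\<lambda>X. X) r \<in> carrier_mat (?n*?n) (?n*?n)" if "is_sotf st" "is_state A r" for st r
    by (rule sotfD(4)[OF that(1) A A id that(2)])
  have sq: "tpair ?n (st A A (\<lambda>X. X) r) U r = (\<Sum>a<?n. \<Sum>c<?n. U $$ (c,a) * (r * r) $$ (a,c))"
    if "is_sotf st" "axiom_P st" "axiom_CC st" "is_state A r" for st r U
    unfolding tpair_slice[OF stc[OF that(4)]]
    by (intro sum.cong refl) (simp add: sotf_square[OF that(1-3) A that(4)])
  have swap: "tpair ?n (st A A (\<lambda>X. X) r) U V = tpair ?n (st A A (\<lambda>X. X) r) V U"
    if st: "is_sotf st" "axiom_T st" "is_state A r" for st r U V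
  proof (rule tpair_swap)
    let ?M = "st A A (\<lambda>X. X) r"
    have "swap_op A * ?M * swap_op A = ?M" using st(2,3) A unfolding axiom_T_def by blast
    then have "swap_conj A A ?M = ?M" using swap_op_conj[OF idA sotfD(1)[OF st(1) A A id st(3)]] by simp
    then show "?M $$ (b*?n+a, d*?n+c) = ?M $$ (a*?n+b, c*?n+d)" if "a < ?n" "b < ?n" "c < ?n" "d < ?n" for a b c d
      using swap_conj_entry[OF car[OF st(1,3)] that(1,3,2,4)] by simp
  qed
  have mid: "st A A (\<lambda>X. X) ((1/2) \<cdot>\<^sub>m (r + s)) = (1/2) \<cdot>\<^sub>m (st A A (\<lambda>X. X) r + st A A (\<lambda>X. X) s)"
    if "is_sotf st" "axiom_P st" "is_state A r" "is_state A s" for st r s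
    using that(2) sotf_midpoint[OF that(1) _ A A id that(3,4)] unfolding axiom_P_def by blast
  define f where "f = (\<lambda>U r V. tpair ?n (star A A (\<lambda>X. X) r) U V - tpair ?n (star' A A (\<lambda>X. X) r) U V)"
  \<comment> \<open>The value supplied by \<open>sotf_square\<close> depends on \<open>U\<close> and
    \<open>r\<close> only and is the same for both candidates.\<close>
  have f0: "f U r r = 0" if "is_state A r" for U r
    using sq[OF S(1-3) that] sq[OF S'(1-3) that] by (simp add: f_def)
  have fswap: "f U r V = f V r U" if "is_state A r" for U r V
    using swap[OF S(1,4) that] swap[OF S'(1,4) that] by (metis f_def)
  have fanti: "f U r s = - f U s r" if r: "is_state A r" and s: "is_state A s" for U r s
  proof -
    have m: "is_state A ((1/2) \<cdot>\<^sub>m (r + s))" by (rule state_half_sum[OF idA r s])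
    have "0 = f U ((1/2) \<cdot>\<^sub>m (r + s)) ((1/2) \<cdot>\<^sub>m (r + s))" using f0[OF m] by simp
    \<comment> \<open>One factor 1/2 comes from midpoint-affinity in the middle slot, the other from
      linearity in the last slot.\<close>
    also have "\<dots> = (1/4) * (f U r r + f U r s + f U s r + f U s s)"
      unfolding f_def mid[OF S(1,2) r s] mid[OF S'(1,2) r s]
        tpair_combination_op[OF car[OF S(1) r] car[OF S(1) s]] tpair_combination_op[OF car[OF S'(1) r] car[OF S'(1) s]]
        tpair_combination[OF stc[OF r] stc[OF s]]
      by (simp add: field_simps)
    finally show ?thesis using f0[OF r] f0[OF s] by (simp add: add_eq_0_iff)
  qed
  \<comment> \<open>Along the chain each argument visits the middle slot, hence all three are taken
    to be states here.\<close>
  have fstates: "f r s t = 0" if "is_state A r" "is_state A s" "is_state A t" for r s t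
  proof -
    have "f r s t = - f r t s" using that by (intro fanti)
    also have "f r t s = f s t r" using that by (intro fswap)
    also have "f s t r = - f s r t" using that by (intro fanti)
    also have "f s r t = f t r s" using that by (intro fswap)
    also have "f t r s = - f t s r" using that by (intro fanti)
    also have "f t s r = f r s t" using that by (intro fswap)
    finally show ?thesis by simp
  qed
  let ?M = "star A A (\<lambda>X. X) rho" and ?M' = "star' A A (\<lambda>X. X) rho" and ?P = "sproj A"
  have Pc: "?P \<in> carrier_mat ?n ?n" "adj ?P = ?P" "?P * ?P = ?P" using A by (auto simp: is_system_def)
  have fcomb: "f (k \<cdot>\<^sub>m (X + Y)) rho V = k * (f X rho V + f Y rho V)" 
    if "X \<in> carrier_mat ?n ?n" "Y \<in> carrier_mat ?n ?n" for k X Y V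
    unfolding f_def tpair_combination[OF that] by (simp add: algebra_simps)
  \<comment> \<open>Normalizing X + P shows that \<open>f\<close> at \<open>X\<close> plus
    \<open>f\<close> at \<open>P\<close> is zero for every positive \<open>X\<close>. The case X = 0
    gives zero at \<open>P\<close>, and therefore at every \<open>X\<close>.\<close>
  have fshift: "f X rho V = 0" if zero: "\<And>r. is_state A r \<Longrightarrow> f r rho V = 0" and X: "X \<in> ops A" "psd ?n X" for X V
  proof -
    have shift: "f Y rho V + f ?P rho V = 0" if Y: "Y \<in> ops A" "psd ?n Y" for Y
    proof -
      obtain t where t: "t \<noteq> 0" "is_state A ((1/t) \<cdot>\<^sub>m (Y + ?P))" using normalized_state[OF A Y] .
      then have "(1/t) * (f Y rho V + f ?P rho V) = 0"
        using zero[OF t(2)] fcomb[OF ops_carrier[OF Y(1)] Pc(1)] by simp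
      then show ?thesis using t(1) by simp
    qed
    have Z: "0\<^sub>m ?n ?n \<in> ops A" "psd ?n (0\<^sub>m ?n ?n)"
      using Pc(1) by (auto simp: ops_def psd_iff sesq_def)
    have "f (0\<^sub>m ?n ?n) rho V = 0" by (simp add: f_def tpair_def)
    with shift[OF Z] shift[OF X] show ?thesis by simp
  qed
  \<comment> \<open>Only the first slot is extended directly; the symmetry from (T) carries the
    extension over to the last slot, while \<open>rho\<close> remains in the middle.\<close>
  have fops: "f X rho Y = 0" if X: "X \<in> ops A" "psd ?n X" and Y: "Y \<in> ops A" "psd ?n Y" for X Y
  proof (rule fshift[OF _ X])
    fix r assume r: "is_state A r"
    have "f s rho r = 0" if "is_state A s" for s using fstates[OF that rho r] .
    then have "f Y rho r = 0" using fshift[OF _ Y] by blast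
    then show "f r rho Y = 0" using fswap[OF rho] by simp
  qed
  define D where "D = ?M - ?M'"
  have Mc: "?M \<in> carrier_mat (?n*?n) (?n*?n)" "?M' \<in> carrier_mat (?n*?n) (?n*?n)"
    using car[OF S(1) rho] car[OF S'(1) rho] by auto
  have De: "D $$ (a*?n+b, c*?n+d) = ?M $$ (a*?n+b, c*?n+d) - ?M' $$ (a*?n+b, c*?n+d)"
    if "a < ?n" "b < ?n" "c < ?n" "d < ?n" for a b c d
    using Mc that by (simp add: D_def)
  have fD: "f U rho V = tpair ?n D U V" for U V
    unfolding f_def tpair_def sum_subtractf[symmetric] by (intro sum.cong refl) (simp add: De left_diff_distrib)
  let ?K = "kron ?P ?P" let ?N = "?n*?n"
  have Kc: "?K \<in> carrier_mat ?N ?N" using Pc by auto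
  \<comment> \<open>Vectors of the ambient space may leave the subspace. Since states over time
    absorb P \<otimes> P, outer products can be compressed into \<open>ops A\<close> without
    changing the pairing.\<close>
  have KMK: "tpair ?n N (?P * U * ?P) (?P * V * ?P) = tpair ?n N U V"
    if N: "N \<in> ops (stensor A A)" and UV: "U \<in> carrier_mat ?n ?n" "V \<in> carrier_mat ?n ?n" for N U V
  proof -
    have Nc: "N \<in> carrier_mat ?N ?N" "?K * N = N" "N * ?K = N"
      using N ops_iff[OF idem_stensor[OF idA idA]] by auto
    have UVc: "kron U V \<in> carrier_mat ?N ?N" using UV by auto
    have PU: "?P * U \<in> carrier_mat ?n ?n" "?P * V \<in> carrier_mat ?n ?n" using Pc UV by auto
    have "kron (?P * U * ?P) (?P * V * ?P) = ?K * kron U V * ?K"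
      using kron_mult[OF PU Pc(1) Pc(1)] kron_mult[OF Pc(1) Pc(1) UV] by simp
    then have "tpair ?n N (?P * U * ?P) (?P * V * ?P) = mtrace (N * (?K * kron U V * ?K))"
      using tpair_mtrace[OF Nc(1), of "?P * U * ?P" "?P * V * ?P"] Pc UV PU by simp
    also have "N * (?K * kron U V * ?K) = N * ?K * (kron U V * ?K)"
      using Nc(1) Kc UVc assoc_mult_mat[OF Nc(1) Kc square_mult_carrier[OF UVc Kc]] by simp
    also have "\<dots> = N * kron U V * ?K" unfolding Nc(3) using assoc_mult_mat[OF Nc(1) UVc Kc] by simp
    also have "mtrace \<dots> = mtrace (?K * (N * kron U V))"
      by (rule mtrace_comm[OF square_mult_carrier[OF Nc(1) UVc] Kc])
    also have "?K * (N * kron U V) = N * kron U V" using assoc_mult_mat[OF Kc Nc(1) UVc] Nc(2) by simp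
    finally show ?thesis using tpair_mtrace[OF Nc(1) UV] by simp
  qed
  have outer_ops: "?P * outer ?n v * ?P \<in> ops A" "psd ?n (?P * outer ?n v * ?P)" for v
  proof -
    show "?P * outer ?n v * ?P \<in> ops A"
      by (rule ops_sandwich[OF idA]) (auto simp: sproj_ops[OF idA])
    show "psd ?n (?P * outer ?n v * ?P)" using psd_congruence[OF outer_psd Pc(1), of v] Pc(2) by simp
  qed
  have "tpair ?n D (outer ?n v) (outer ?n w) = 0" for v w
  proof -
    have "f (outer ?n v) rho (outer ?n w) = f (?P * outer ?n v * ?P) rho (?P * outer ?n w * ?P)"
      unfolding f_def KMK[OF sotfD(1)[OF S(1) A A id rho] outer_carrier outer_carrier]
        KMK[OF sotfD(1)[OF S'(1) A A id rho] outer_carrier outer_carrier] ..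
    also have "\<dots> = 0" by (rule fops[OF outer_ops outer_ops])
    finally show ?thesis by (simp add: fD)
  qed
  then have "D $$ (a*?n+b, c*?n+d) = 0" if "a < ?n" "b < ?n" "c < ?n" "d < ?n" for a b c d
    using tpair_outer_zero that by blast
  then show ?thesis using Mc De by (intro tensor_mat_eqI[of _ ?n ?n]) auto
qed

lemma sotf_unique:
  assumes S: "is_sotf star" "axiom_P star" "axiom_CC star" "axiom_T star"
    and S': "is_sotf star'" "axiom_P star'" "axiom_CC star'" "axiom_T star'"
    and "is_system A" "is_system B" "is_channel A B Phi" "is_state A rho"
  shows "star A B Phi rho = star' A B Phi rho"
  using axiom_P_factor[OF S(1,2) assms(9-12)] axiom_P_factor[OF S'(1,2) assms(9-12)]
    sotf_ident_unique[OF S S' assms(9,12)] by simp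

theorem theorem1:
  shows "is_sotf fp \<and> axiom_E fp \<and> axiom_P fp \<and> axiom_CC fp \<and> axiom_T fp
    \<and> (\<forall>star. is_sotf star \<and> axiom_E star \<and> axiom_P star \<and> axiom_CC star \<and> axiom_T star
         \<longrightarrow> (\<forall>A B Phi rho. is_system A \<and> is_system B \<and> is_channel A B Phi \<and> is_state A rho
                \<longrightarrow> star A B Phi rho = fp A B Phi rho))"
  using is_sotf_fp axiom_E_fp axiom_P_fp axiom_CC_fp axiom_T_fp sotf_unique by blast

end
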